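(* Let $G$ be a Lie group whose Lie algebra ${\mathfrak g}$ is equipped with an invariant non-degenerate symmetric bilinear form $\langle~,~\rangle_{\mathfrak g}$. Let $G_0\subset G$ be the dense open subset of elements $g$ such that $-1$ is not an eigenvalue of $\mathrm{Ad}_g$, let $\pi$ be the bivector field on $G_0$ defined by $\pi^\sharp(\alpha^L+\alpha^R)=2(\underline\alpha^L-\underline\alpha^R)$ for all $\alpha\in{\mathfrak g}^*$, and let $\psi$ be the bi-invariant 3-form on $G$ (restricted to $G_0$), called the Cartan 3-form, whose value on ${\mathfrak g}$ is $\psi(X,Y,Z)=\frac12\langle X,[Y,Z]\rangle_{\mathfrak g}$. Then the twisted Poisson manifold $(G_0,\pi,\psi)$ is unimodular, i.e. its modular class vanishes.
   Context: For $\alpha\in{\mathfrak g}^*$, $\underline\alpha\in{\mathfrak g}$ is its image under the isomorphism ${\mathfrak g}^*\simeq{\mathfrak g}$ induced by $\langle~,~\rangle_{\mathfrak g}$; superscripts $L$, $R$ denote the corresponding left-invariant and right-invariant vector fields and forms on $G$, so that $d\alpha^L=(d_{\mathfrak g}\alpha)^L$ and $d\alpha^R=-(d_{\mathfrak g}\alpha)^R$, where $d_{\mathfrak g}$ is the Chevalley-Eilenberg differential and $d$ the de Rham differential. The set $G_0$ is equivalently the set of $g\in G$ such that $\alpha\mapsto\alpha^R(g)+\alpha^L(g)$ is an isomorphism ${\mathfrak g}^*\to T_g^*G$. The pair $(\pi,\psi)$ is taken as a twisted Poisson structure on $G_0$ (an example of Ševera and Weinstein). Conventions. $(X\wedge Y)(\alpha,\beta)=\alpha(X)\beta(Y)-\alpha(Y)\beta(X)$;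 $i_X$ is the interior product of forms by a vector $X$, $i_{X_1\wedge\dots\wedge X_p}=i_{X_1}\circ\dots\circ i_{X_p}$; for a bivector $\pi$, $\langle\beta,\pi^\sharp\alpha\rangle=\pi(\alpha,\beta)$, so $i_\pi(\alpha\wedge\beta)=-\pi(\alpha,\beta)$; $\wedge^q\pi^\sharp$ maps $\alpha_1\wedge\dots\wedge\alpha_q$ to $\pi^\sharp\alpha_1\wedge\dots\wedge\pi^\sharp\alpha_q$. The bracket $[~,~]$ on multivector fields is the graded biderivation extending the Lie bracket, with $[a,f]=a\cdot f$ for vector fields $a$ and functions $f$, and $[a_1\wedge\dots\wedge a_q,b_1\wedge\dots\wedge b_r]=\sum_{k,\ell}(-1)^{k+\ell}[a_k,b_\ell]\wedge a_1\wedge\dots\widehat{a_k}\dots\wedge a_q\wedge b_1\wedge\dots\widehat{b_\ell}\dots\wedge b_r$. A twisted Poisson manifold $(M,\pi,\psi)$ is a manifold with a bivector field $\pi$ and a closed 3-form $\psi$ such that $\frac12[\pi,\pi]=(\wedge^3\pi^\sharp)\psi$. For a vector $X$ let $\psi^{(2)}(X)$ be the bivector $(\xi,\eta)\mapsto\psi(\pi^\sharp\xi,\pi^\sharp\eta,X)$. The differential $d_{\pi,\psi}$ on multivector fields is $d_{\pi,\psi}=[\pi,\cdot\,]+\underline d_{\pi,\psi}$, with $\underline d_{\pi,\psi}(X_1\wedge\dots\wedge X_p)=\sum_k(-1)^{k+1}\psi^{(2)}(X_k)\wedge X_1\wedge\dots\widehat{X_k}\dots\wedge X_p$, zero on functions.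 For a volume form $\lambda$, $X_{\pi,\lambda}$ is the vector field with $\langle\alpha,X_{\pi,\lambda}\rangle\lambda={\mathcal L}_{\pi^\sharp\alpha}\lambda-(i_\pi d\alpha)\lambda$ for all 1-forms $\alpha$, and $Y_{\pi,\psi}=\pi^\sharp(i_\pi\psi)$. The modular class of $(M,\pi,\psi)$ is the $d_{\pi,\psi}$-cohomology class of $Z_{\pi,\psi,\lambda}=X_{\pi,\lambda}+Y_{\pi,\psi}$ (independent of $\lambda$). *)

theory Defs
  imports "HOL-Analysis.Analysis" "HOL-Algebra.Group"
begin

section \<open>Smooth manifolds\<close>

text \<open>The model space is a real inner product space that every manifold below assumes to be of
finite dimension. This is more general than the class of Euclidean spaces, because it admits
dimension 0. In finite dimension, the following is the usual notion of class \<open>C\<^sup>k\<close>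
on an open set: all directional derivatives are of class \<open>C\<^bsup>k-1\<^esup>\<close>.\<close>

primrec Ck_on :: "nat \<Rightarrow> 'a::real_normed_vector set \<Rightarrow> ('a \<Rightarrow> 'b::real_normed_vector) \<Rightarrow> bool" where
  "Ck_on 0 S f \<longleftrightarrow> continuous_on S f"
| "Ck_on (Suc k) S f \<longleftrightarrow>
     (\<forall>x\<in>S. f differentiable (at x)) \<and> (\<forall>v. Ck_on k S (\<lambda>x. frechet_derivative f (at x) v))"

definition Cinf_on :: "'a::real_normed_vector set \<Rightarrow> ('a \<Rightarrow> 'b::real_normed_vector) \<Rightarrow> bool" where
  "Cinf_on S f \<longleftrightarrow> (\<forall>k. Ck_on k S f)"

type_synonym ('g, 'e) chart = "'g set \<times> ('g \<Rightarrow> 'e)"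

definition is_chart :: "('g::topological_space, 'e::real_normed_vector) chart \<Rightarrow> bool" where
  "is_chart c \<longleftrightarrow> (case c of (U, \<phi>) \<Rightarrow>
     open U \<and> open (\<phi> ` U) \<and> homeomorphism U (\<phi> ` U) \<phi> (inv_into U \<phi>))"

definition chart_inv :: "('g, 'e) chart \<Rightarrow> 'e \<Rightarrow> 'g" where
  "chart_inv c = inv_into (fst c) (snd c)"

definition smooth_atlas :: "('g::topological_space, 'e::real_normed_vector) chart set \<Rightarrow> bool" where
  "smooth_atlas A \<longleftrightarrow>
     (\<forall>c\<in>A. is_chart c) \<and> (\<Union>c\<in>A. fst c) = UNIV \<and>
     (\<forall>c\<in>A. \<forall>c'\<in>A. Cinf_on (snd c ` (fst c \<inter> fst c')) (snd c' \<circ> chart_inv c))"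

definition prod_atlas :: "('g, 'e) chart set \<Rightarrow> ('h, 'f) chart set \<Rightarrow> ('g \<times> 'h, 'e \<times> 'f) chart set" where
  "prod_atlas A B = {(U \<times> V, map_prod \<phi> \<psi>) | U \<phi> V \<psi>. (U, \<phi>) \<in> A \<and> (V, \<psi>) \<in> B}"

definition smooth_map ::
  "('g::topological_space, 'e::real_normed_vector) chart set \<Rightarrow>
   ('h::topological_space, 'f::real_normed_vector) chart set \<Rightarrow> ('g \<Rightarrow> 'h) \<Rightarrow> bool" where
  "smooth_map A B F \<longleftrightarrow> continuous_on UNIV F \<and>
     (\<forall>c\<in>A. \<forall>c'\<in>B. Cinf_on (snd c ` (fst c \<inter> F -` fst c')) (snd c' \<circ> F \<circ> chart_inv c))"

text \<open>Smooth real functions on the open submanifold \<open>U\<close>.\<close>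

definition smooth_fun :: "('g, 'e::real_normed_vector) chart set \<Rightarrow> 'g set \<Rightarrow> ('g \<Rightarrow> real) \<Rightarrow> bool" where
  "smooth_fun A U f \<longleftrightarrow> (\<forall>c\<in>A. Cinf_on (snd c ` (U \<inter> fst c)) (f \<circ> chart_inv c))"

section \<open>Tangent vectors, vector fields and forms\<close>

text \<open>A tangent vector at \<open>p\<close> is represented by its coordinates in a chosen chart around
\<open>p\<close>. So the tangent space at each point is a copy of \<open>'e\<close>, the cotangent space is the dual
\<open>'e \<Rightarrow>\<^sub>L real\<close>, and a vector field is a function \<open>'g \<Rightarrow> 'e\<close>. The coordinates of
vectors at different points refer to different charts in general.\<close>

definition chart_at :: "('g, 'e) chart set \<Rightarrow> 'g \<Rightarrow> ('g, 'e) chart" where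
  "chart_at A p = (SOME c. c \<in> A \<and> p \<in> fst c)"

definition tangent_map ::
  "('g, 'e::real_normed_vector) chart set \<Rightarrow> ('g \<Rightarrow> 'g) \<Rightarrow> 'g \<Rightarrow> 'e \<Rightarrow> 'e" where
  "tangent_map A F p = frechet_derivative (snd (chart_at A (F p)) \<circ> F \<circ> chart_inv (chart_at A p))
                         (at (snd (chart_at A p) p))"

text \<open>The derivative \<open>v \<cdot> f\<close> of a function along a tangent vector \<open>v\<close> at \<open>p\<close>.\<close>

definition dirder :: "('g, 'e::real_normed_vector) chart set \<Rightarrow> 'g \<Rightarrow> 'e \<Rightarrow> ('g \<Rightarrow> real) \<Rightarrow> real" where
  "dirder A p v f = frechet_derivative (f \<circ> chart_inv (chart_at A p)) (at (snd (chart_at A p) p)) v"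

definition vfield :: "('g::topological_space, 'e::real_normed_vector) chart set \<Rightarrow> 'g set \<Rightarrow> ('g \<Rightarrow> 'e) \<Rightarrow> bool" where
  "vfield A U X \<longleftrightarrow> (\<forall>V f. open V \<and> V \<subseteq> U \<and> smooth_fun A V f \<longrightarrow>
                         smooth_fun A V (\<lambda>p. dirder A p (X p) f))"

definition lie_bracket ::
  "('g::topological_space, 'e::real_normed_vector) chart set \<Rightarrow> ('g \<Rightarrow> 'e) \<Rightarrow> ('g \<Rightarrow> 'e) \<Rightarrow> 'g \<Rightarrow> 'e" where
  "lie_bracket A X Y p = (THE v. \<forall>V f. open V \<and> p \<in> V \<and> smooth_fun A V f \<longrightarrow>
     dirder A p v f = dirder A p (X p) (\<lambda>q. dirder A q (Y q) f)
                    - dirder A p (Y p) (\<lambda>q. dirder A q (X q) f))"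

text \<open>Alternating \<open>k\<close>-linear functions, with a list as argument: \<open>k\<close>-forms at a point for
\<open>'v = 'e\<close>, and \<open>k\<close>-vectors at a point for \<open>'v = 'e \<Rightarrow>\<^sub>L real\<close>. Only the values on
lists of length \<open>k\<close> matter.\<close>

definition alternating :: "nat \<Rightarrow> ('v::real_vector list \<Rightarrow> real) \<Rightarrow> bool" where
  "alternating k T \<longleftrightarrow> (\<forall>xs. length xs = k \<longrightarrow>
     (\<forall>i<k. linear (\<lambda>x. T (xs[i := x]))) \<and>
     (\<forall>i j. i < j \<and> j < k \<and> xs ! i = xs ! j \<longrightarrow> T xs = 0))"

definition dform :: "('g::topological_space, 'e::real_normed_vector) chart set \<Rightarrow> 'g set \<Rightarrow> nat \<Rightarrow>
    ('g \<Rightarrow> 'e list \<Rightarrow> real) \<Rightarrow> bool" where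
  "dform A U k \<omega> \<longleftrightarrow> (\<forall>p\<in>U. alternating k (\<omega> p)) \<and>
     (\<forall>V Xs. open V \<and> V \<subseteq> U \<and> length Xs = k \<and> (\<forall>X\<in>set Xs. vfield A V X) \<longrightarrow>
        smooth_fun A V (\<lambda>p. \<omega> p (map (\<lambda>X. X p) Xs)))"

text \<open>1-forms are written as covector fields; \<open>form_of\<close> converts them to forms on lists.\<close>

definition oneform :: "('g::topological_space, 'e::real_normed_vector) chart set \<Rightarrow> 'g set \<Rightarrow>
    ('g \<Rightarrow> 'e \<Rightarrow>\<^sub>L real) \<Rightarrow> bool" where
  "oneform A U \<alpha> \<longleftrightarrow> (\<forall>V X. open V \<and> V \<subseteq> U \<and> vfield A V X \<longrightarrow>
                          smooth_fun A V (\<lambda>p. blinfun_apply (\<alpha> p) (X p)))"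

definition form_of :: "('g \<Rightarrow> 'e::real_normed_vector \<Rightarrow>\<^sub>L real) \<Rightarrow> 'g \<Rightarrow> 'e list \<Rightarrow> real" where
  "form_of \<alpha> p vs = blinfun_apply (\<alpha> p) (hd vs)"

definition mvfield :: "('g::topological_space, 'e::real_normed_vector) chart set \<Rightarrow> 'g set \<Rightarrow> nat \<Rightarrow>
    ('g \<Rightarrow> ('e \<Rightarrow>\<^sub>L real) list \<Rightarrow> real) \<Rightarrow> bool" where
  "mvfield A U k P \<longleftrightarrow> (\<forall>p\<in>U. alternating k (P p)) \<and>
     (\<forall>V \<alpha>s. open V \<and> V \<subseteq> U \<and> length \<alpha>s = k \<and> (\<forall>\<alpha>\<in>set \<alpha>s. oneform A V \<alpha>) \<longrightarrow>
        smooth_fun A V (\<lambda>p. P p (map (\<lambda>\<alpha>. \<alpha> p) \<alpha>s)))"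

text \<open>The vector field on the domain of the chart at \<open>p\<close> which has value \<open>v\<close> at \<open>p\<close> and constant
components in that chart.\<close>

definition coord_ext :: "('g, 'e::real_normed_vector) chart set \<Rightarrow> 'g \<Rightarrow> 'e \<Rightarrow> 'g \<Rightarrow> 'e" where
  "coord_ext A p v q = frechet_derivative (snd (chart_at A q) \<circ> chart_inv (chart_at A p))
                         (at (snd (chart_at A p) q)) v"

text \<open>The exterior derivative at \<open>p\<close>: the invariant formula, applied to fields with constant
components in the chart at \<open>p\<close>, whose brackets vanish.\<close>

definition ext_deriv :: "('g, 'e::real_normed_vector) chart set \<Rightarrow> ('g \<Rightarrow> 'e list \<Rightarrow> real) \<Rightarrow>
    'g \<Rightarrow> 'e list \<Rightarrow> real" where
  "ext_deriv A \<omega> p vs = (\<Sum>i<length vs. (-1) ^ i *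
     dirder A p (vs ! i) (\<lambda>q. \<omega> q (map (\<lambda>v. coord_ext A p v q) (take i vs @ drop (Suc i) vs))))"

text \<open>The Lie derivative at \<open>p\<close>:
\<open>(\<L>\<^sub>X \<omega>)(Y\<^sub>1,\<dots>) = X \<cdot> \<omega>(Y\<^sub>1,\<dots>) - \<Sum>\<^sub>i \<omega>(\<dots>,[X,Y\<^sub>i],\<dots>)\<close>,
where \<open>Y\<^sub>i\<close> is the local extension \<open>coord_ext\<close> of the \<open>i\<close>-th argument.\<close>

definition lie_deriv :: "('g::topological_space, 'e::real_normed_vector) chart set \<Rightarrow> ('g \<Rightarrow> 'e) \<Rightarrow>
    ('g \<Rightarrow> 'e list \<Rightarrow> real) \<Rightarrow> 'g \<Rightarrow> 'e list \<Rightarrow> real" where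
  "lie_deriv A X \<omega> p vs =
     dirder A p (X p) (\<lambda>q. \<omega> q (map (\<lambda>v. coord_ext A p v q) vs))
     - (\<Sum>i<length vs. \<omega> p (vs[i := lie_bracket A X (coord_ext A p (vs ! i)) p]))"

definition volume_form :: "('g::topological_space, 'e::real_normed_vector) chart set \<Rightarrow> 'g set \<Rightarrow>
    ('g \<Rightarrow> 'e list \<Rightarrow> real) \<Rightarrow> bool" where
  "volume_form A U \<mu> \<longleftrightarrow> dform A U (dim (UNIV :: 'e set)) \<mu> \<and>
     (\<forall>p\<in>U. \<exists>vs. length vs = dim (UNIV :: 'e set) \<and> \<mu> p vs \<noteq> 0)"

section \<open>Bivectors\<close>

text \<open>\<open>wedge [X\<^sub>1,\<dots>,X\<^sub>k] [\<alpha>\<^sub>1,\<dots>,\<alpha>\<^sub>k] = det (\<alpha>\<^sub>i(X\<^sub>j))\<close>\<close>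

definition wedge :: "'e::real_normed_vector list \<Rightarrow> ('e \<Rightarrow>\<^sub>L real) list \<Rightarrow> real" where
  "wedge Xs \<alpha>s = (\<Sum>\<sigma> | \<sigma> permutes {..<length Xs}.
     of_int (sign \<sigma>) * (\<Prod>i<length Xs. blinfun_apply (\<alpha>s ! \<sigma> i) (Xs ! i)))"

definition is_wedge_sum :: "(('e::real_normed_vector \<Rightarrow>\<^sub>L real) list \<Rightarrow> real) \<Rightarrow> ('e \<times> 'e) list \<Rightarrow> bool" where
  "is_wedge_sum P xys \<longleftrightarrow> (\<forall>\<alpha> \<beta>. P [\<alpha>, \<beta>] = (\<Sum>(x, y)\<leftarrow>xys. wedge [x, y] [\<alpha>, \<beta>]))"

text \<open>A bivector at a point is a sum of decomposables \<open>x \<and> y\<close>. Operations that are linear in the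
bivector are defined by their value on decomposables, through a chosen such sum.\<close>

definition wedge_sum :: "(('e::real_normed_vector \<Rightarrow>\<^sub>L real) list \<Rightarrow> real) \<Rightarrow> ('e \<times> 'e) list" where
  "wedge_sum P = (SOME xys. is_wedge_sum P xys)"

text \<open>The vector \<open>\<pi>\<^sup>\<sharp>\<alpha>\<close> with \<open>\<langle>\<beta>, \<pi>\<^sup>\<sharp>\<alpha>\<rangle> = \<pi>(\<alpha>,\<beta>)\<close>.\<close>

definition sharp :: "(('e::real_normed_vector \<Rightarrow>\<^sub>L real) list \<Rightarrow> real) \<Rightarrow> ('e \<Rightarrow>\<^sub>L real) \<Rightarrow> 'e" where
  "sharp P \<alpha> = (THE v. \<forall>\<beta>. blinfun_apply \<beta> v = P [\<alpha>, \<beta>])"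

text \<open>Interior product of a form by a bivector, with \<open>i\<^bsub>x\<and>y\<^esub> = i\<^sub>x \<circ> i\<^sub>y\<close>, where \<open>i\<^sub>x\<close> inserts \<open>x\<close> as
the first argument.\<close>

definition contract :: "(('e::real_normed_vector \<Rightarrow>\<^sub>L real) list \<Rightarrow> real) \<Rightarrow> ('e list \<Rightarrow> real) \<Rightarrow>
    'e list \<Rightarrow> real" where
  "contract P \<omega> vs = (\<Sum>(x, y)\<leftarrow>wedge_sum P. \<omega> (y # x # vs))"

text \<open>\<open>[\<pi>, f]\<close> for a function \<open>f\<close>: by the biderivation rule and \<open>[x, f] = x \<cdot> f\<close> one has
\<open>[x \<and> y, f] = (y \<cdot> f) x - (x \<cdot> f) y\<close>.\<close>

definition bracket_fun :: "('g, 'e::real_normed_vector) chart set \<Rightarrow>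
    ('g \<Rightarrow> ('e \<Rightarrow>\<^sub>L real) list \<Rightarrow> real) \<Rightarrow> ('g \<Rightarrow> real) \<Rightarrow> 'g \<Rightarrow> 'e" where
  "bracket_fun A \<pi> f p =
     (\<Sum>(x, y)\<leftarrow>wedge_sum (\<pi> p). dirder A p y f *\<^sub>R x - dirder A p x f *\<^sub>R y)"

text \<open>The trivector field \<open>[\<pi>, \<pi>]\<close>, where \<open>\<pi>\<close> is the sum of the \<open>X \<and> Y\<close> for the pairs \<open>(X, Y)\<close> of
vector fields in a list. The four terms are those of the formula for \<open>[X \<and> Y, Z \<and> W]\<close>.\<close>

definition bracket_self :: "('g::topological_space, 'e::real_normed_vector) chart set \<Rightarrow>
    (('g \<Rightarrow> 'e) \<times> ('g \<Rightarrow> 'e)) list \<Rightarrow> 'g \<Rightarrow> ('e \<Rightarrow>\<^sub>L real) list \<Rightarrow> real" where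
  "bracket_self A XYs p \<alpha>s = (\<Sum>(X, Y)\<leftarrow>XYs. \<Sum>(Z, W)\<leftarrow>XYs.
       wedge [lie_bracket A X Z p, Y p, W p] \<alpha>s - wedge [lie_bracket A X W p, Y p, Z p] \<alpha>s
     - wedge [lie_bracket A Y Z p, X p, W p] \<alpha>s + wedge [lie_bracket A Y W p, X p, Z p] \<alpha>s)"

section \<open>Twisted Poisson structures and the modular class\<close>

text \<open>The open submanifold \<open>U\<close> with a bivector field \<open>\<pi>\<close> and a closed 3-form \<open>\<psi>\<close> such that
\<open>1/2 [\<pi>, \<pi>] = (\<and>\<^sup>3 \<pi>\<^sup>\<sharp>) \<psi>\<close>. The bracket is computed from the expressions of \<open>\<pi>\<close> as a sum of
decomposables on open subsets; such expressions exist around every point.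

The trivector on the right is taken to be \<open>(\<alpha>,\<beta>,\<gamma>) \<mapsto> \<psi>(\<pi>\<^sup>\<sharp>\<alpha>, \<pi>\<^sup>\<sharp>\<beta>, \<pi>\<^sup>\<sharp>\<gamma>)\<close>, in line with
\<open>\<psi>\<^bsup>(2)\<^esup>(X)(\<xi>,\<eta>) = \<psi>(\<pi>\<^sup>\<sharp>\<xi>, \<pi>\<^sup>\<sharp>\<eta>, X)\<close>. This is the sign for which \<open>d\<^bsub>\<pi>,\<psi>\<^esub>\<close> has square zero: on a
function \<open>f\<close>, this amounts to \<open>\<L>\<^bsub>\<pi>\<^sup>\<sharp>df\<^esub> \<pi> = \<psi>\<^bsup>(2)\<^esup>(\<pi>\<^sup>\<sharp>df)\<close>, and for functions \<open>f\<close>, \<open>g\<close>, \<open>h\<close> the left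
side at \<open>(dg, dh)\<close> is \<open>1/2 [\<pi>, \<pi>](df, dg, dh)\<close>. If instead \<open>\<and>\<^sup>3 \<pi>\<^sup>\<sharp>\<close> is paired with covectors by
determinants, the opposite sign results, because \<open>\<pi>\<^sup>\<sharp>\<close> is skew.\<close>

definition twisted_poisson :: "('g::topological_space, 'e::real_normed_vector) chart set \<Rightarrow> 'g set \<Rightarrow>
    ('g \<Rightarrow> ('e \<Rightarrow>\<^sub>L real) list \<Rightarrow> real) \<Rightarrow> ('g \<Rightarrow> 'e list \<Rightarrow> real) \<Rightarrow> bool" where
  "twisted_poisson A U \<pi> \<psi> \<longleftrightarrow> open U \<and> mvfield A U 2 \<pi> \<and> dform A U 3 \<psi> \<and>
     (\<forall>p\<in>U. \<forall>vs. length vs = 4 \<longrightarrow> ext_deriv A \<psi> p vs = 0) \<and>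
     (\<forall>V XYs. open V \<and> V \<subseteq> U \<and> (\<forall>(X, Y)\<in>set XYs. vfield A V X \<and> vfield A V Y) \<and>
        (\<forall>p\<in>V. is_wedge_sum (\<pi> p) (map (\<lambda>(X, Y). (X p, Y p)) XYs)) \<longrightarrow>
        (\<forall>p\<in>V. \<forall>\<alpha> \<beta> \<gamma>. 1/2 * bracket_self A XYs p [\<alpha>, \<beta>, \<gamma>] =
           \<psi> p [sharp (\<pi> p) \<alpha>, sharp (\<pi> p) \<beta>, sharp (\<pi> p) \<gamma>]))"

text \<open>\<open>X\<^bsub>\<pi>,\<mu>\<^esub>\<close>, for a volume form \<open>\<mu>\<close> on \<open>U\<close>.\<close>

definition X_field :: "('g::topological_space, 'e::real_normed_vector) chart set \<Rightarrow> 'g set \<Rightarrow>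
    ('g \<Rightarrow> ('e \<Rightarrow>\<^sub>L real) list \<Rightarrow> real) \<Rightarrow> ('g \<Rightarrow> 'e list \<Rightarrow> real) \<Rightarrow> 'g \<Rightarrow> 'e" where
  "X_field A U \<pi> \<mu> p = (THE v. \<forall>\<alpha> vs. oneform A U \<alpha> \<and> length vs = dim (UNIV :: 'e set) \<longrightarrow>
     blinfun_apply (\<alpha> p) v * \<mu> p vs =
       lie_deriv A (\<lambda>q. sharp (\<pi> q) (\<alpha> q)) \<mu> p vs
       - contract (\<pi> p) (ext_deriv A (form_of \<alpha>) p) [] * \<mu> p vs)"

definition Y_field :: "('g \<Rightarrow> ('e::real_normed_vector \<Rightarrow>\<^sub>L real) list \<Rightarrow> real) \<Rightarrow>
    ('g \<Rightarrow> 'e list \<Rightarrow> real) \<Rightarrow> 'g \<Rightarrow> 'e" where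
  "Y_field \<pi> \<psi> p = sharp (\<pi> p) (Blinfun (\<lambda>v. contract (\<pi> p) (\<psi> p) [v]))"

definition Z_field :: "('g::topological_space, 'e::real_normed_vector) chart set \<Rightarrow> 'g set \<Rightarrow>
    ('g \<Rightarrow> ('e \<Rightarrow>\<^sub>L real) list \<Rightarrow> real) \<Rightarrow> ('g \<Rightarrow> 'e list \<Rightarrow> real) \<Rightarrow> ('g \<Rightarrow> 'e list \<Rightarrow> real) \<Rightarrow>
    'g \<Rightarrow> 'e" where
  "Z_field A U \<pi> \<psi> \<mu> p = X_field A U \<pi> \<mu> p + Y_field \<pi> \<psi> p"

text \<open>The degree 1 coboundaries of \<open>d\<^bsub>\<pi>,\<psi>\<^esub>\<close>. On functions \<open>d\<^bsub>\<pi>,\<psi>\<^esub>\<close> is \<open>[\<pi>, \<cdot>]\<close>, because the term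
with \<open>\<psi>\<close> is zero there. Fields on \<open>U\<close> are compared on \<open>U\<close> only.\<close>

definition coboundaries :: "('g, 'e::real_normed_vector) chart set \<Rightarrow> 'g set \<Rightarrow>
    ('g \<Rightarrow> ('e \<Rightarrow>\<^sub>L real) list \<Rightarrow> real) \<Rightarrow> ('g \<Rightarrow> 'e) set" where
  "coboundaries A U \<pi> = {W. \<exists>f. smooth_fun A U f \<and> (\<forall>p\<in>U. W p = bracket_fun A \<pi> f p)}"

definition cohomology_class :: "('g, 'e::real_normed_vector) chart set \<Rightarrow> 'g set \<Rightarrow>
    ('g \<Rightarrow> ('e \<Rightarrow>\<^sub>L real) list \<Rightarrow> real) \<Rightarrow> ('g \<Rightarrow> 'e) \<Rightarrow> ('g \<Rightarrow> 'e) set" where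
  "cohomology_class A U \<pi> Z = {W. (\<lambda>p. W p - Z p) \<in> coboundaries A U \<pi>}"

text \<open>The modular class does not depend on the volume form. Vanishing is required for all volume
forms, and the existence of one is part of the definition.\<close>

definition unimodular :: "('g::topological_space, 'e::real_normed_vector) chart set \<Rightarrow> 'g set \<Rightarrow>
    ('g \<Rightarrow> ('e \<Rightarrow>\<^sub>L real) list \<Rightarrow> real) \<Rightarrow> ('g \<Rightarrow> 'e list \<Rightarrow> real) \<Rightarrow> bool" where
  "unimodular A U \<pi> \<psi> \<longleftrightarrow> (\<exists>\<mu>. volume_form A U \<mu>) \<and>
     (\<forall>\<mu>. volume_form A U \<mu> \<longrightarrow>
        cohomology_class A U \<pi> (Z_field A U \<pi> \<psi> \<mu>) = cohomology_class A U \<pi> (\<lambda>p. 0))"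

section \<open>Lie groups\<close>

text \<open>The underlying set of the group is a whole type. Second countability and
connectedness are not required.\<close>

locale lie_group = group G for G :: "('g::t2_space, 'm) monoid_scheme" (structure) +
  fixes A :: "('g, 'e::real_inner) chart set"
  assumes carrier: "carrier G = UNIV"
    and finite_dim: "\<exists>B :: 'e set. finite B \<and> span B = UNIV"
    and atlas: "smooth_atlas A"
    and smooth_mult: "smooth_map (prod_atlas A A) A (\<lambda>(x, y). x \<otimes> y)"
    and smooth_inv: "smooth_map A A (\<lambda>x. inv x)"

text \<open>The Lie algebra is the tangent space \<open>'e\<close> at the unit, with the bracket of left-invariant
vector fields.\<close>

definition left_field :: "('g, 'm) monoid_scheme \<Rightarrow> ('g, 'e::real_normed_vector) chart set \<Rightarrow>
    'e \<Rightarrow> 'g \<Rightarrow> 'e" where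
  "left_field G A X g = tangent_map A (\<lambda>x. g \<otimes>\<^bsub>G\<^esub> x) \<one>\<^bsub>G\<^esub> X"

definition right_field :: "('g, 'm) monoid_scheme \<Rightarrow> ('g, 'e::real_normed_vector) chart set \<Rightarrow>
    'e \<Rightarrow> 'g \<Rightarrow> 'e" where
  "right_field G A X g = tangent_map A (\<lambda>x. x \<otimes>\<^bsub>G\<^esub> g) \<one>\<^bsub>G\<^esub> X"

definition left_form :: "('g, 'm) monoid_scheme \<Rightarrow> ('g, 'e::real_normed_vector) chart set \<Rightarrow>
    ('e \<Rightarrow>\<^sub>L real) \<Rightarrow> 'g \<Rightarrow> 'e \<Rightarrow>\<^sub>L real" where
  "left_form G A \<alpha> g =
     Blinfun (\<lambda>v. blinfun_apply \<alpha> (tangent_map A (\<lambda>x. inv\<^bsub>G\<^esub> g \<otimes>\<^bsub>G\<^esub> x) g v))"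

definition right_form :: "('g, 'm) monoid_scheme \<Rightarrow> ('g, 'e::real_normed_vector) chart set \<Rightarrow>
    ('e \<Rightarrow>\<^sub>L real) \<Rightarrow> 'g \<Rightarrow> 'e \<Rightarrow>\<^sub>L real" where
  "right_form G A \<alpha> g =
     Blinfun (\<lambda>v. blinfun_apply \<alpha> (tangent_map A (\<lambda>x. x \<otimes>\<^bsub>G\<^esub> inv\<^bsub>G\<^esub> g) g v))"

definition Lie_br :: "('g::topological_space, 'm) monoid_scheme \<Rightarrow>
    ('g, 'e::real_normed_vector) chart set \<Rightarrow> 'e \<Rightarrow> 'e \<Rightarrow> 'e" where
  "Lie_br G A X Y = lie_bracket A (left_field G A X) (left_field G A Y) \<one>\<^bsub>G\<^esub>"

definition Ad :: "('g, 'm) monoid_scheme \<Rightarrow> ('g, 'e::real_normed_vector) chart set \<Rightarrow>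
    'g \<Rightarrow> 'e \<Rightarrow> 'e" where
  "Ad G A g = tangent_map A (\<lambda>x. g \<otimes>\<^bsub>G\<^esub> x \<otimes>\<^bsub>G\<^esub> inv\<^bsub>G\<^esub> g) \<one>\<^bsub>G\<^esub>"

definition bi_invariant :: "('g, 'm) monoid_scheme \<Rightarrow> ('g, 'e::real_normed_vector) chart set \<Rightarrow>
    nat \<Rightarrow> ('g \<Rightarrow> 'e list \<Rightarrow> real) \<Rightarrow> bool" where
  "bi_invariant G A k \<omega> \<longleftrightarrow> (\<forall>g h vs. length vs = k \<longrightarrow>
     \<omega> (g \<otimes>\<^bsub>G\<^esub> h) (map (tangent_map A (\<lambda>x. g \<otimes>\<^bsub>G\<^esub> x) h) vs) = \<omega> h vs \<and>
     \<omega> (h \<otimes>\<^bsub>G\<^esub> g) (map (tangent_map A (\<lambda>x. x \<otimes>\<^bsub>G\<^esub> g) h) vs) = \<omega> h vs)"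

text \<open>Invariance is invariance under the adjoint action of the Lie algebra. For a disconnected
group it is weaker than invariance under \<open>Ad\<close>.\<close>

definition invariant_metric :: "('g::topological_space, 'm) monoid_scheme \<Rightarrow>
    ('g, 'e::real_normed_vector) chart set \<Rightarrow> ('e \<Rightarrow> 'e \<Rightarrow> real) \<Rightarrow> bool" where
  "invariant_metric G A B \<longleftrightarrow> bilinear B \<and> (\<forall>x y. B x y = B y x) \<and>
     (\<forall>x. (\<forall>y. B x y = 0) \<longrightarrow> x = 0) \<and>
     (\<forall>x y z. B (Lie_br G A z x) y + B x (Lie_br G A z y) = 0)"

definition metric_dual :: "('e::real_normed_vector \<Rightarrow> 'e \<Rightarrow> real) \<Rightarrow> ('e \<Rightarrow>\<^sub>L real) \<Rightarrow> 'e" where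
  "metric_dual B \<alpha> = (THE x. \<forall>y. B x y = blinfun_apply \<alpha> y)"

text \<open>The elements \<open>g\<close> such that \<open>-1\<close> is not an eigenvalue of \<open>Ad\<^sub>g\<close>.\<close>

definition G_zero :: "('g, 'm) monoid_scheme \<Rightarrow> ('g, 'e::real_normed_vector) chart set \<Rightarrow> 'g set" where
  "G_zero G A = {g. \<not> (\<exists>X. X \<noteq> 0 \<and> Ad G A g X = - X)}"

end

(*
  Let mu be a volume form on G_0, n its value on a frame of left-invariant fields, and f = ln |n|.
  The fields W = 2 (a^L - a^R) are the images under pi^# of the 1-forms theta = alpha^L + alpha^R,
  which span every cotangent space over G_0. The divergence of W with respect to mu is W f, because
  ad_a has trace 0 for an invariant metric and because left- and right-invariant fields commute. By
  d alpha^L = (d_g alpha)^L, d alpha^R = - (d_g alpha)^R and the definition of the Cartan form,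
  d theta = - psi(W, -, -), so the term i_pi d theta in <theta, X> cancels <theta, Y>. Hence
  <theta, X + Y> = W f = <theta, [pi, f]> for all these theta, that is, X + Y = [pi, f].
*)

theory Submission
  imports Defs
begin

section \<open>Calculus in finite-dimensional inner product spaces\<close>

text \<open>\<open>X_field\<close> is a definite description over all 1-forms that involves
  derivatives of the form, so it is meaningful only if its right side depends on the value of the
  form at p alone. In coordinates the divergence of \<pi>^# \<alpha> and the term i_\<pi> d\<alpha>
  contain the same sum of products of components of \<pi> with first derivatives of \<alpha>; it
  cancels, and the rest is linear in \<alpha>(p). Tangent vectors are stored in a chart chosen
  separately at each point, with no continuity in the choice. Equality of vectors is therefore
  mostly tested on functions, and smoothness is read off after transport to one fixed chart.
  Right-invariant objects are the left-invariant ones of the opposite multiplication, so each fact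
  is proved once; the sign in d \<alpha>^R is that of the opposite bracket. Left- and
  right-invariant fields commute because both orders give a mixed derivative of f(y g z). The trace
  of ad_a vanishes because it pairs a symmetric Gram matrix with a skew matrix. The set G_0 enters
  through spanning: a vector killed by all \<theta> yields u with Ad_g u = -u.\<close>

text \<open>The model space is only \<open>real_inner\<close>, so a finite orthonormal basis is
  carried along explicitly instead of being fixed by a type class. In dimension 0 it is
  empty.\<close>

definition onb :: "'a::real_inner set \<Rightarrow> bool" where
  "onb S \<longleftrightarrow> finite S \<and> (\<forall>a\<in>S. \<forall>b\<in>S. a \<bullet> b = (if a = b then 1 else 0)) \<and>
     (\<forall>x. (\<Sum>b\<in>S. (x \<bullet> b) *\<^sub>R b) = x)"

lemma onb_finite: "onb S \<Longrightarrow> finite S"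
  and onb_inner: "onb S \<Longrightarrow> a \<in> S \<Longrightarrow> b \<in> S \<Longrightarrow> a \<bullet> b = (if a = b then 1 else 0)"
  and onb_expand: "onb S \<Longrightarrow> (\<Sum>b\<in>S. (x \<bullet> b) *\<^sub>R b) = x"
  by (auto simp: onb_def)

text \<open>Gram-Schmidt. The orthogonal set that it provides may contain 0, which has to be dropped
  before normalising.\<close>

lemma onb_exists:
  assumes "finite B" "span B = (UNIV :: 'a::real_inner set)"
  shows "\<exists>S :: 'a set. onb S"
proof -
  obtain C where C: "finite C" "span C = span B" "pairwise orthogonal C"
    using basis_orthogonal[OF assms(1)] by blast
  define S where "S = (\<lambda>x. x /\<^sub>R norm x) ` (C - {0})"
  have fin: "finite S" unfolding S_def using C(1) by auto
  have orth: "a \<bullet> b = (if a = b then 1 else 0)" if ab: "a \<in> S" "b \<in> S" for a b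
  proof -
    obtain x where x: "x \<in> C" "x \<noteq> 0" "a = x /\<^sub>R norm x"
      using ab(1) unfolding S_def by blast
    obtain y where y: "y \<in> C" "y \<noteq> 0" "b = y /\<^sub>R norm y"
      using ab(2) unfolding S_def by blast
    note xy = x y
    show ?thesis
    proof (cases "x = y")
      case True
      then show ?thesis using xy by (simp add: dot_square_norm power2_eq_square)
    next
      case False
      then have "x \<bullet> y = 0" using C(3) xy by (auto simp: pairwise_def orthogonal_def)
      then have "a \<bullet> b = 0" using xy by simp
      moreover have "a \<bullet> a \<noteq> 0" using xy by simp
      ultimately show ?thesis by auto
    qed
  qed
  have "C \<subseteq> span S"
  proof
    fix x assume "x \<in> C"
    show "x \<in> span S"
    proof (cases "x = 0")
      case False
      then have "x = norm x *\<^sub>R (x /\<^sub>R norm x)" by simp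
      moreover have "x /\<^sub>R norm x \<in> span S" using False \<open>x \<in> C\<close> by (auto simp: S_def intro: span_base)
      ultimately show ?thesis by (metis span_scale)
    qed (simp add: span_zero)
  qed
  then have sp: "span S = UNIV" using C(2) assms(2)
    by (metis UNIV_I span_minimal subspace_span subset_antisym subset_UNIV)
  have "(\<Sum>b\<in>S. (x \<bullet> b) *\<^sub>R b) = x" for x
  proof -
    have "x \<in> span S" using sp by simp
    then obtain r where x: "x = (\<Sum>a\<in>S. r a *\<^sub>R a)" using span_finite[OF fin] by auto
    have "x \<bullet> b = r b" if "b \<in> S" for b
    proof -
      have "x \<bullet> b = (\<Sum>a\<in>S. r a * (if a = b then 1 else 0))"
        unfolding x inner_sum_left by (intro sum.cong) (auto simp: orth that)
      then show ?thesis using fin that by (simp add: sum.delta if_distrib cong: if_cong)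
    qed
    then show ?thesis using x by simp
  qed
  then show ?thesis using fin orth unfolding onb_def by blast
qed

text \<open>The degree of a volume form is fixed as \<open>dim UNIV\<close>; this matches it with
  the length of a list that enumerates the basis.\<close>

lemma onb_card:
  fixes S :: "'a::real_inner set"
  assumes "onb S"
  shows "card S = dim (UNIV :: 'a set)"
proof -
  have "pairwise orthogonal S" "0 \<notin> S"
    using assms unfolding onb_def pairwise_def orthogonal_def by (auto, fastforce)
  then have "independent S" by (rule pairwise_orthogonal_independent)
  moreover have "span S = UNIV"
  proof -
    have "x \<in> span S" for x
      using onb_expand[OF assms, of x] by (metis (no_types, lifting) span_base span_scale span_sum)
    then show ?thesis by auto
  qed
  ultimately show ?thesis by (metis dim_eq_card_independent dim_span)
qed

text \<open>In charts the multiplication is a function on the product of two model spaces, and the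
  chain rules below need a basis of that product.\<close>

lemma onb_prod:
  assumes "onb S" "onb T"
  shows "onb ((\<lambda>a. (a, 0)) ` S \<union> (\<lambda>b. (0, b)) ` T)"
proof -
  note f = onb_finite[OF assms(1)] onb_finite[OF assms(2)]
  have nz: "0 \<notin> S" "0 \<notin> T" using assms unfolding onb_def by force+
  have "(\<Sum>b\<in>(\<lambda>a. (a, 0)) ` S \<union> (\<lambda>b. (0, b)) ` T. (x \<bullet> b) *\<^sub>R b) = x" for x
  proof -
    have "(\<Sum>b\<in>(\<lambda>a. (a, 0)) ` S \<union> (\<lambda>b. (0, b)) ` T. (x \<bullet> b) *\<^sub>R b) =
       (\<Sum>b\<in>(\<lambda>a. (a, 0)) ` S. (x \<bullet> b) *\<^sub>R b) + (\<Sum>b\<in>(\<lambda>b. (0, b)) ` T. (x \<bullet> b) *\<^sub>R b)"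
      using f nz by (intro sum.union_disjoint) auto
    also have "\<dots> = (\<Sum>a\<in>S. (fst x \<bullet> a) *\<^sub>R (a, 0)) + (\<Sum>b\<in>T. (snd x \<bullet> b) *\<^sub>R (0, b))"
      by (subst (1 2) sum.reindex) (auto simp: inj_on_def inner_prod_def)
    also have "\<dots> = (fst x, 0) + (0, snd x)"
      using onb_expand[OF assms(1), of "fst x"] onb_expand[OF assms(2), of "snd x"]
      by (auto simp: prod_eq_iff fst_sum snd_sum)
    finally show ?thesis by simp
  qed
  moreover have "a \<bullet> b = (if a = b then 1 else 0)"
    if "a \<in> (\<lambda>a. (a, 0)) ` S \<union> (\<lambda>b. (0, b)) ` T" "b \<in> (\<lambda>a. (a, 0)) ` S \<union> (\<lambda>b. (0, b)) ` T" for a b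
    using that nz by (auto simp: inner_prod_def onb_inner[OF assms(1)] onb_inner[OF assms(2)] split: if_splits)
  ultimately show ?thesis using f unfolding onb_def by blast
qed

lemma onb_real: "onb {1 :: real}"
  by (auto simp: onb_def)

lemma onb_eqI:
  assumes "onb S" "\<And>b. b \<in> S \<Longrightarrow> x \<bullet> b = y \<bullet> b"
  shows "x = y"
  using onb_expand[OF assms(1), of x] onb_expand[OF assms(1), of y] assms(2) by (metis (no_types, lifting) sum.cong)

lemma onb_linear_expand:
  fixes f :: "'a::real_inner \<Rightarrow> 'b::real_vector"
  assumes "onb S" "linear f"
  shows "f x = (\<Sum>b\<in>S. (x \<bullet> b) *\<^sub>R f b)"
proof -
  have "f x = f (\<Sum>b\<in>S. (x \<bullet> b) *\<^sub>R b)" by (simp only: onb_expand[OF assms(1)])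
  also have "\<dots> = (\<Sum>b\<in>S. (x \<bullet> b) *\<^sub>R f b)"
    by (simp only: linear_sum[OF assms(2)] linear_scale[OF assms(2)])
  finally show ?thesis .
qed

text \<open>A linear map is a finite sum of inner products with basis vectors, each of them bounded.
  This is what guarantees that \<open>Blinfun\<close> returns the functional it is given.\<close>

lemma onb_bounded_linear:
  fixes f :: "'a::real_inner \<Rightarrow> 'b::real_normed_vector" and S :: "'a set"
  assumes "onb S" "linear f"
  shows "bounded_linear f"
proof -
  have "f = (\<lambda>x. \<Sum>b\<in>S. (x \<bullet> b) *\<^sub>R f b)"
    by (rule ext) (rule onb_linear_expand[OF assms])
  moreover have "bounded_linear (\<lambda>x. \<Sum>b\<in>S. (x \<bullet> b) *\<^sub>R f b)"
    by (intro bounded_linear_sum bounded_linear_scaleR_const bounded_linear_inner_left)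
  ultimately show ?thesis by metis
qed

section \<open>Functions of class C^k\<close>

lemma Ck_differentiable: "Ck_on (Suc k) S f \<Longrightarrow> x \<in> S \<Longrightarrow> f differentiable (at x)"
  by simp

lemma Ck_subset: "Ck_on k S f \<Longrightarrow> T \<subseteq> S \<Longrightarrow> Ck_on k T f"
  by (induction k arbitrary: f) (auto intro: continuous_on_subset)

lemma Ck_cong:
  "Ck_on k S f \<Longrightarrow> open S \<Longrightarrow> (\<And>x. x \<in> S \<Longrightarrow> f x = g x) \<Longrightarrow> Ck_on k S g"
proof (induction k arbitrary: f g)
  case 0
  then show ?case using continuous_on_cong[of S S f g] by simp
next
  case (Suc k)
  have d: "g differentiable (at x)" if "x \<in> S" for x
  proof -
    have "f differentiable (at x)" using Suc.prems that by simp
    then show ?thesis unfolding differentiable_def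
      using has_derivative_transform_within_open[OF _ Suc.prems(2) that, of f _ UNIV g] Suc.prems(3) by metis
  qed
  have eq: "frechet_derivative f (at x) = frechet_derivative g (at x)" if "x \<in> S" for x
    using Suc.prems that by (intro frechet_derivative_transform_within_open) auto
  have "Ck_on k S (\<lambda>x. frechet_derivative g (at x) v)" for v
    using Suc.IH[of "\<lambda>x. frechet_derivative f (at x) v" "\<lambda>x. frechet_derivative g (at x) v"]
      Suc.prems eq by auto
  with d show ?case by simp
qed

lemma Ck_SucD: "Ck_on (Suc k) S f \<Longrightarrow> Ck_on k S f"
proof (induction k arbitrary: f)
  case 0
  then show ?case
    by (auto intro!: continuous_at_imp_continuous_on differentiable_imp_continuous_within)
next
  case (Suc k)
  then show ?case by (metis Ck_on.simps(2))
qed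

lemma Ck_local:
  "(\<And>x. x \<in> S \<Longrightarrow> \<exists>T. open T \<and> x \<in> T \<and> Ck_on k T f) \<Longrightarrow> Ck_on k S f"
proof (induction k arbitrary: f)
  case 0
  have "continuous (at x) f" if "x \<in> S" for x
    using 0[OF that] by (auto simp: continuous_on_eq_continuous_at)
  then show ?case by (simp add: continuous_at_imp_continuous_on)
next
  case (Suc k)
  have "Ck_on k S (\<lambda>x. frechet_derivative f (at x) v)" for v
    using Suc.prems by (intro Suc.IH) (metis Ck_on.simps(2))
  moreover have "f differentiable (at x)" if "x \<in> S" for x
    using Suc.prems[OF that] by auto
  ultimately show ?case by simp
qed

lemma Ck_const: "Ck_on k S (\<lambda>x. c)"
  by (induction k arbitrary: c) auto

lemma frechet_derivative_bounded_linear: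
  "bounded_linear f \<Longrightarrow> frechet_derivative f (at x) = f"
  using frechet_derivative_at[OF bounded_linear_imp_has_derivative] by metis

lemma Ck_bounded_linear: "bounded_linear f \<Longrightarrow> Ck_on k S f"
  by (cases k) (auto simp: linear_continuous_on frechet_derivative_bounded_linear Ck_const
      bounded_linear_imp_differentiable)

lemma frechet_derivative_add:
  assumes "f differentiable (at x)" "g differentiable (at x)"
  shows "frechet_derivative (\<lambda>x. f x + g x) (at x) v = frechet_derivative f (at x) v + frechet_derivative g (at x) v"
proof -
  have "((\<lambda>x. f x + g x) has_derivative (\<lambda>v. frechet_derivative f (at x) v + frechet_derivative g (at x) v)) (at x)"
    by (rule has_derivative_add) (use assms in \<open>auto simp: frechet_derivative_works\<close>)
  from fun_cong[OF frechet_derivative_at[OF this], of v] show ?thesis by simp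
qed

lemma Ck_add:
  "open S \<Longrightarrow> Ck_on k S f \<Longrightarrow> Ck_on k S g \<Longrightarrow> Ck_on k S (\<lambda>x. f x + g x)"
proof (induction k arbitrary: f g)
  case 0
  then show ?case by (simp add: continuous_on_add)
next
  case (Suc k)
  have "Ck_on k S (\<lambda>x. frechet_derivative (\<lambda>x. f x + g x) (at x) v)" for v
    by (rule Ck_cong[OF Suc.IH[of "\<lambda>x. frechet_derivative f (at x) v" "\<lambda>x. frechet_derivative g (at x) v"]])
      (use Suc.prems in \<open>auto simp: frechet_derivative_add\<close>)
  then show ?case using Suc.prems by simp
qed

lemma frechet_derivative_linear_comp:
  assumes "bounded_linear L" "f differentiable (at x)"
  shows "frechet_derivative (\<lambda>x. L (f x)) (at x) v = L (frechet_derivative f (at x) v)"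
proof -
  have "((\<lambda>x. L (f x)) has_derivative (\<lambda>v. L (frechet_derivative f (at x) v))) (at x)"
    by (rule bounded_linear.has_derivative[OF assms(1)]) (use assms(2) in \<open>simp add: frechet_derivative_works\<close>)
  from fun_cong[OF frechet_derivative_at[OF this], of v] show ?thesis by simp
qed

lemma Ck_linear_comp:
  assumes "bounded_linear L"
  shows "open S \<Longrightarrow> Ck_on k S f \<Longrightarrow> Ck_on k S (\<lambda>x. L (f x))"
proof (induction k arbitrary: f)
  case 0
  then show ?case by (simp add: bounded_linear.continuous_on[OF assms])
next
  case (Suc k)
  have "Ck_on k S (\<lambda>x. frechet_derivative (\<lambda>x. L (f x)) (at x) v)" for v
    by (rule Ck_cong[OF Suc.IH[of "\<lambda>x. frechet_derivative f (at x) v"]])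
      (use Suc.prems in \<open>auto simp: frechet_derivative_linear_comp[OF assms]\<close>)
  moreover have "(\<lambda>x. L (f x)) differentiable (at x)" if "x \<in> S" for x
    using Suc.prems that bounded_linear.has_derivative[OF assms]
    unfolding differentiable_def Ck_on.simps by blast
  ultimately show ?case by simp
qed

lemma frechet_derivative_scaleR:
  fixes f :: "'a::real_normed_vector \<Rightarrow> real" and g :: "'a \<Rightarrow> 'b::real_normed_vector"
  assumes "f differentiable (at x)" "g differentiable (at x)"
  shows "frechet_derivative (\<lambda>x. f x *\<^sub>R g x) (at x) v =
    f x *\<^sub>R frechet_derivative g (at x) v + frechet_derivative f (at x) v *\<^sub>R g x"
proof -
  have "((\<lambda>x. f x *\<^sub>R g x) has_derivative
      (\<lambda>v. f x *\<^sub>R frechet_derivative g (at x) v + frechet_derivative f (at x) v *\<^sub>R g x)) (at x)"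
    by (rule has_derivative_scaleR) (use assms in \<open>auto simp: frechet_derivative_works\<close>)
  from fun_cong[OF frechet_derivative_at[OF this], of v] show ?thesis by simp
qed

lemma Ck_scaleR:
  fixes f :: "'a::real_normed_vector \<Rightarrow> real" and g :: "'a \<Rightarrow> 'b::real_normed_vector"
  shows "open S \<Longrightarrow> Ck_on k S f \<Longrightarrow> Ck_on k S g \<Longrightarrow> Ck_on k S (\<lambda>x. f x *\<^sub>R g x)"
proof (induction k arbitrary: f g)
  case 0
  then show ?case by (simp add: continuous_on_scaleR)
next
  case (Suc k)
  have "Ck_on k S (\<lambda>x. frechet_derivative (\<lambda>x. f x *\<^sub>R g x) (at x) v)" for v
  proof -
    have "Ck_on k S (\<lambda>x. f x *\<^sub>R frechet_derivative g (at x) v + frechet_derivative f (at x) v *\<^sub>R g x)"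
      using Suc.prems Ck_SucD[of k S f] Ck_SucD[of k S g] by (intro Ck_add Suc.IH) auto
    then show ?thesis
      by (rule Ck_cong) (use Suc.prems in \<open>auto simp: frechet_derivative_scaleR\<close>)
  qed
  moreover have "(\<lambda>x. f x *\<^sub>R g x) differentiable (at x)" if "x \<in> S" for x
    using Suc.prems that by (intro differentiable_scaleR) auto
  ultimately show ?case by simp
qed

lemma Ck_sum:
  assumes "open S" "\<And>i. i \<in> I \<Longrightarrow> Ck_on k S (f i)"
  shows "Ck_on k S (\<lambda>x. \<Sum>i\<in>I. f i x)"
  using assms(2)
  by (induction I rule: infinite_finite_induct) (auto simp: Ck_const intro!: Ck_add assms(1))

text \<open>The derivative of the composite is the derivative of g at f x in the direction of the
  derivative of f, which varies with x. Expanding that direction in the basis leaves derivatives of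
  g in fixed directions, to which the induction hypothesis applies.\<close>

lemma Ck_compose:
  fixes f :: "'a::real_normed_vector \<Rightarrow> 'b::real_inner" and g :: "'b \<Rightarrow> 'c::real_normed_vector"
    and Bs :: "'b set"
  assumes "onb Bs" "open S" "open T"
  shows "Ck_on k S f \<Longrightarrow> Ck_on k T g \<Longrightarrow> f ` S \<subseteq> T \<Longrightarrow> Ck_on k S (\<lambda>x. g (f x))"
proof (induction k arbitrary: f g)
  case 0
  then show ?case by (simp add: continuous_on_compose2)
next
  case (Suc k)
  have d: "f differentiable (at x)" "g differentiable (at (f x))" if "x \<in> S" for x
    using Suc.prems that by auto
  have "Ck_on k S (\<lambda>x. frechet_derivative (\<lambda>x. g (f x)) (at x) v)" for v
  proof -
    have "Ck_on k S (\<lambda>x. \<Sum>b\<in>Bs. (frechet_derivative f (at x) v \<bullet> b) *\<^sub>R frechet_derivative g (at (f x)) b)"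
      by (intro Ck_sum Ck_scaleR assms Ck_linear_comp[OF bounded_linear_inner_left]
          Suc.IH[of f "\<lambda>y. frechet_derivative g (at y) _"] Ck_SucD[OF Suc.prems(1)])
        (use Suc.prems in auto)
    then show ?thesis
    proof (rule Ck_cong)
      fix x assume x: "x \<in> S"
      have "frechet_derivative (\<lambda>x. g (f x)) (at x) v = frechet_derivative g (at (f x)) (frechet_derivative f (at x) v)"
        using frechet_derivative_compose[OF d[OF x]] by (simp add: o_def)
      moreover have "linear (frechet_derivative g (at (f x)))"
        using d[OF x] by (simp add: linear_frechet_derivative)
      ultimately show "(\<Sum>b\<in>Bs. (frechet_derivative f (at x) v \<bullet> b) *\<^sub>R frechet_derivative g (at (f x)) b) =
          frechet_derivative (\<lambda>x. g (f x)) (at x) v"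
        by (simp add: onb_linear_expand[OF assms(1), symmetric])
    qed (rule assms)
  qed
  moreover have "(\<lambda>x. g (f x)) differentiable (at x)" if "x \<in> S" for x
    using differentiable_chain_at[OF d[OF that]] by (simp add: o_def)
  ultimately show ?case by simp
qed

text \<open>The derivative is a polynomial in \<open>inverse\<close> itself, so the induction on the
  order closes.\<close>

lemma Ck_inverse: "Ck_on k (- {0}) (inverse :: real \<Rightarrow> real)"
proof (induction k)
  case 0
  then show ?case by (auto intro!: continuous_intros)
next
  case (Suc k)
  have der: "(inverse has_derivative (\<lambda>v. - (inverse x * v * inverse x))) (at x)" if "x \<noteq> 0" for x :: real
    using that by (rule has_derivative_inverse')
  have "Ck_on k (- {0}) (\<lambda>x. frechet_derivative inverse (at x) v)" for v :: real
  proof -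
    have "Ck_on k (- {0}) (\<lambda>x. (- v) *\<^sub>R (inverse x *\<^sub>R inverse x))"
      by (intro Ck_scaleR Ck_const Suc) auto
    then show ?thesis
    proof (rule Ck_cong)
      fix x :: real assume "x \<in> - {0}"
      then have "frechet_derivative inverse (at x) v = - (inverse x * v * inverse x)"
        using fun_cong[OF frechet_derivative_at[OF der], of x v] by simp
      then show "(- v) *\<^sub>R (inverse x *\<^sub>R inverse x) = frechet_derivative inverse (at x) v" by simp
    qed auto
  qed
  moreover have "inverse differentiable (at x)" if "x \<in> - {0}" for x :: real
    using der that unfolding differentiable_def by auto
  ultimately show ?case by simp
qed

text \<open>The function whose logarithm is taken later is nonzero but of unknown sign, and the sign
  may differ from place to place. The derivative 1/x is the same on both half-lines.\<close>

lemma has_derivative_ln_abs: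
  assumes "x \<noteq> (0::real)"
  shows "((\<lambda>x. ln \<bar>x\<bar>) has_derivative (\<lambda>v. v * inverse x)) (at x)"
proof (cases "x > 0")
  case True
  have "(ln has_derivative (\<lambda>v. v * inverse x)) (at x)"
    using True by (auto intro!: derivative_eq_intros simp: field_simps)
  then show ?thesis
    by (rule has_derivative_transform_within_open[of _ _ _ _ "{0<..}"]) (use True in auto)
next
  case False
  then have "((\<lambda>x. ln (- x)) has_derivative (\<lambda>v. v * inverse x)) (at x)"
    using assms by (auto intro!: derivative_eq_intros simp: field_simps)
  then show ?thesis
    by (rule has_derivative_transform_within_open[of _ _ _ _ "{..<0}"]) (use False assms in auto)
qed

lemma Ck_ln_abs: "Ck_on k (- {0}) (\<lambda>x::real. ln \<bar>x\<bar>)"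
proof (cases k)
  case 0
  then show ?thesis by (auto intro!: continuous_intros)
next
  case (Suc j)
  have "Ck_on j (- {0}) (\<lambda>x. frechet_derivative (\<lambda>x. ln \<bar>x\<bar>) (at x) v)" for v :: real
  proof -
    have "Ck_on j (- {0}) (\<lambda>x::real. v *\<^sub>R inverse x)"
      by (intro Ck_scaleR Ck_const Ck_inverse) auto
    then show ?thesis
    proof (rule Ck_cong)
      fix x :: real assume "x \<in> - {0}"
      then show "v *\<^sub>R inverse x = frechet_derivative (\<lambda>x. ln \<bar>x\<bar>) (at x) v"
        using fun_cong[OF frechet_derivative_at[OF has_derivative_ln_abs[of x]], of v] by simp
    qed auto
  qed
  moreover have "(\<lambda>x. ln \<bar>x\<bar>) differentiable (at x)" if "x \<in> - {0}" for x :: real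
    using has_derivative_ln_abs[of x] that unfolding differentiable_def by auto
  ultimately show ?thesis using Suc by simp
qed

section \<open>Smooth functions\<close>

lemma Cinf_differentiable: "Cinf_on S f \<Longrightarrow> x \<in> S \<Longrightarrow> f differentiable (at x)"
  unfolding Cinf_on_def using Ck_differentiable by blast

lemma Cinf_derivative: "Cinf_on S f \<Longrightarrow> Cinf_on S (\<lambda>x. frechet_derivative f (at x) v)"
  unfolding Cinf_on_def using Ck_on.simps(2) by blast

lemma Cinf_continuous: "Cinf_on S f \<Longrightarrow> continuous_on S f"
  unfolding Cinf_on_def by (auto dest: spec[of _ 0])

lemma Cinf_subset: "Cinf_on S f \<Longrightarrow> T \<subseteq> S \<Longrightarrow> Cinf_on T f"
  unfolding Cinf_on_def using Ck_subset by blast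

lemma Cinf_cong: "Cinf_on S f \<Longrightarrow> open S \<Longrightarrow> (\<And>x. x \<in> S \<Longrightarrow> f x = g x) \<Longrightarrow> Cinf_on S g"
  unfolding Cinf_on_def using Ck_cong[of _ S f g] by blast

lemma Cinf_local:
  "(\<And>x. x \<in> S \<Longrightarrow> \<exists>T. open T \<and> x \<in> T \<and> Cinf_on T f) \<Longrightarrow> Cinf_on S f"
  unfolding Cinf_on_def by (intro allI Ck_local) blast

lemma Cinf_const: "Cinf_on S (\<lambda>x. c)"
  by (simp add: Cinf_on_def Ck_const)

lemma Cinf_bounded_linear: "bounded_linear f \<Longrightarrow> Cinf_on S f"
  by (simp add: Cinf_on_def Ck_bounded_linear)

lemma Cinf_add: "open S \<Longrightarrow> Cinf_on S f \<Longrightarrow> Cinf_on S g \<Longrightarrow> Cinf_on S (\<lambda>x. f x + g x)"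
  by (simp add: Cinf_on_def Ck_add)

lemma Cinf_scaleR:
  fixes f :: "'a::real_normed_vector \<Rightarrow> real"
  shows "open S \<Longrightarrow> Cinf_on S f \<Longrightarrow> Cinf_on S g \<Longrightarrow> Cinf_on S (\<lambda>x. f x *\<^sub>R g x)"
  by (simp add: Cinf_on_def Ck_scaleR)

lemma Cinf_sum:
  "open S \<Longrightarrow> (\<And>i. i \<in> I \<Longrightarrow> Cinf_on S (f i)) \<Longrightarrow> Cinf_on S (\<lambda>x. \<Sum>i\<in>I. f i x)"
  by (simp add: Cinf_on_def Ck_sum)

lemma Cinf_linear_comp:
  "bounded_linear L \<Longrightarrow> open S \<Longrightarrow> Cinf_on S f \<Longrightarrow> Cinf_on S (\<lambda>x. L (f x))"
  by (simp add: Cinf_on_def Ck_linear_comp)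

lemma Cinf_compose:
  fixes f :: "'a::real_normed_vector \<Rightarrow> 'b::real_inner"
    and T Bs :: "'b set"
  shows "onb Bs \<Longrightarrow> open S \<Longrightarrow> open T \<Longrightarrow> Cinf_on S f \<Longrightarrow> Cinf_on T g \<Longrightarrow> f ` S \<subseteq> T \<Longrightarrow>
    Cinf_on S (\<lambda>x. g (f x))"
  unfolding Cinf_on_def using Ck_compose[of Bs S T _ f g] by blast

lemma Cinf_Pair:
  assumes "open S" "Cinf_on S f" "Cinf_on S g"
  shows "Cinf_on S (\<lambda>x. (f x, g x))"
proof -
  have "Cinf_on S (\<lambda>x. (f x, 0) + (0, g x))"
    by (intro Cinf_add assms Cinf_linear_comp[where L = "\<lambda>y. (y, 0)"] Cinf_linear_comp[where L = "\<lambda>y. (0, y)"])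
      (auto intro!: bounded_linear_Pair bounded_linear_ident bounded_linear_zero)
  then show ?thesis by simp
qed

lemma Cinf_componentwise:
  assumes "onb Bs" "open S" "\<And>b. b \<in> Bs \<Longrightarrow> Cinf_on S (\<lambda>x. f x \<bullet> b)"
  shows "Cinf_on S f"
proof -
  have "Cinf_on S (\<lambda>x. \<Sum>b\<in>Bs. (f x \<bullet> b) *\<^sub>R b)"
    by (intro Cinf_sum Cinf_scaleR assms Cinf_const)
  then show ?thesis by (simp add: onb_expand[OF assms(1)])
qed

text \<open>Here both the direction and the base point vary; expanding the direction in the basis
  reduces to fixed directions. The base point is a separate map h because derivatives of the
  multiplication are later taken at points such as (i x, x).\<close>

lemma Cinf_derivative_along:
  fixes f :: "'a::real_inner \<Rightarrow> 'b::real_normed_vector" and Bs :: "'a set"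
  assumes "onb Bs" "open S" "open T" "Cinf_on S f" "Cinf_on T X" "Cinf_on T h" "h ` T \<subseteq> S"
  shows "Cinf_on T (\<lambda>x. frechet_derivative f (at (h x)) (X x))"
proof -
  have "Cinf_on T (\<lambda>x. \<Sum>b\<in>Bs. (X x \<bullet> b) *\<^sub>R frechet_derivative f (at (h x)) b)"
    by (intro Cinf_sum Cinf_scaleR assms Cinf_linear_comp[OF bounded_linear_inner_left]
        Cinf_compose[OF assms(1) assms(3) assms(2), of h "\<lambda>y. frechet_derivative f (at y) _"] Cinf_derivative)
  then show ?thesis
  proof (rule Cinf_cong)
    fix x assume "x \<in> T"
    then have "linear (frechet_derivative f (at (h x)))"
      using assms by (intro linear_frechet_derivative Cinf_differentiable) auto
    then show "(\<Sum>b\<in>Bs. (X x \<bullet> b) *\<^sub>R frechet_derivative f (at (h x)) b) = frechet_derivative f (at (h x)) (X x)"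
      using onb_linear_expand[OF assms(1)] by metis
  qed (rule assms)
qed

text \<open>By the mean value theorem in each variable, the second difference of \<open>f\<close> equals
\<open>s\<^sup>2\<close> times a mixed derivative near \<open>x\<close>, in either order.\<close>

lemma second_difference:
  fixes f :: "'a::real_normed_vector \<Rightarrow> real"
  assumes s: "s > 0" and sub: "\<And>a b. 0 \<le> a \<Longrightarrow> a \<le> s \<Longrightarrow> 0 \<le> b \<Longrightarrow> b \<le> s \<Longrightarrow> x + a *\<^sub>R v + b *\<^sub>R w \<in> S"
    and f: "Cinf_on S f"
  shows "\<exists>a b. 0 < a \<and> a < s \<and> 0 < b \<and> b < s \<and>
    f (x + s *\<^sub>R v + s *\<^sub>R w) - f (x + s *\<^sub>R v) - f (x + s *\<^sub>R w) + f x =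
    s * s * frechet_derivative (\<lambda>y. frechet_derivative f (at y) v) (at (x + a *\<^sub>R v + b *\<^sub>R w)) w"
proof -
  have dir: "((\<lambda>r. h (y + r *\<^sub>R u)) has_real_derivative frechet_derivative h (at (y + r *\<^sub>R u)) u) (at r)"
    if "h differentiable (at (y + r *\<^sub>R u))" for h :: "'a \<Rightarrow> real" and y u r
  proof -
    have "((\<lambda>r. y + r *\<^sub>R u) has_derivative (\<lambda>t. t *\<^sub>R u)) (at r)"
      by (auto intro!: derivative_eq_intros)
    then have "((\<lambda>r. h (y + r *\<^sub>R u)) has_derivative (\<lambda>t. frechet_derivative h (at (y + r *\<^sub>R u)) (t *\<^sub>R u))) (at r)"
      using that by (auto intro: has_derivative_compose simp: frechet_derivative_works)
    moreover have "frechet_derivative h (at (y + r *\<^sub>R u)) (t *\<^sub>R u) = t * frechet_derivative h (at (y + r *\<^sub>R u)) u" for t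
      using linear_frechet_derivative[OF that] by (simp add: linear_cmul)
    ultimately show ?thesis by (simp add: has_field_derivative_def mult_commute_abs)
  qed
  define u where "u r = f ((x + s *\<^sub>R w) + r *\<^sub>R v) - f (x + r *\<^sub>R v)" for r
  have du: "(u has_real_derivative (frechet_derivative f (at (x + s *\<^sub>R w + r *\<^sub>R v)) v - frechet_derivative f (at (x + r *\<^sub>R v)) v)) (at r)"
    if "0 \<le> r" "r \<le> s" for r
    unfolding u_def using sub[of r s] sub[of r 0] that s
    by (intro DERIV_diff dir Cinf_differentiable[OF f]) (auto simp: algebra_simps)
  obtain a where a: "0 < a" "a < s" and ua: "u s - u 0 = (s - 0) * (frechet_derivative f (at (x + s *\<^sub>R w + a *\<^sub>R v)) v - frechet_derivative f (at (x + a *\<^sub>R v)) v)"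
    using MVT2[OF s du] by auto
  define g where "g r = frechet_derivative f (at ((x + a *\<^sub>R v) + r *\<^sub>R w)) v" for r
  have dg: "(g has_real_derivative (frechet_derivative (\<lambda>y. frechet_derivative f (at y) v) (at (x + a *\<^sub>R v + r *\<^sub>R w)) w)) (at r)"
    if "0 \<le> r" "r \<le> s" for r
    unfolding g_def using sub[of a r] that s a
    by (intro dir[of "\<lambda>y. frechet_derivative f (at y) v"] Cinf_differentiable[OF Cinf_derivative[OF f]]) (auto simp: algebra_simps)
  obtain b where b: "0 < b" "b < s" and gb: "g s - g 0 = (s - 0) * frechet_derivative (\<lambda>y. frechet_derivative f (at y) v) (at (x + a *\<^sub>R v + b *\<^sub>R w)) w"
    using MVT2[OF s dg] by auto
  have "u s - u 0 = s * (g s - g 0)"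
    unfolding ua g_def by (simp add: algebra_simps)
  then show ?thesis using a b gb unfolding u_def
    by (intro exI[of _ a] exI[of _ b]) (simp add: algebra_simps)
qed

text \<open>If the two mixed derivatives differed at x, continuity would keep each within half their
  distance of its value at x. But the second difference, computed in both orders, makes a value of
  one equal to a value of the other at nearby points.\<close>

lemma second_derivative_symmetric:
  fixes f :: "'a::real_normed_vector \<Rightarrow> real"
  assumes S: "open S" "x \<in> S" and f: "Cinf_on S f"
  shows "frechet_derivative (\<lambda>y. frechet_derivative f (at y) v) (at x) w =
    frechet_derivative (\<lambda>y. frechet_derivative f (at y) w) (at x) v"
proof (rule ccontr)
  define P where "P y = frechet_derivative (\<lambda>y. frechet_derivative f (at y) v) (at y) w" for y
  define Q where "Q y = frechet_derivative (\<lambda>y. frechet_derivative f (at y) w) (at y) v" for y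
  assume "\<not> ?thesis"
  then have ne: "dist (P x) (Q x) > 0" by (simp add: P_def Q_def)
  have "Cinf_on S P" "Cinf_on S Q"
    unfolding P_def Q_def using f by (auto intro!: Cinf_derivative)
  then have "isCont P x" "isCont Q x"
    using S by (auto dest!: Cinf_continuous simp: continuous_on_eq_continuous_at)
  then have "(P \<longlongrightarrow> P x) (nhds x)" "(Q \<longlongrightarrow> Q x) (nhds x)"
    by (simp_all add: isCont_def flip: tendsto_at_iff_tendsto_nhds)
  then have "\<forall>\<^sub>F y in nhds x. dist (P y) (P x) < dist (P x) (Q x) / 2"
    "\<forall>\<^sub>F y in nhds x. dist (Q y) (Q x) < dist (P x) (Q x) / 2"
    using half_gt_zero[OF ne] unfolding tendsto_iff by blast+
  moreover have "\<forall>\<^sub>F y in nhds x. y \<in> S" using S by (rule eventually_nhds_in_open)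
  ultimately have "\<forall>\<^sub>F y in nhds x. y \<in> S \<and> dist (P y) (P x) < dist (P x) (Q x) / 2 \<and> dist (Q y) (Q x) < dist (P x) (Q x) / 2"
    by eventually_elim auto
  then obtain d where d: "d > 0" "\<And>y. dist y x < d \<Longrightarrow> y \<in> S \<and> dist (P y) (P x) < dist (P x) (Q x) / 2 \<and> dist (Q y) (Q x) < dist (P x) (Q x) / 2"
    unfolding eventually_nhds_metric by auto
  \<comment> \<open>The parallelogram with sides \<open>s *\<^sub>R v\<close> and
    \<open>s *\<^sub>R w\<close> has to lie in the ball of radius d. The summand 1 covers the case
    that both vectors are 0.\<close>
  define s where "s = d / (2 * (norm v + norm w + 1))"
  have s: "s > 0" using d(1) unfolding s_def by (intro divide_pos_pos) (auto intro: add_nonneg_pos)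
  have near: "dist (x + a *\<^sub>R v + b *\<^sub>R w) x < d" if "0 \<le> a" "a \<le> s" "0 \<le> b" "b \<le> s" for a b
  proof -
    have "norm (a *\<^sub>R v + b *\<^sub>R w) \<le> a * norm v + b * norm w"
      using norm_triangle_ineq[of "a *\<^sub>R v" "b *\<^sub>R w"] that by simp
    also have "\<dots> \<le> s * norm v + s * norm w"
      using that by (intro add_mono mult_right_mono) auto
    also have "\<dots> < s * (2 * (norm v + norm w + 1))"
    proof -
      have "s * (2 * (norm v + norm w + 1)) - (s * norm v + s * norm w) = s * (norm v + norm w + 2)"
        by (simp add: algebra_simps)
      moreover have "s * (norm v + norm w + 2) > 0" using s by (intro mult_pos_pos) (auto intro: add_nonneg_pos)
      ultimately show ?thesis by linarith
    qed
    also have "\<dots> = d"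
    proof -
      have "norm v + norm w + 1 > 0" by (auto intro: add_nonneg_pos)
      then show ?thesis by (simp add: s_def)
    qed
    finally show ?thesis by (simp add: dist_norm algebra_simps)
  qed
  obtain a b where ab: "0 < a" "a < s" "0 < b" "b < s"
    "f (x + s *\<^sub>R v + s *\<^sub>R w) - f (x + s *\<^sub>R v) - f (x + s *\<^sub>R w) + f x = s * s * P (x + a *\<^sub>R v + b *\<^sub>R w)"
    using second_difference[OF s, of x v w S f] near d(2) f unfolding P_def by blast
  \<comment> \<open>The same second difference with v and w exchanged, which now yields a value of
    \<open>Q\<close>.\<close>
  obtain a' b' where ab': "0 < a'" "a' < s" "0 < b'" "b' < s"
    "f (x + s *\<^sub>R w + s *\<^sub>R v) - f (x + s *\<^sub>R w) - f (x + s *\<^sub>R v) + f x = s * s * Q (x + a' *\<^sub>R w + b' *\<^sub>R v)"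
  proof -
    have "x + a *\<^sub>R w + b *\<^sub>R v \<in> S" if "0 \<le> a" "a \<le> s" "0 \<le> b" "b \<le> s" for a b
      using near[of b a] d(2) that by (metis add.commute add.left_commute)
    then show ?thesis
      using second_difference[OF s, of x w v S f] f that unfolding Q_def by blast
  qed
  have "s * s * P (x + a *\<^sub>R v + b *\<^sub>R w) = s * s * Q (x + b' *\<^sub>R v + a' *\<^sub>R w)"
    using ab(5) ab'(5) by (simp add: algebra_simps)
  then have eq: "P (x + a *\<^sub>R v + b *\<^sub>R w) = Q (x + b' *\<^sub>R v + a' *\<^sub>R w)" using s by simp
  have "dist (P (x + a *\<^sub>R v + b *\<^sub>R w)) (P x) < dist (P x) (Q x) / 2"
    using d(2)[OF near] ab by auto
  moreover have "dist (Q (x + b' *\<^sub>R v + a' *\<^sub>R w)) (Q x) < dist (P x) (Q x) / 2"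
    using d(2)[OF near] ab' by auto
  moreover have "dist (P x) (Q x) \<le> dist (P (x + a *\<^sub>R v + b *\<^sub>R w)) (P x) + dist (Q (x + b' *\<^sub>R v + a' *\<^sub>R w)) (Q x)"
    unfolding eq by (metis dist_commute dist_triangle2 dist_triangle)
  ultimately show False by linarith
qed

section \<open>Derivatives along variable directions\<close>

lemma frechet_derivative_sum:
  assumes "finite I" "\<And>i. i \<in> I \<Longrightarrow> f i differentiable (at x)"
  shows "frechet_derivative (\<lambda>x. \<Sum>i\<in>I. f i x) (at x) v = (\<Sum>i\<in>I. frechet_derivative (f i) (at x) v)"
proof -
  have "((\<lambda>x. \<Sum>i\<in>I. f i x) has_derivative (\<lambda>v. \<Sum>i\<in>I. frechet_derivative (f i) (at x) v)) (at x)"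
    by (rule has_derivative_sum) (use assms in \<open>auto simp: frechet_derivative_works\<close>)
  from fun_cong[OF frechet_derivative_at[OF this], of v] show ?thesis by simp
qed

text \<open>Product rule: the first term differentiates f' with the direction frozen at x, the
  second differentiates the direction. The basis expansion turns the evaluation of f' at
  \<open>Y y\<close> into a sum of ordinary products.\<close>

lemma frechet_derivative_along:
  fixes f :: "'a::real_inner \<Rightarrow> 'b::real_normed_vector" and Bs :: "'a set"
  assumes onb: "onb Bs" and S: "open S" "x \<in> S" and f: "Cinf_on S f" and Y: "Cinf_on S Y"
  shows "frechet_derivative (\<lambda>y. frechet_derivative f (at y) (Y y)) (at x) u =
    frechet_derivative (\<lambda>y. frechet_derivative f (at y) (Y x)) (at x) u +
    frechet_derivative f (at x) (frechet_derivative Y (at x) u)"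
proof -
  have lin: "linear (frechet_derivative f (at y))" if "y \<in> S" for y
    using f that by (intro linear_frechet_derivative Cinf_differentiable)
  have dY: "Y differentiable (at x)" and dYb: "(\<lambda>y. Y y \<bullet> b) differentiable (at x)"
    and df: "(\<lambda>y. frechet_derivative f (at y) b) differentiable (at x)" for b
    using f Y S by (auto intro!: Cinf_differentiable[of S] Cinf_derivative Cinf_linear_comp[OF bounded_linear_inner_left])
  have "frechet_derivative (\<lambda>y. frechet_derivative f (at y) (Y y)) (at x) u =
    frechet_derivative (\<lambda>y. \<Sum>b\<in>Bs. (Y y \<bullet> b) *\<^sub>R frechet_derivative f (at y) b) (at x) u"
    using Cinf_differentiable[OF Cinf_derivative_along[OF onb S(1) S(1) f Y Cinf_bounded_linear[OF bounded_linear_ident]]] S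
    by (intro fun_cong[OF frechet_derivative_transform_within_open[OF _ S]])
      (auto intro!: onb_linear_expand[OF onb] lin)
  also have "\<dots> = (\<Sum>b\<in>Bs. frechet_derivative (\<lambda>y. (Y y \<bullet> b) *\<^sub>R frechet_derivative f (at y) b) (at x) u)"
    by (intro frechet_derivative_sum onb_finite[OF onb] differentiable_scaleR dYb df)
  also have "\<dots> = (\<Sum>b\<in>Bs. (Y x \<bullet> b) *\<^sub>R frechet_derivative (\<lambda>y. frechet_derivative f (at y) b) (at x) u) +
      (\<Sum>b\<in>Bs. (frechet_derivative Y (at x) u \<bullet> b) *\<^sub>R frechet_derivative f (at x) b)"
    by (simp add: frechet_derivative_scaleR[OF dYb df] sum.distrib
        frechet_derivative_linear_comp[OF bounded_linear_inner_left dY])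
  also have "(\<Sum>b\<in>Bs. (frechet_derivative Y (at x) u \<bullet> b) *\<^sub>R frechet_derivative f (at x) b) =
      frechet_derivative f (at x) (frechet_derivative Y (at x) u)"
    by (rule onb_linear_expand[OF onb lin[OF S(2)], symmetric])
  also have "(\<Sum>b\<in>Bs. (Y x \<bullet> b) *\<^sub>R frechet_derivative (\<lambda>y. frechet_derivative f (at y) b) (at x) u) =
      (\<Sum>b\<in>Bs. frechet_derivative (\<lambda>y. (Y x \<bullet> b) *\<^sub>R frechet_derivative f (at y) b) (at x) u)"
    by (intro sum.cong refl, subst frechet_derivative_scaleR) (auto simp: df)
  also have "\<dots> = frechet_derivative (\<lambda>y. \<Sum>b\<in>Bs. (Y x \<bullet> b) *\<^sub>R frechet_derivative f (at y) b) (at x) u"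
    by (intro frechet_derivative_sum[symmetric] onb_finite[OF onb] differentiable_scaleR differentiable_const df)
  also have "\<dots> = frechet_derivative (\<lambda>y. frechet_derivative f (at y) (Y x)) (at x) u"
    by (intro fun_cong[OF frechet_derivative_transform_within_open[OF _ S], symmetric])
      (auto intro!: onb_linear_expand[OF onb] lin df)
  finally show ?thesis .
qed

text \<open>The terms with second derivatives of f cancel by symmetry. What survives is of first
  order in f, which is why the bracket of two vector fields is a vector field.\<close>

lemma frechet_derivative_commutator:
  fixes f :: "'a::real_inner \<Rightarrow> real" and Bs :: "'a set"
  assumes onb: "onb Bs" and S: "open S" "x \<in> S" and f: "Cinf_on S f" and X: "Cinf_on S X" and Y: "Cinf_on S Y"
  shows "frechet_derivative (\<lambda>y. frechet_derivative f (at y) (Y y)) (at x) (X x) -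
      frechet_derivative (\<lambda>y. frechet_derivative f (at y) (X y)) (at x) (Y x) =
    frechet_derivative f (at x) (frechet_derivative Y (at x) (X x) - frechet_derivative X (at x) (Y x))"
  using frechet_derivative_along[OF onb S f Y, of "X x"] frechet_derivative_along[OF onb S f X, of "Y x"]
    second_derivative_symmetric[OF S f, of "X x" "Y x"]
    linear_diff[OF linear_frechet_derivative[OF Cinf_differentiable[OF f S(2)]]] by simp

section \<open>Functions and vector fields in charts\<close>

locale manifold =
  fixes A :: "('g::topological_space, 'e::real_inner) chart set" and bs :: "'e set"
  assumes smooth_atlas: "smooth_atlas A" and onb: "onb bs"
begin

lemma
  assumes "c \<in> A"
  shows open_chart: "open (fst c)" and chart_homeomorphism: "homeomorphism (fst c) (snd c ` fst c) (snd c) (chart_inv c)"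
    and open_chart_image: "open (snd c ` fst c)"
  using assms smooth_atlas unfolding smooth_atlas_def is_chart_def chart_inv_def by force+

lemma chart_inv_chart [simp]: "c \<in> A \<Longrightarrow> q \<in> fst c \<Longrightarrow> chart_inv c (snd c q) = q"
  using chart_homeomorphism unfolding homeomorphism_def by blast

lemma open_image:
  assumes "c \<in> A" "open V"
  shows "open (snd c ` (V \<inter> fst c))"
proof -
  have "snd c ` (V \<inter> fst c) = snd c ` fst c \<inter> chart_inv c -` V"
    using assms(1) by (auto simp: image_iff)
  moreover have "continuous_on (snd c ` fst c) (chart_inv c)"
    using chart_homeomorphism[OF assms(1)] by (simp add: homeomorphism_def)
  ultimately show ?thesis
    using continuous_on_open_vimage[OF open_chart_image[OF assms(1)]] assms(2)
    by (metis Int_commute)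
qed

lemma transition_smooth:
  "c \<in> A \<Longrightarrow> c' \<in> A \<Longrightarrow> Cinf_on (snd c ` (fst c \<inter> fst c')) (snd c' \<circ> chart_inv c)"
  using smooth_atlas unfolding smooth_atlas_def by blast

lemma chart_at [simp]: "chart_at A p \<in> A" "p \<in> fst (chart_at A p)"
proof -
  have "\<exists>c. c \<in> A \<and> p \<in> fst c" using smooth_atlas unfolding smooth_atlas_def by blast
  then show "chart_at A p \<in> A" "p \<in> fst (chart_at A p)"
    unfolding chart_at_def by (metis (mono_tags, lifting) someI_ex)+
qed

section \<open>Smooth functions on the manifold\<close>

text \<open>\<open>smooth_fun\<close> tests every chart of the atlas. One chart around each point is
  enough, because a smooth transition map carries the expression to any other chart.\<close>

lemma smooth_fun_localI:
  assumes "\<And>p. p \<in> V \<Longrightarrow> \<exists>c\<in>A. \<exists>W. open W \<and> p \<in> W \<and> W \<subseteq> fst c \<and> Cinf_on (snd c ` W) (f \<circ> chart_inv c)"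
  shows "smooth_fun A V f"
  unfolding smooth_fun_def
proof (intro ballI Cinf_local)
  fix c' x assume c': "c' \<in> A" and "x \<in> snd c' ` (V \<inter> fst c')"
  then obtain p where p: "p \<in> V" "p \<in> fst c'" "x = snd c' p" by auto
  obtain c W where c: "c \<in> A" and W: "open W" "p \<in> W" "W \<subseteq> fst c" and f: "Cinf_on (snd c ` W) (f \<circ> chart_inv c)"
    using assms[OF p(1)] by blast
  define T where "T = snd c' ` (W \<inter> fst c')"
  have T: "open T" unfolding T_def by (rule open_image[OF c' W(1)])
  have "Cinf_on T (\<lambda>x. (f \<circ> chart_inv c) ((snd c \<circ> chart_inv c') x))"
  proof (rule Cinf_compose[OF onb T _ _ f])
    show "open (snd c ` W)" using open_image[OF c W(1)] W(3) by (simp add: inf_absorb1)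
    show "Cinf_on T (snd c \<circ> chart_inv c')"
      unfolding T_def by (rule Cinf_subset[OF transition_smooth[OF c' c]]) (use W in auto)
    show "(snd c \<circ> chart_inv c') ` T \<subseteq> snd c ` W"
      using c' by (auto simp: T_def)
  qed
  then have "Cinf_on T (f \<circ> chart_inv c')"
    by (rule Cinf_cong[OF _ T]) (use c c' W in \<open>auto simp: T_def subset_iff\<close>)
  then show "\<exists>T. open T \<and> x \<in> T \<and> Cinf_on T (f \<circ> chart_inv c')"
    using T p W unfolding T_def by blast
qed

lemma smooth_fun_Cinf:
  "smooth_fun A V f \<Longrightarrow> c \<in> A \<Longrightarrow> Cinf_on (snd c ` (V \<inter> fst c)) (f \<circ> chart_inv c)"
  unfolding smooth_fun_def by blast

lemma smooth_fun_subset: "smooth_fun A V f \<Longrightarrow> W \<subseteq> V \<Longrightarrow> smooth_fun A W f"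
  unfolding smooth_fun_def by (metis (no_types, lifting) Cinf_subset Int_mono image_mono order_refl)

lemma smooth_fun_cong:
  assumes "smooth_fun A V f" "open V" "\<And>p. p \<in> V \<Longrightarrow> f p = g p"
  shows "smooth_fun A V g"
  unfolding smooth_fun_def
proof
  fix c assume c: "c \<in> A"
  show "Cinf_on (snd c ` (V \<inter> fst c)) (g \<circ> chart_inv c)"
    by (rule Cinf_cong[OF smooth_fun_Cinf[OF assms(1) c] open_image[OF c assms(2)]])
      (use c assms(3) in auto)
qed

lemma smooth_fun_const: "smooth_fun A V (\<lambda>p. k)"
  by (simp add: smooth_fun_def o_def Cinf_const)

lemma smooth_fun_add:
  "open V \<Longrightarrow> smooth_fun A V f \<Longrightarrow> smooth_fun A V g \<Longrightarrow> smooth_fun A V (\<lambda>p. f p + g p)"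
  by (auto simp: smooth_fun_def o_def intro!: Cinf_add open_image)

lemma smooth_fun_mult:
  assumes "open V" "smooth_fun A V f" "smooth_fun A V g"
  shows "smooth_fun A V (\<lambda>p. f p * g p)"
  unfolding smooth_fun_def
proof
  fix c assume c: "c \<in> A"
  show "Cinf_on (snd c ` (V \<inter> fst c)) ((\<lambda>p. f p * g p) \<circ> chart_inv c)"
    using Cinf_scaleR[OF open_image[OF c assms(1)] smooth_fun_Cinf[OF assms(2) c] smooth_fun_Cinf[OF assms(3) c]]
    by (simp add: o_def)
qed

lemma smooth_fun_sum:
  "open V \<Longrightarrow> (\<And>i. i \<in> I \<Longrightarrow> smooth_fun A V (f i)) \<Longrightarrow> smooth_fun A V (\<lambda>p. \<Sum>i\<in>I. f i p)"
  by (induction I rule: infinite_finite_induct) (auto simp: smooth_fun_const intro!: smooth_fun_add)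

lemma smooth_fun_prod:
  "open V \<Longrightarrow> (\<And>i. i \<in> I \<Longrightarrow> smooth_fun A V (f i)) \<Longrightarrow> smooth_fun A V (\<lambda>p. \<Prod>i\<in>I. f i p)"
  by (induction I rule: infinite_finite_induct) (auto simp: smooth_fun_const intro!: smooth_fun_mult)

lemma smooth_fun_ln_abs:
  assumes "open V" "smooth_fun A V f" "\<And>p. p \<in> V \<Longrightarrow> f p \<noteq> 0"
  shows "smooth_fun A V (\<lambda>p. ln \<bar>f p\<bar>)"
  unfolding smooth_fun_def
proof
  fix c assume c: "c \<in> A"
  have "Cinf_on (snd c ` (V \<inter> fst c)) (\<lambda>x. ln \<bar>(f \<circ> chart_inv c) x\<bar>)"
    by (rule Cinf_compose[OF onb_real open_image[OF c assms(1)] _ smooth_fun_Cinf[OF assms(2) c], of "- {0}"])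
      (use c assms(3) in \<open>auto simp: Cinf_on_def Ck_ln_abs\<close>)
  then show "Cinf_on (snd c ` (V \<inter> fst c)) ((\<lambda>p. ln \<bar>f p\<bar>) \<circ> chart_inv c)" by (simp add: o_def)
qed

lemma smooth_fun_differentiable:
  assumes "smooth_fun A V f" "p \<in> V" "c \<in> A" "p \<in> fst c"
  shows "(f \<circ> chart_inv c) differentiable (at (snd c p))"
  using Cinf_differentiable[OF smooth_fun_Cinf[OF assms(1,3)]] assms by blast

lemma smooth_fun_coord:
  assumes c: "c \<in> A"
  shows "smooth_fun A (fst c) (\<lambda>q. snd c q \<bullet> b)"
proof (rule smooth_fun_localI)
  fix p assume "p \<in> fst c"
  have "Cinf_on (snd c ` fst c) ((\<lambda>q. snd c q \<bullet> b) \<circ> chart_inv c)"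
    by (rule Cinf_cong[OF Cinf_bounded_linear[OF bounded_linear_inner_left[of b]] open_chart_image[OF c]])
      (use c in auto)
  then show "\<exists>c'\<in>A. \<exists>W. open W \<and> p \<in> W \<and> W \<subseteq> fst c' \<and> Cinf_on (snd c' ` W) ((\<lambda>q. snd c q \<bullet> b) \<circ> chart_inv c')"
    using c \<open>p \<in> fst c\<close> open_chart[OF c] by blast
qed

section \<open>Directional derivatives\<close>

lemma dirder_cong:
  assumes "smooth_fun A V f" "open V" "p \<in> V" "\<And>q. q \<in> V \<Longrightarrow> f q = g q"
  shows "dirder A p v f = dirder A p v g"
  unfolding dirder_def
  by (intro fun_cong[OF frechet_derivative_transform_within_open[OF
      smooth_fun_differentiable[OF assms(1,3) chart_at] open_image[OF chart_at(1) assms(2)]]])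
    (use assms in auto)

lemma dirder_linear: "smooth_fun A V f \<Longrightarrow> p \<in> V \<Longrightarrow> linear (\<lambda>v. dirder A p v f)"
  unfolding dirder_def by (intro linear_frechet_derivative smooth_fun_differentiable chart_at)

lemma dirder_const: "dirder A p v (\<lambda>q. k) = 0"
  by (simp add: dirder_def o_def)

lemma dirder_add:
  assumes "smooth_fun A V f" "smooth_fun A V g" "p \<in> V"
  shows "dirder A p v (\<lambda>q. f q + g q) = dirder A p v f + dirder A p v g"
  using frechet_derivative_add[OF smooth_fun_differentiable[OF assms(1,3) chart_at] smooth_fun_differentiable[OF assms(2,3) chart_at]]
  by (simp add: dirder_def o_def)

lemma dirder_mult:
  assumes "smooth_fun A V f" "smooth_fun A V g" "p \<in> V"
  shows "dirder A p v (\<lambda>q. f q * g q) = f p * dirder A p v g + dirder A p v f * g p"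
  using frechet_derivative_scaleR[OF smooth_fun_differentiable[OF assms(1,3) chart_at] smooth_fun_differentiable[OF assms(2,3) chart_at]]
  by (simp add: dirder_def o_def)

lemma dirder_sum:
  assumes "finite I" "\<And>i. i \<in> I \<Longrightarrow> smooth_fun A V (f i)" "p \<in> V"
  shows "dirder A p v (\<lambda>q. \<Sum>i\<in>I. f i q) = (\<Sum>i\<in>I. dirder A p v (f i))"
  using frechet_derivative_sum[OF assms(1) smooth_fun_differentiable[OF assms(2,3) chart_at]]
  by (simp add: dirder_def o_def)

lemma dirder_ln_abs:
  assumes f: "smooth_fun A V f" "p \<in> V" and "f p \<noteq> 0"
  shows "dirder A p v (\<lambda>q. ln \<bar>f q\<bar>) = dirder A p v f / f p"
proof -
  let ?c = "chart_at A p"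
  have "((f \<circ> chart_inv ?c) has_derivative frechet_derivative (f \<circ> chart_inv ?c) (at (snd ?c p))) (at (snd ?c p))"
    using smooth_fun_differentiable[OF f chart_at] by (simp add: frechet_derivative_works)
  from has_derivative_compose[OF this has_derivative_ln_abs] assms(3)
  have "((\<lambda>x. ln \<bar>(f \<circ> chart_inv ?c) x\<bar>) has_derivative (\<lambda>v. dirder A p v f * inverse (f p))) (at (snd ?c p))"
    by (simp add: dirder_def)
  from fun_cong[OF frechet_derivative_at[OF this], of v] show ?thesis
    by (simp add: dirder_def o_def divide_inverse)
qed

lemma dirder_scaled_diff:
  assumes V: "open V" "p \<in> V" and f: "smooth_fun A V f" and g: "smooth_fun A V g"
  shows "dirder A p v (\<lambda>q. k * (f q - g q)) = k * (dirder A p v f - dirder A p v g)"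
proof -
  have kf: "dirder A p v (\<lambda>q. k * f q) = k * dirder A p v f" if "smooth_fun A V f" for k f
    using dirder_mult[OF smooth_fun_const that V(2)] by (simp add: dirder_const)
  have "(\<lambda>q. k * (f q - g q)) = (\<lambda>q. k * f q + (- k) * g q)" by (auto simp: algebra_simps)
  then show ?thesis
    using dirder_add[OF smooth_fun_mult[OF V(1) smooth_fun_const f] smooth_fun_mult[OF V(1) smooth_fun_const g] V(2), of v k "- k"]
    by (simp only: kf[OF f] kf[OF g]) (simp add: algebra_simps)
qed

section \<open>Change of chart for tangent vectors\<close>

text \<open>Converts a tangent vector at q from its stored coordinates, which refer to the chart
  chosen at q, into coordinates in c.\<close>

definition to_chart :: "('g, 'e) chart \<Rightarrow> 'g \<Rightarrow> 'e \<Rightarrow> 'e" where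
  "to_chart c q = frechet_derivative (snd c \<circ> chart_inv (chart_at A q)) (at (snd (chart_at A q) q))"

text \<open>The inverse conversion. For fixed v and varying q it is the vector field with constant
  components v in c.\<close>

definition from_chart :: "('g, 'e) chart \<Rightarrow> 'g \<Rightarrow> 'e \<Rightarrow> 'e" where
  "from_chart c q = frechet_derivative (snd (chart_at A q) \<circ> chart_inv c) (at (snd c q))"

text \<open>The coordinate expression of the field in c. Unlike the stored values of X, its values
  at different points refer to one chart and can be differentiated.\<close>

definition components :: "('g, 'e) chart \<Rightarrow> ('g \<Rightarrow> 'e) \<Rightarrow> 'e \<Rightarrow> 'e" where
  "components c X x = to_chart c (chart_inv c x) (X (chart_inv c x))"

lemma coord_ext_eq: "coord_ext A p v q = from_chart (chart_at A p) q v"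
  by (simp add: coord_ext_def from_chart_def)

lemma transition_differentiable:
  assumes "c \<in> A" "c' \<in> A" "q \<in> fst c" "q \<in> fst c'"
  shows "(snd c' \<circ> chart_inv c) differentiable (at (snd c q))"
  using Cinf_differentiable[OF transition_smooth[OF assms(1,2)]] assms by blast

lemma transition_inverse:
  assumes "c \<in> A" "c' \<in> A" "q \<in> fst c" "q \<in> fst c'"
  shows "frechet_derivative (snd c \<circ> chart_inv c') (at (snd c' q))
    (frechet_derivative (snd c' \<circ> chart_inv c) (at (snd c q)) v) = v"
proof -
  have "frechet_derivative ((snd c \<circ> chart_inv c') \<circ> (snd c' \<circ> chart_inv c)) (at (snd c q)) =
     frechet_derivative (snd c \<circ> chart_inv c') (at (snd c' q)) \<circ> frechet_derivative (snd c' \<circ> chart_inv c) (at (snd c q))"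
    using assms transition_differentiable[of c c' q] transition_differentiable[of c' c q]
    by (subst frechet_derivative_compose) auto
  moreover have "frechet_derivative ((snd c \<circ> chart_inv c') \<circ> (snd c' \<circ> chart_inv c)) (at (snd c q)) =
      frechet_derivative (\<lambda>x. x) (at (snd c q))"
    by (rule frechet_derivative_transform_within_open[OF _ open_image[OF assms(1) open_chart[OF assms(2)]]])
      (use assms transition_differentiable[of c c' q] transition_differentiable[of c' c q] in
        \<open>auto intro!: differentiable_chain_at\<close>)
  ultimately show ?thesis by (metis comp_apply frechet_derivative_ident)
qed

lemma
  assumes "c \<in> A" "q \<in> fst c"
  shows to_chart_from_chart [simp]: "to_chart c q (from_chart c q v) = v"
    and from_chart_to_chart [simp]: "from_chart c q (to_chart c q v) = v"
    and linear_to_chart: "linear (to_chart c q)"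
    and linear_from_chart: "linear (from_chart c q)"
  using assms transition_inverse[of c "chart_at A q" q v] transition_inverse[of "chart_at A q" c q v]
    transition_differentiable[of c "chart_at A q" q] transition_differentiable[of "chart_at A q" c q]
  by (auto simp: to_chart_def from_chart_def intro: linear_frechet_derivative)

lemma
  shows to_chart_self [simp]: "to_chart (chart_at A p) p v = v"
    and from_chart_self [simp]: "from_chart (chart_at A p) p v = v"
proof -
  have "frechet_derivative (snd (chart_at A p) \<circ> chart_inv (chart_at A p)) (at (snd (chart_at A p) p)) =
      frechet_derivative (\<lambda>x. x) (at (snd (chart_at A p) p))"
    by (rule frechet_derivative_transform_within_open[OF _ open_chart_image[OF chart_at(1)[of p]]])
      (auto intro: transition_differentiable)
  then show "to_chart (chart_at A p) p v = v" "from_chart (chart_at A p) p v = v"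
    by (simp_all add: to_chart_def from_chart_def)
qed

lemma components_at [simp]: "components (chart_at A p) X (snd (chart_at A p) p) = X p"
  by (simp add: components_def)

text \<open>Chain rule for the transition from the chart chosen at q: the derivative of a function
  along a vector can be computed in any chart around q.\<close>

lemma dirder_chart:
  assumes "smooth_fun A V f" "q \<in> V" "open V" "c \<in> A" "q \<in> fst c"
  shows "dirder A q v f = frechet_derivative (f \<circ> chart_inv c) (at (snd c q)) (to_chart c q v)"
proof -
  let ?c = "chart_at A q"
  have d: "(snd c \<circ> chart_inv ?c) differentiable (at (snd ?c q))"
    by (rule transition_differentiable) (use assms in auto)
  have f: "(f \<circ> chart_inv c) differentiable (at ((snd c \<circ> chart_inv ?c) (snd ?c q)))"
    using smooth_fun_differentiable[OF assms(1,2,4,5)] by simp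
  have "dirder A q v f = frechet_derivative ((f \<circ> chart_inv c) \<circ> (snd c \<circ> chart_inv ?c)) (at (snd ?c q)) v"
    unfolding dirder_def
    by (intro fun_cong[OF frechet_derivative_transform_within_open[OF
      smooth_fun_differentiable[OF assms(1,2) chart_at] open_image[OF chart_at(1) open_chart[OF assms(4)]]]])
    (use assms in auto)
  also have "\<dots> = frechet_derivative (f \<circ> chart_inv c) (at (snd c q)) (to_chart c q v)"
    unfolding frechet_derivative_compose[OF d f] by (simp add: to_chart_def)
  finally show ?thesis .
qed

lemma dirder_coord:
  assumes "c \<in> A" "q \<in> fst c"
  shows "dirder A q v (\<lambda>q. snd c q \<bullet> b) = to_chart c q v \<bullet> b"
proof -
  have "dirder A q v (\<lambda>q. snd c q \<bullet> b) = frechet_derivative ((\<lambda>q. snd c q \<bullet> b) \<circ> chart_inv c) (at (snd c q)) (to_chart c q v)"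
    by (rule dirder_chart[OF smooth_fun_coord[OF assms(1)] assms(2) open_chart[OF assms(1)] assms])
  also have "\<dots> = frechet_derivative (\<lambda>x. x \<bullet> b) (at (snd c q)) (to_chart c q v)"
    by (intro fun_cong[OF frechet_derivative_transform_within_open[OF
       smooth_fun_differentiable[OF smooth_fun_coord[OF assms(1)] assms(2) assms] open_chart_image[OF assms(1)]]])
      (use assms in auto)
  also have "\<dots> = to_chart c q v \<bullet> b"
    by (simp add: frechet_derivative_bounded_linear[OF bounded_linear_inner_left])
  finally show ?thesis .
qed

text \<open>The coordinate functions of the chart at p read off the components of a tangent vector,
  so its action on functions determines it. Test functions on small neighbourhoods suffice.\<close>

lemma tangent_eqI:
  assumes "open V" "p \<in> V" "\<And>f W. open W \<Longrightarrow> p \<in> W \<Longrightarrow> W \<subseteq> V \<Longrightarrow> smooth_fun A W f \<Longrightarrow> dirder A p v f = dirder A p w f"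
  shows "v = w"
proof (rule onb_eqI[OF onb])
  fix b
  have "dirder A p v (\<lambda>q. snd (chart_at A p) q \<bullet> b) = dirder A p w (\<lambda>q. snd (chart_at A p) q \<bullet> b)"
    by (rule assms(3)[of "V \<inter> fst (chart_at A p)"])
      (auto intro!: smooth_fun_subset[OF smooth_fun_coord] open_Int open_chart assms)
  then show "v \<bullet> b = w \<bullet> b" by (simp add: dirder_coord)
qed

section \<open>Vector fields\<close>

text \<open>\<open>vfield\<close> is a condition on the action on functions; applied to the
  coordinate functions it gives the components.\<close>

lemma vfield_components:
  assumes "vfield A V X" "open V" "c \<in> A"
  shows "Cinf_on (snd c ` (V \<inter> fst c)) (components c X)"
proof (rule Cinf_componentwise[OF onb open_image[OF assms(3,2)]])
  fix b
  have "smooth_fun A (V \<inter> fst c) (\<lambda>p. dirder A p (X p) (\<lambda>q. snd c q \<bullet> b))"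
    using assms(1) unfolding vfield_def
    by (auto intro!: open_Int assms open_chart smooth_fun_subset[OF smooth_fun_coord])
  then have "smooth_fun A (V \<inter> fst c) (\<lambda>p. to_chart c p (X p) \<bullet> b)"
    by (rule smooth_fun_cong) (use assms in \<open>auto intro!: dirder_coord open_Int open_chart\<close>)
  from smooth_fun_Cinf[OF this assms(3)]
  show "Cinf_on (snd c ` (V \<inter> fst c)) (\<lambda>x. components c X x \<bullet> b)"
    by (simp add: o_def components_def)
qed

text \<open>Converse of the component criterion: in a chart, the action on f is the derivative of
  the expression of f along the components, which is smooth by
  \<open>Cinf_derivative_along\<close>.\<close>

lemma vfieldI:
  assumes "\<And>p. p \<in> V \<Longrightarrow> \<exists>c\<in>A. \<exists>W. open W \<and> p \<in> W \<and> W \<subseteq> fst c \<and> Cinf_on (snd c ` W) (components c X)"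
  shows "vfield A V X"
  unfolding vfield_def
proof (intro allI impI, elim conjE)
  fix W f assume W: "open W" "W \<subseteq> V" and f: "smooth_fun A W f"
  show "smooth_fun A W (\<lambda>p. dirder A p (X p) f)"
  proof (rule smooth_fun_localI)
    fix p assume p: "p \<in> W"
    then obtain c W' where c: "c \<in> A" and W': "open W'" "p \<in> W'" "W' \<subseteq> fst c"
      and X: "Cinf_on (snd c ` W') (components c X)" using assms W by blast
    let ?W = "W \<inter> W'"
    have eq: "?W \<inter> fst c = ?W" "W' \<inter> fst c = W'" using W' by auto
    have op: "open (snd c ` ?W)" using open_image[OF c open_Int[OF W(1) W'(1)]] eq by simp
    have "Cinf_on (snd c ` ?W) (\<lambda>x. frechet_derivative (f \<circ> chart_inv c) (at x) (components c X x))"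
      by (rule Cinf_derivative_along[OF onb open_image[OF c W(1)] op smooth_fun_Cinf[OF f c]])
        (use W' in \<open>auto intro: Cinf_subset[OF X] intro!: Cinf_bounded_linear[OF bounded_linear_ident]\<close>)
    then have "Cinf_on (snd c ` ?W) ((\<lambda>p. dirder A p (X p) f) \<circ> chart_inv c)"
    proof (rule Cinf_cong[OF _ op])
      fix x assume "x \<in> snd c ` ?W"
      then obtain q where q: "q \<in> W" "q \<in> W'" "q \<in> fst c" "x = snd c q" using W' by auto
      show "frechet_derivative (f \<circ> chart_inv c) (at x) (components c X x) = ((\<lambda>p. dirder A p (X p) f) \<circ> chart_inv c) x"
        using dirder_chart[OF f q(1) W(1) c q(3)] q c by (simp add: components_def)
    qed
    then show "\<exists>c\<in>A. \<exists>W. open W \<and> p \<in> W \<and> W \<subseteq> fst c \<and> Cinf_on (snd c ` W) ((\<lambda>p. dirder A p (X p) f) \<circ> chart_inv c)"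
      using c p W W' by (intro bexI[of _ c] exI[of _ ?W]) auto
  qed
qed

lemma vfield_smooth: "vfield A V X \<Longrightarrow> open V \<Longrightarrow> smooth_fun A V f \<Longrightarrow> smooth_fun A V (\<lambda>p. dirder A p (X p) f)"
  unfolding vfield_def by blast

lemma vfield_subset: "vfield A V X \<Longrightarrow> W \<subseteq> V \<Longrightarrow> vfield A W X"
  unfolding vfield_def by blast

lemma vfield_from_chart:
  assumes "c \<in> A"
  shows "vfield A (fst c) (\<lambda>q. from_chart c q v)"
proof (rule vfieldI)
  fix p assume "p \<in> fst c"
  have "Cinf_on (snd c ` fst c) (components c (\<lambda>q. from_chart c q v))"
    by (rule Cinf_cong[OF Cinf_const[of _ v] open_chart_image[OF assms]])
      (use assms in \<open>auto simp: components_def\<close>)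
  then show "\<exists>c'\<in>A. \<exists>W. open W \<and> p \<in> W \<and> W \<subseteq> fst c' \<and> Cinf_on (snd c' ` W) (components c' (\<lambda>q. from_chart c q v))"
    using assms \<open>p \<in> fst c\<close> open_chart[OF assms] by blast
qed

lemma vfield_coord_ext: "vfield A (fst (chart_at A p)) (coord_ext A p v)"
  using vfield_from_chart[OF chart_at(1)] by (simp add: coord_ext_eq[abs_def])

lemma dirder_components:
  assumes "smooth_fun A V f" "q \<in> V" "open V" "c \<in> A" "q \<in> fst c"
  shows "dirder A q (X q) f = frechet_derivative (f \<circ> chart_inv c) (at (snd c q)) (components c X (snd c q))"
  using dirder_chart[OF assms] assms by (simp add: components_def)

section \<open>The Lie bracket in a chart\<close>

text \<open>The commutator formula in the chart at p, where stored coordinates and components at p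
  agree. The test function may live on any neighbourhood W, as the definition of the bracket
  requires.\<close>

lemma lie_bracket_components_dirder:
  assumes X: "vfield A V X" and Y: "vfield A V Y" and V: "open V" "p \<in> V"
    and f: "smooth_fun A W f" and W: "open W" "p \<in> W"
  defines "c \<equiv> chart_at A p"
  shows "dirder A p (frechet_derivative (components c Y) (at (snd c p)) (X p)
      - frechet_derivative (components c X) (at (snd c p)) (Y p)) f =
    dirder A p (X p) (\<lambda>q. dirder A q (Y q) f) - dirder A p (Y p) (\<lambda>q. dirder A q (X q) f)"
proof -
  have c: "c \<in> A" "p \<in> fst c" by (auto simp: c_def)
  define S where "S = snd c ` (V \<inter> W \<inter> fst c)"
  have S: "open S" "snd c p \<in> S" unfolding S_def using V W c by (auto intro!: open_image)
  have f': "Cinf_on S (f \<circ> chart_inv c)"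
    unfolding S_def by (rule Cinf_subset[OF smooth_fun_Cinf[OF f c(1)]]) auto
  have X': "Cinf_on S (components c X)" and Y': "Cinf_on S (components c Y)"
    unfolding S_def by (rule Cinf_subset[OF vfield_components[OF X V(1) c(1)]] Cinf_subset[OF vfield_components[OF Y V(1) c(1)]], force)+
  have XX: "components c Z (snd c p) = Z p" for Z by (simp add: c_def)
  have "dirder A p v (\<lambda>q. dirder A q (Z q) f) = frechet_derivative (\<lambda>y. frechet_derivative (f \<circ> chart_inv c) (at y) (components c Z y)) (at (snd c p)) v"
    if Z: "vfield A V Z" for Z v
  proof -
    have sm: "smooth_fun A (V \<inter> W) (\<lambda>q. dirder A q (Z q) f)"
      by (rule vfield_smooth[OF vfield_subset[OF Z] _ smooth_fun_subset[OF f]]) (use V W in auto)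
    have "dirder A p v (\<lambda>q. dirder A q (Z q) f) = frechet_derivative ((\<lambda>q. dirder A q (Z q) f) \<circ> chart_inv c) (at (snd c p)) v"
      using dirder_chart[OF sm _ _ c, of v] V W by (simp add: c_def open_Int)
    also have "\<dots> = frechet_derivative (\<lambda>y. frechet_derivative (f \<circ> chart_inv c) (at y) (components c Z y)) (at (snd c p)) v"
    proof (rule fun_cong[OF frechet_derivative_transform_within_open[OF smooth_fun_differentiable[OF sm _ c] S]])
      fix x assume "x \<in> S"
      then obtain q where q: "q \<in> V" "q \<in> W" "q \<in> fst c" "x = snd c q" unfolding S_def by auto
      show "((\<lambda>q. dirder A q (Z q) f) \<circ> chart_inv c) x = frechet_derivative (f \<circ> chart_inv c) (at x) (components c Z x)"
        using dirder_components[OF f q(2) W(1) c(1) q(3)] q c by simp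
    qed (use V W in auto)
    finally show ?thesis .
  qed
  from this[OF X] this[OF Y] frechet_derivative_commutator[OF onb S f' X' Y'] dirder_chart[OF f W(2,1) c]
  show ?thesis by (simp add: XX) (simp add: c_def)
qed

text \<open>Discharges the definite description: the coordinate commutator has the required action
  on functions, and a vector is determined by that action.\<close>

lemma lie_bracket_components:
  assumes X: "vfield A V X" and Y: "vfield A V Y" and V: "open V" "p \<in> V"
  defines "c \<equiv> chart_at A p"
  shows "lie_bracket A X Y p = frechet_derivative (components c Y) (at (snd c p)) (X p)
      - frechet_derivative (components c X) (at (snd c p)) (Y p)"
proof -
  let ?v = "frechet_derivative (components c Y) (at (snd c p)) (X p)
      - frechet_derivative (components c X) (at (snd c p)) (Y p)"
  note * = lie_bracket_components_dirder[OF X Y V, folded c_def]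
  show ?thesis unfolding lie_bracket_def
  proof (rule the_equality)
    show "\<forall>V f. open V \<and> p \<in> V \<and> smooth_fun A V f \<longrightarrow>
      dirder A p ?v f = dirder A p (X p) (\<lambda>q. dirder A q (Y q) f) - dirder A p (Y p) (\<lambda>q. dirder A q (X q) f)"
      using * by blast
    fix v assume v: "\<forall>V f. open V \<and> p \<in> V \<and> smooth_fun A V f \<longrightarrow>
      dirder A p v f = dirder A p (X p) (\<lambda>q. dirder A q (Y q) f) - dirder A p (Y p) (\<lambda>q. dirder A q (X q) f)"
    show "v = ?v"
      by (rule tangent_eqI[OF V]) (use v * in auto)
  qed
qed

lemma dirder_lie_bracket:
  assumes "vfield A V X" "vfield A V Y" "open V" "p \<in> V" "smooth_fun A W f" "open W" "p \<in> W"
  shows "dirder A p (lie_bracket A X Y p) f =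
    dirder A p (X p) (\<lambda>q. dirder A q (Y q) f) - dirder A p (Y p) (\<lambda>q. dirder A q (X q) f)"
  using lie_bracket_components_dirder[OF assms] lie_bracket_components[OF assms(1-4)] by simp

section \<open>Smooth maps and their tangent maps\<close>

lemma smooth_map_compose:
  assumes F: "smooth_map A A F" and f: "smooth_fun A V f" and V: "open V"
  shows "smooth_fun A (F -` V) (f \<circ> F)"
proof (rule smooth_fun_localI)
  fix p assume p: "p \<in> F -` V"
  let ?c = "chart_at A p" and ?c' = "chart_at A (F p)"
  have cont: "continuous_on UNIV F" using F by (simp add: smooth_map_def)
  define W where "W = F -` (V \<inter> fst ?c') \<inter> fst ?c"
  have W: "open W" "p \<in> W" "W \<subseteq> fst ?c"
    unfolding W_def using p by (auto intro!: open_Int open_vimage cont V open_chart)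
  have op: "open (snd ?c ` W)" using open_image[OF chart_at(1)[of p] W(1)] W(3) by (simp add: inf_absorb1)
  have "Cinf_on (snd ?c ` W) (\<lambda>x. (f \<circ> chart_inv ?c') ((snd ?c' \<circ> F \<circ> chart_inv ?c) x))"
  proof (rule Cinf_compose[OF onb op open_image[OF chart_at(1) V] _ smooth_fun_Cinf[OF f chart_at(1)]])
    have "Cinf_on (snd ?c ` (fst ?c \<inter> F -` fst ?c')) (snd ?c' \<circ> F \<circ> chart_inv ?c)"
      using F unfolding smooth_map_def by (metis chart_at(1))
    then show "Cinf_on (snd ?c ` W) (snd ?c' \<circ> F \<circ> chart_inv ?c)"
      by (rule Cinf_subset) (auto simp: W_def)
  qed (auto simp: W_def)
  then have "Cinf_on (snd ?c ` W) ((f \<circ> F) \<circ> chart_inv ?c)"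
    by (rule Cinf_cong[OF _ op]) (auto simp: W_def)
  then show "\<exists>c\<in>A. \<exists>W. open W \<and> p \<in> W \<and> W \<subseteq> fst c \<and> Cinf_on (snd c ` W) ((f \<circ> F) \<circ> chart_inv c)"
    using W by (intro bexI[of _ ?c]) auto
qed

lemma smooth_map_differentiable:
  assumes F: "smooth_map A A F"
  shows "(snd (chart_at A (F p)) \<circ> F \<circ> chart_inv (chart_at A p)) differentiable (at (snd (chart_at A p) p))"
proof -
  have "Cinf_on (snd (chart_at A p) ` (fst (chart_at A p) \<inter> F -` fst (chart_at A (F p)))) (snd (chart_at A (F p)) \<circ> F \<circ> chart_inv (chart_at A p))"
    using F unfolding smooth_map_def by (metis chart_at(1))
  then show ?thesis by (rule Cinf_differentiable) auto
qed

lemma linear_tangent_map: "smooth_map A A F \<Longrightarrow> linear (tangent_map A F p)"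
  unfolding tangent_map_def by (intro linear_frechet_derivative smooth_map_differentiable)

text \<open>Chain rule in the chosen charts. Together with \<open>tangent_eqI\<close> it
  characterises the tangent map by its action on functions, without reference to these
  charts.\<close>

lemma dirder_tangent_map:
  assumes F: "smooth_map A A F" and f: "smooth_fun A V f" and V: "open V" "F p \<in> V"
  shows "dirder A (F p) (tangent_map A F p v) f = dirder A p v (f \<circ> F)"
proof -
  let ?c = "chart_at A p" and ?c' = "chart_at A (F p)"
  have cont: "continuous_on UNIV F" using F by (simp add: smooth_map_def)
  define W where "W = F -` (V \<inter> fst ?c')"
  have W: "open W" "p \<in> W"
    unfolding W_def using V by (auto intro!: open_Int open_vimage cont open_chart)
  have sm: "smooth_fun A W (f \<circ> F)"
    by (rule smooth_fun_subset[OF smooth_map_compose[OF F f V(1)]]) (auto simp: W_def)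
  have "dirder A p v (f \<circ> F) = frechet_derivative ((f \<circ> chart_inv ?c') \<circ> (snd ?c' \<circ> F \<circ> chart_inv ?c)) (at (snd ?c p)) v"
    unfolding dirder_def
    by (intro fun_cong[OF frechet_derivative_transform_within_open[OF
          smooth_fun_differentiable[OF sm W(2) chart_at] open_image[OF chart_at(1) W(1)]]])
      (auto simp: W_def W intro!: imageI V)
  also have "\<dots> = frechet_derivative (f \<circ> chart_inv ?c') (at (snd ?c' (F p))) (tangent_map A F p v)"
    using frechet_derivative_compose[OF smooth_map_differentiable[OF F, of p], of "f \<circ> chart_inv ?c'"]
      smooth_fun_differentiable[OF f V(2) chart_at] by (simp add: tangent_map_def)
  finally show ?thesis by (simp add: dirder_def)
qed

text \<open>The hypothesis is applied to the coordinate functions of the target charts, whose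
  pullbacks are the components of the chart expression of F.\<close>

lemma smooth_mapI:
  assumes "continuous_on UNIV F" "\<And>V f. open V \<Longrightarrow> smooth_fun A V f \<Longrightarrow> smooth_fun A (F -` V) (f \<circ> F)"
  shows "smooth_map A A F"
  unfolding smooth_map_def
proof (intro conjI ballI assms(1))
  fix c c' assume c: "c \<in> A" "c' \<in> A"
  have op: "open (F -` fst c')" using assms(1) open_chart[OF c(2)] by (rule open_vimage[rotated])
  show "Cinf_on (snd c ` (fst c \<inter> F -` fst c')) (snd c' \<circ> F \<circ> chart_inv c)"
  proof (rule Cinf_componentwise[OF onb])
    show "open (snd c ` (fst c \<inter> F -` fst c'))" using open_image[OF c(1) op] by (simp add: Int_commute)
    fix b
    have "smooth_fun A (F -` fst c') ((\<lambda>q. snd c' q \<bullet> b) \<circ> F)"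
      by (rule assms(2)[OF open_chart[OF c(2)] smooth_fun_coord[OF c(2)]])
    from smooth_fun_Cinf[OF this c(1)]
    show "Cinf_on (snd c ` (fst c \<inter> F -` fst c')) (\<lambda>x. (snd c' \<circ> F \<circ> chart_inv c) x \<bullet> b)"
      by (simp add: o_def Int_commute)
  qed
qed

lemma smooth_map_comp:
  assumes F: "smooth_map A A F" and H: "smooth_map A A H"
  shows "smooth_map A A (F \<circ> H)"
proof (rule smooth_mapI)
  have cont: "continuous_on UNIV F" "continuous_on UNIV H" using F H by (simp_all add: smooth_map_def)
  then show "continuous_on UNIV (F \<circ> H)" by (metis continuous_on_compose continuous_on_subset subset_UNIV)
  show "smooth_fun A ((F \<circ> H) -` V) (f \<circ> (F \<circ> H))" if "open V" "smooth_fun A V f" for V f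
    using smooth_map_compose[OF H smooth_map_compose[OF F that(2,1)] open_vimage[OF that(1) cont(1)]]
    by (simp add: o_assoc vimage_comp)
qed

lemma tangent_map_compose:
  assumes F: "smooth_map A A F" and H: "smooth_map A A H"
  shows "tangent_map A F (H p) (tangent_map A H p v) = tangent_map A (F \<circ> H) p v"
proof (rule tangent_eqI[of UNIV])
  fix f W assume f: "open W" "F (H p) \<in> W" "smooth_fun A W f"
  have cF: "continuous_on UNIV F" using F by (simp add: smooth_map_def)
  have "dirder A (F (H p)) (tangent_map A F (H p) (tangent_map A H p v)) f = dirder A p v ((f \<circ> F) \<circ> H)"
    using dirder_tangent_map[OF F f(3,1,2)] dirder_tangent_map[OF H smooth_map_compose[OF F f(3,1)], of p v] f
    by (simp add: open_vimage[OF _ cF])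
  also have "\<dots> = dirder A (F (H p)) (tangent_map A (F \<circ> H) p v) f"
    using dirder_tangent_map[OF smooth_map_comp[OF F H] f(3,1), of p v] f by (simp add: o_assoc)
  finally show "dirder A (F (H p)) (tangent_map A F (H p) (tangent_map A H p v)) f =
      dirder A (F (H p)) (tangent_map A (F \<circ> H) p v) f" .
qed auto

lemma tangent_map_id: "tangent_map A (\<lambda>x. x) p v = v"
  using to_chart_self[of p v] unfolding tangent_map_def to_chart_def by (simp add: o_def)

end

section \<open>Alternating functions\<close>

lemma alternating_linear:
  "alternating k T \<Longrightarrow> length xs = k \<Longrightarrow> i < k \<Longrightarrow> linear (\<lambda>x. T (xs[i := x]))"
  and alternating_eq: "alternating k T \<Longrightarrow> length xs = k \<Longrightarrow> i < j \<Longrightarrow> j < k \<Longrightarrow> xs ! i = xs ! j \<Longrightarrow> T xs = 0"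
  unfolding alternating_def by blast+

lemma alternating_eq':
  "alternating k T \<Longrightarrow> length xs = k \<Longrightarrow> i \<noteq> j \<Longrightarrow> i < k \<Longrightarrow> j < k \<Longrightarrow> xs ! i = xs ! j \<Longrightarrow> T xs = 0"
  by (metis alternating_eq linorder_neqE_nat)

text \<open>Polarisation: expand the vanishing value at x + y in both slots.\<close>

lemma alternating_swap:
  assumes T: "alternating k T" and xs: "length xs = k" "i \<noteq> j" "i < k" "j < k"
  shows "T (xs[i := x, j := y]) = - T (xs[i := y, j := x])"
proof -
  have l1: "linear (\<lambda>z. T (xs[i := w, j := z]))" for w
    using alternating_linear[OF T, of "xs[i := w]" j] xs by simp
  have l2: "linear (\<lambda>z. T (xs[i := z, j := w]))" for w
    using alternating_linear[OF T, of "xs[j := w]" i] xs by (simp add: list_update_swap)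
  have 0: "T (xs[i := w, j := w]) = 0" for w
    by (rule alternating_eq'[OF T _ xs(2-4)]) (use xs in \<open>auto simp: nth_list_update\<close>)
  have "0 = T (xs[i := x + y, j := x + y])" by (simp add: 0)
  also have "\<dots> = T (xs[i := x, j := x + y]) + T (xs[i := y, j := x + y])"
    by (rule linear_add[OF l2])
  also have "\<dots> = T (xs[i := x, j := y]) + T (xs[i := y, j := x])"
    by (simp add: linear_add[OF l1] 0)
  finally show ?thesis by simp
qed

lemma alternating_map:
  assumes "alternating k T" "linear f"
  shows "alternating k (\<lambda>vs. T (map f vs))"
  unfolding alternating_def
proof (intro allI impI conjI, goal_cases)
  case (1 xs i)
  then show ?case
    using linear_compose[OF assms(2) alternating_linear[OF assms(1), of "map f xs" i]] by (simp add: o_def map_update)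
next
  case (2 xs i j)
  then show ?case by (intro alternating_eq[OF assms(1), of _ i j]) auto
qed

text \<open>A list of basis vectors either has a repetition or is a rearrangement of
  \<open>bl\<close>, reached by transpositions that only change the sign. An arbitrary list reduces
  to this case by expanding its entries in the basis.\<close>

lemma alternating_top_eq_0:
  fixes T :: "'e::real_inner list \<Rightarrow> real"
  assumes onb: "onb (set bl)" and bl: "distinct bl" and T: "alternating (length bl) T" and 0: "T bl = 0"
    and "length vs = length bl"
  shows "T vs = 0"
proof -
  let ?n = "length bl"
  have basis: "T vs = 0" if "length vs = ?n" "set vs \<subseteq> set bl" for vs
  proof (cases "distinct vs")
    case False
    then have "\<exists>i<?n. \<exists>j<?n. i \<noteq> j \<and> vs ! i = vs ! j"
      using that(1) unfolding distinct_conv_nth by metis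
    then show ?thesis using alternating_eq'[OF T that(1)] by blast
  next
    case True
    \<comment> \<open>Here k bounds the number of final entries that may still differ from
      \<open>bl\<close>. The step finds \<open>bl ! j\<close>, for the first open position j, at
      some later position l and swaps it into place.\<close>
    have "T vs = 0" if "distinct vs" "length vs = ?n" "set vs \<subseteq> set bl" "k \<le> ?n" "take (?n - k) vs = take (?n - k) bl" for k vs
      using that
    proof (induction k arbitrary: vs)
      case 0
      then show ?case using \<open>T bl = 0\<close> by simp
    next
      case (Suc k)
      define j where "j = ?n - Suc k"
      have j: "j < ?n" "?n - k = Suc j" using Suc.prems(4) by (auto simp: j_def)
      have al: "vs ! i = bl ! i" if "i < j" for i
        using Suc.prems(5) that by (metis j_def nth_take)
      have "set vs = set bl"
        using Suc.prems bl by (metis card_subset_eq distinct_card finite_set)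
      then obtain l where l: "l < ?n" "vs ! l = bl ! j"
        using j(1) Suc.prems(2) by (metis in_set_conv_nth)
      have lj: "l \<ge> j"
      proof (rule ccontr)
        assume "\<not> l \<ge> j"
        then have "bl ! l = bl ! j" using al l by auto
        then show False using bl l j \<open>\<not> l \<ge> j\<close> by (simp add: nth_eq_iff_index_eq)
      qed
      let ?ws = "vs[j := vs ! l, l := vs ! j]"
      have "T ?ws = 0"
      proof (rule Suc.IH)
        show "distinct ?ws" by (subst distinct_swap) (use Suc.prems j l in simp_all)
        show "set ?ws \<subseteq> set bl" by (subst set_swap) (use Suc.prems j l in simp_all)
        show "take (?n - k) ?ws = take (?n - k) bl"
        proof (rule nth_equalityI)
          fix i assume i: "i < length (take (?n - k) ?ws)"
          then show "take (?n - k) ?ws ! i = take (?n - k) bl ! i"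
            using j l lj al[of i] Suc.prems(2) by (auto simp: nth_list_update less_Suc_eq)
        qed (use Suc.prems in auto)
      qed (use Suc.prems in auto)
      moreover have "T ?ws = T vs \<or> T ?ws = - T vs"
      proof (cases "l = j")
        case False
        then have "T ?ws = - T (vs[j := vs ! j, l := vs ! l])"
          using Suc.prems(2) j l by (intro alternating_swap[OF T]) auto
        then show ?thesis by simp
      qed simp
      ultimately show ?case by auto
    qed
    from this[of vs ?n] True that show ?thesis by simp
  qed
  \<comment> \<open>Here k is the number of leading entries that are still arbitrary. The step
    expands the last of them, in slot k of the list.\<close>
  have "T vs = 0" if "length vs = ?n" "k \<le> ?n" "\<forall>i<?n. k \<le> i \<longrightarrow> vs ! i \<in> set bl" for k vs
    using that
  proof (induction k arbitrary: vs)
    case 0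
    then show ?case by (intro basis) (auto simp: in_set_conv_nth)
  next
    case (Suc k)
    have lin: "linear (\<lambda>x. T (vs[k := x]))" using Suc.prems by (intro alternating_linear[OF T]) auto
    have "T vs = T (vs[k := vs ! k])" by simp
    also have "\<dots> = (\<Sum>b\<in>set bl. (vs ! k \<bullet> b) *\<^sub>R T (vs[k := b]))"
      by (rule onb_linear_expand[OF onb lin])
    also have "\<dots> = 0"
    proof (rule sum.neutral, rule ballI)
      fix b assume "b \<in> set bl"
      then have "T (vs[k := b]) = 0"
        using Suc.prems by (intro Suc.IH) (auto simp: nth_list_update)
      then show "(vs ! k \<bullet> b) *\<^sub>R T (vs[k := b]) = 0" by simp
    qed
    finally show ?case .
  qed
  from this[of vs ?n] assms(5) show ?thesis by simp
qed

text \<open>Forms of top degree make up a line: the combination T'(bl) T - T(bl) T' vanishes on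
  \<open>bl\<close>, hence everywhere. The product form avoids a division by a value that may be
  0.\<close>

lemma alternating_top_proportional:
  fixes T :: "'e::real_inner list \<Rightarrow> real"
  assumes onb: "onb (set bl)" and bl: "distinct bl" and T: "alternating (length bl) T"
    and T': "alternating (length bl) T'" and "length vs = length bl"
  shows "T vs * T' bl = T bl * T' vs"
proof -
  have "alternating (length bl) (\<lambda>vs. T' bl * T vs - T bl * T' vs)"
    unfolding alternating_def
  proof (intro allI impI conjI, goal_cases)
    case (1 xs i)
    then show ?case
      using linear_compose_sub[OF linear_compose_scale_right[OF alternating_linear[OF T 1], of "T' bl"]
          linear_compose_scale_right[OF alternating_linear[OF T' 1], of "T bl"]] by simp
  next
    case (2 xs i j)
    then show ?case using alternating_eq[OF T] alternating_eq[OF T'] by (metis diff_self mult_zero_right)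
  qed
  from alternating_top_eq_0[OF onb bl this _ assms(5)] show ?thesis by (simp add: algebra_simps)
qed

text \<open>The infinitesimal version of the determinant: acting as a derivation, L multiplies a
  form of top degree by its trace. The left side is itself alternating, so it is proportional to T,
  and the factor is found on \<open>bl\<close>.\<close>

lemma alternating_trace:
  fixes T :: "'e::real_inner list \<Rightarrow> real" and L :: "'e \<Rightarrow> 'e"
  assumes onb: "onb (set bl)" and bl: "distinct bl" and T: "alternating (length bl) T" and L: "linear L"
    and vs: "length vs = length bl"
  shows "(\<Sum>i<length bl. T (vs[i := L (vs ! i)])) = (\<Sum>b\<in>set bl. L b \<bullet> b) * T vs"
proof -
  let ?n = "length bl"
  define D where "D vs = (\<Sum>i<?n. T (vs[i := L (vs ! i)]))" for vs
  have "alternating ?n D"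
    unfolding alternating_def
  proof (intro allI impI conjI)
    fix xs :: "'e list" and i assume xs: "length xs = ?n" "i < ?n"
    have "linear (\<lambda>x. T ((xs[i := x])[k := L (xs[i := x] ! k)]))" if k: "k < ?n" for k
    proof (cases "k = i")
      case True
      have "linear ((\<lambda>x. T (xs[i := x])) \<circ> L)"
        by (intro linear_compose L alternating_linear[OF T xs])
      then show ?thesis using True xs by (simp add: o_def)
    next
      case False
      then show ?thesis using alternating_linear[OF T, of "xs[k := L (xs ! k)]" i] xs k
        by (simp add: list_update_swap)
    qed
    then show "linear (\<lambda>x. D (xs[i := x]))" unfolding D_def by (intro linear_compose_sum) auto
  next
    fix xs :: "'e list" and i j assume xs: "length xs = ?n" and ij: "i < j \<and> j < ?n \<and> xs ! i = xs ! j"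
    have "T (xs[k := L (xs ! k)]) = 0" if "k < ?n" "k \<noteq> i" "k \<noteq> j" for k
      by (rule alternating_eq[OF T, of _ i j]) (use that xs ij in auto)
    \<comment> \<open>If L acts in any other slot, the equal entries i and j survive and the term
      vanishes. The two terms left are exchanged by a transposition and cancel.\<close>
    then have "D xs = (\<Sum>k\<in>{i, j}. T (xs[k := L (xs ! k)]))"
      unfolding D_def using ij by (intro sum.mono_neutral_right) auto
    also have "\<dots> = T (xs[i := L (xs ! i), j := xs ! i]) + T (xs[i := xs ! i, j := L (xs ! i)])"
    proof -
      have "xs[i := L (xs ! i), j := xs ! i] = xs[i := L (xs ! i)]"
        using ij by (metis list_update_id list_update_swap order_less_imp_not_eq)
      moreover have "xs[i := xs ! i, j := L (xs ! i)] = xs[j := L (xs ! j)]"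
        using ij by (metis list_update_id)
      ultimately show ?thesis using ij by (metis (no_types, lifting) finite.emptyI finite_insert insert_absorb insert_not_empty order_less_irrefl singletonD sum.empty sum.insert add.right_neutral)
    qed
    also have "\<dots> = 0"
      using alternating_swap[OF T xs, of i j "L (xs ! i)" "xs ! i"] ij by simp
    finally show "D xs = 0" .
  qed
  \<comment> \<open>An off-diagonal component of L repeats another basis vector of the list, so only
    the diagonal one contributes.\<close>
  have upd: "T (bl[i := L (bl ! i)]) = (L (bl ! i) \<bullet> (bl ! i)) * T bl" if i: "i < ?n" for i
  proof -
    have "T (bl[i := L (bl ! i)]) = (\<Sum>b\<in>set bl. (L (bl ! i) \<bullet> b) *\<^sub>R T (bl[i := b]))"
      using onb_linear_expand[OF onb alternating_linear[OF T refl i]] by blast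
    also have "\<dots> = (\<Sum>b\<in>{bl ! i}. (L (bl ! i) \<bullet> b) *\<^sub>R T (bl[i := b]))"
    proof (rule sum.mono_neutral_right)
      show "\<forall>b\<in>set bl - {bl ! i}. (L (bl ! i) \<bullet> b) *\<^sub>R T (bl[i := b]) = 0"
      proof
        fix b assume "b \<in> set bl - {bl ! i}"
        then obtain j where "j < ?n" "b = bl ! j" "j \<noteq> i" by (auto simp: in_set_conv_nth)
        then show "(L (bl ! i) \<bullet> b) *\<^sub>R T (bl[i := b]) = 0"
          using alternating_eq'[OF T, of "bl[i := b]" i j] i by simp
      qed
    qed (use i in auto)
    finally show ?thesis by simp
  qed
  have Dbl: "D bl = (\<Sum>b\<in>set bl. L b \<bullet> b) * T bl"
    unfolding D_def by (simp add: upd sum_distrib_right sum.reindex_bij_betw[OF bij_betw_nth[OF bl refl refl], of "\<lambda>b. (L b \<bullet> b) * T bl"])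
  show ?thesis
  proof (cases "T bl = 0")
    case True
    then have "\<And>vs. length vs = ?n \<Longrightarrow> T vs = 0" using alternating_top_eq_0[OF onb bl T] by blast
    then show ?thesis using vs by simp
  next
    case False
    from alternating_top_proportional[OF onb bl \<open>alternating ?n D\<close> T vs] Dbl False
    show ?thesis by (simp add: D_def)
  qed
qed

text \<open>Leibniz rule for a multilinear function of a list. The slots are made variable one at a
  time, and each new slot is expanded in the basis so that the ordinary product rule
  applies.\<close>

lemma alternating_has_derivative:
  fixes T :: "'e::real_inner list \<Rightarrow> real" and Ys :: "('a::real_normed_vector \<Rightarrow> 'e) list"
    and bs :: "'e set"
  assumes onb: "onb bs" and T: "alternating n T" and Ys: "length Ys = n"
    and D: "\<And>i. i < n \<Longrightarrow> ((Ys ! i) has_derivative D i) (at x)"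
  shows "((\<lambda>x. T (map (\<lambda>Y. Y x) Ys)) has_derivative (\<lambda>u. \<Sum>i<n. T ((map (\<lambda>Y. Y x) Ys)[i := D i u]))) (at x)"
proof -
  \<comment> \<open>The first k slots carry the moving vectors, the others are frozen at
    \<open>ws\<close>. The induction must vary \<open>ws\<close>, since the expansion freezes a
    basis vector in slot k.\<close>
  define F where "F k ws y = take k (map (\<lambda>Y. Y y) Ys) @ drop k ws" for k ws y
  have len: "length (F k ws y) = n" if "k \<le> n" "length ws = n" for k ws y
    using that Ys by (simp add: F_def)
  have upd: "F k (ws[k := b]) y = (F k ws y)[k := b]" if "k < n" "length ws = n" for k ws y b
    using that Ys by (simp add: F_def list_update_append drop_update_swap)
  have suc: "F (Suc k) ws y = (F k ws y)[k := (Ys ! k) y]" if "k < n" "length ws = n" for k ws y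
    using that Ys by (intro nth_equalityI) (auto simp: F_def nth_append nth_list_update less_Suc_eq)
  have "((\<lambda>y. T (F k ws y)) has_derivative (\<lambda>u. \<Sum>i<k. T ((F k ws x)[i := D i u]))) (at x)"
    if "k \<le> n" "length ws = n" for k ws
    using that
  proof (induction k arbitrary: ws)
    case 0
    then show ?case by (simp add: F_def)
  next
    case (Suc k)
    have k: "k < n" "k \<le> n" using Suc.prems by auto
    have exp: "T ((F k ws y)[k := v]) = (\<Sum>b\<in>bs. (v \<bullet> b) * T (F k (ws[k := b]) y))" for y v
      using onb_linear_expand[OF onb alternating_linear[OF T len[OF k(2) Suc.prems(2), of y] k(1)], of v]
      by (simp add: upd[OF k(1) Suc.prems(2)])
    have "((\<lambda>y. \<Sum>b\<in>bs. ((Ys ! k) y \<bullet> b) * T (F k (ws[k := b]) y)) has_derivative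
      (\<lambda>u. \<Sum>b\<in>bs. ((Ys ! k) x \<bullet> b) * (\<Sum>i<k. T ((F k (ws[k := b]) x)[i := D i u])) + (D k u \<bullet> b) * T (F k (ws[k := b]) x))) (at x)"
      using D[OF k(1)] Suc.IH[OF k(2)] Suc.prems(2)
      by (intro has_derivative_sum has_derivative_mult) (auto intro: has_derivative_inner_left)
    moreover have "(\<Sum>b\<in>bs. ((Ys ! k) x \<bullet> b) * (\<Sum>i<k. T ((F k (ws[k := b]) x)[i := D i u])) + (D k u \<bullet> b) * T (F k (ws[k := b]) x)) =
        (\<Sum>i<Suc k. T ((F (Suc k) ws x)[i := D i u]))" for u
    proof -
      have "(\<Sum>b\<in>bs. ((Ys ! k) x \<bullet> b) * (\<Sum>i<k. T ((F k (ws[k := b]) x)[i := D i u]))) =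
        (\<Sum>i<k. \<Sum>b\<in>bs. ((Ys ! k) x \<bullet> b) * T ((F k (ws[k := b]) x)[i := D i u]))"
        by (simp add: sum_distrib_left) (rule sum.swap)
      also have "\<dots> = (\<Sum>i<k. T ((F (Suc k) ws x)[i := D i u]))"
      proof (rule sum.cong[OF refl])
        fix i assume "i \<in> {..<k}"
        then have i: "i < k" by simp
        have "linear (\<lambda>v. T (((F k ws x)[i := D i u])[k := v]))"
          by (rule alternating_linear[OF T]) (use len k Suc.prems in auto)
        from onb_linear_expand[OF onb this, of "(Ys ! k) x"]
        show "(\<Sum>b\<in>bs. ((Ys ! k) x \<bullet> b) * T ((F k (ws[k := b]) x)[i := D i u])) = T ((F (Suc k) ws x)[i := D i u])"
          using i k Suc.prems(2) by (simp add: upd suc list_update_swap[of i k])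
      qed
      finally show ?thesis
        using k Suc.prems(2) by (simp add: sum.distrib exp[symmetric] suc)
    qed
    ultimately show ?case
      using exp[of _ "(Ys ! k) _"] suc[OF k(1) Suc.prems(2)] by simp
  qed
  from this[of n "map (\<lambda>Y. Y x) Ys"] show ?thesis using Ys by (simp add: F_def)
qed

section \<open>Wedge products\<close>

text \<open>If entries i and j agree, composing each permutation with their transposition preserves
  the product and reverses the sign, so the sum equals its own negative.\<close>

lemma wedge_alternating: "alternating (length \<alpha>s) (\<lambda>Xs. wedge Xs \<alpha>s)"
  unfolding alternating_def
proof (intro allI impI conjI)
  let ?n = "length \<alpha>s"
  fix Xs :: "'a list" and i assume Xs: "length Xs = ?n" "i < ?n"
  have "linear (\<lambda>x. of_int (sign \<sigma>) * (\<Prod>k<?n. blinfun_apply (\<alpha>s ! \<sigma> k) (Xs[i := x] ! k)))" for \<sigma>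
  proof -
    have "(\<Prod>k<?n. blinfun_apply (\<alpha>s ! \<sigma> k) (Xs[i := x] ! k)) =
      blinfun_apply (\<alpha>s ! \<sigma> i) x * (\<Prod>k\<in>{..<?n} - {i}. blinfun_apply (\<alpha>s ! \<sigma> k) (Xs ! k))" for x
      using Xs by (subst prod.remove[of _ i]) auto
    then show ?thesis
      by (intro linearI) (simp_all add: blinfun.add_right blinfun.scaleR_right algebra_simps)
  qed
  then show "linear (\<lambda>x. wedge (Xs[i := x]) \<alpha>s)"
    unfolding wedge_def length_list_update Xs(1) by (intro linear_compose_sum) auto
next
  let ?n = "length \<alpha>s"
  fix Xs :: "'a list" and i j assume Xs: "length Xs = ?n" and ij: "i < j \<and> j < ?n \<and> Xs ! i = Xs ! j"
  let ?t = "Transposition.transpose i j"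
  have t: "?t permutes {..<?n}" using ij by (intro permutes_swap_id) auto
  have inv: "(\<Prod>k<?n. blinfun_apply (\<alpha>s ! (\<sigma> \<circ> ?t) k) (Xs ! k)) = (\<Prod>k<?n. blinfun_apply (\<alpha>s ! \<sigma> k) (Xs ! k))" for \<sigma>
  proof -
    have "(\<Prod>k<?n. blinfun_apply (\<alpha>s ! (\<sigma> \<circ> ?t) k) (Xs ! k)) = (\<Prod>k<?n. (\<lambda>l. blinfun_apply (\<alpha>s ! \<sigma> l) (Xs ! l)) (?t k))"
      using ij by (intro prod.cong) (auto simp: Transposition.transpose_def)
    also have "\<dots> = (\<Prod>k<?n. blinfun_apply (\<alpha>s ! \<sigma> k) (Xs ! k))"
      by (rule prod.reindex_bij_betw) (rule permutes_imp_bij[OF t])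
    finally show ?thesis .
  qed
  have "wedge Xs \<alpha>s = (\<Sum>\<sigma> | \<sigma> permutes {..<?n}. of_int (sign (\<sigma> \<circ> ?t)) * (\<Prod>k<?n. blinfun_apply (\<alpha>s ! (\<sigma> \<circ> ?t) k) (Xs ! k)))"
    unfolding wedge_def Xs by (rule sum_permutations_compose_right[OF t])
  also have "\<dots> = (\<Sum>\<sigma> | \<sigma> permutes {..<?n}. - (of_int (sign \<sigma>) * (\<Prod>k<?n. blinfun_apply (\<alpha>s ! \<sigma> k) (Xs ! k))))"
  proof (rule sum.cong[OF refl])
    fix \<sigma> assume "\<sigma> \<in> {\<sigma>. \<sigma> permutes {..<?n}}"
    then have "permutation \<sigma>" by (auto simp: permutation_permutes)
    then have "sign (\<sigma> \<circ> ?t) = - sign \<sigma>"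
      using ij by (simp add: sign_compose permutation_swap_id sign_swap_id)
    then show "of_int (sign (\<sigma> \<circ> ?t)) * (\<Prod>k<?n. blinfun_apply (\<alpha>s ! (\<sigma> \<circ> ?t) k) (Xs ! k)) =
      - (of_int (sign \<sigma>) * (\<Prod>k<?n. blinfun_apply (\<alpha>s ! \<sigma> k) (Xs ! k)))" by (simp add: inv del: comp_apply)
  qed
  also have "\<dots> = - wedge Xs \<alpha>s" unfolding wedge_def Xs by (simp add: sum_negf)
  finally show "wedge Xs \<alpha>s = 0" by simp
qed

text \<open>A permutation that moves some index contributes a factor 0, so only the identity
  remains. This normalises the invariant volume form on the group.\<close>

lemma wedge_dual:
  assumes "length Xs = length \<alpha>s"
    and "\<And>i j. i < length \<alpha>s \<Longrightarrow> j < length \<alpha>s \<Longrightarrow> blinfun_apply (\<alpha>s ! i) (Xs ! j) = (if i = j then 1 else 0)"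
  shows "wedge Xs \<alpha>s = 1"
proof -
  let ?n = "length \<alpha>s"
  have "wedge Xs \<alpha>s = (\<Sum>\<sigma>\<in>{id}. of_int (sign \<sigma>) * (\<Prod>i<?n. blinfun_apply (\<alpha>s ! \<sigma> i) (Xs ! i)))"
    unfolding wedge_def assms(1)
  proof (rule sum.mono_neutral_right)
    show "\<forall>\<sigma>\<in>{\<sigma>. \<sigma> permutes {..<?n}} - {id}. of_int (sign \<sigma>) * (\<Prod>i<?n. blinfun_apply (\<alpha>s ! \<sigma> i) (Xs ! i)) = 0"
    proof
      fix \<sigma> assume s: "\<sigma> \<in> {\<sigma>. \<sigma> permutes {..<?n}} - {id}"
      then obtain i where "\<sigma> i \<noteq> i" by fastforce
      then have "i < ?n" "\<sigma> i < ?n" using s permutes_not_in[of \<sigma> "{..<?n}" i] permutes_in_image[of \<sigma> "{..<?n}" i] by auto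
      then have "blinfun_apply (\<alpha>s ! \<sigma> i) (Xs ! i) = 0" using assms(2) \<open>\<sigma> i \<noteq> i\<close> by auto
      then show "of_int (sign \<sigma>) * (\<Prod>i<?n. blinfun_apply (\<alpha>s ! \<sigma> i) (Xs ! i)) = 0"
        using \<open>i < ?n\<close> by auto
    qed
  qed (auto simp: permutes_id finite_permutations)
  also have "\<dots> = 1" by (simp add: assms(2) sign_id)
  finally show ?thesis .
qed

lemma permutations_2: "{\<sigma>. \<sigma> permutes {..<Suc (Suc 0)}} = {id, Transposition.transpose 0 1}"
proof (intro subset_antisym subsetI)
  have two: "{..<Suc (Suc 0)} = {0, 1}" by auto
  fix \<sigma> :: "nat \<Rightarrow> nat"
  {
    assume "\<sigma> \<in> {\<sigma>. \<sigma> permutes {..<Suc (Suc 0)}}"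
    then have s: "\<sigma> permutes {0, 1}" unfolding two by simp
    define t where "t = \<sigma> 0"
    have "Transposition.transpose 0 t \<circ> \<sigma> permutes {1}" unfolding t_def using permutes_insert_lemma[OF s] .
    then have id: "Transposition.transpose 0 t \<circ> \<sigma> = id" by simp
    have "\<sigma> = Transposition.transpose 0 t \<circ> (Transposition.transpose 0 t \<circ> \<sigma>)"
      by (simp add: o_assoc)
    then have "\<sigma> = Transposition.transpose 0 t" unfolding id by simp
    moreover have "t = 0 \<or> t = 1" using permutes_in_image[OF s, of 0] by (simp add: t_def)
    ultimately show "\<sigma> \<in> {id, Transposition.transpose 0 1}" by (elim disjE) simp_all
  }
  assume "\<sigma> \<in> {id, Transposition.transpose 0 1}"
  then consider "\<sigma> = id" | "\<sigma> = Transposition.transpose 0 1" by blast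
  then show "\<sigma> \<in> {\<sigma>. \<sigma> permutes {..<Suc (Suc 0)}}"
    by cases (auto intro: permutes_id permutes_swap_id)
qed

lemma wedge_pair: "wedge [x, y] [\<alpha>, \<beta>] = blinfun_apply \<alpha> x * blinfun_apply \<beta> y - blinfun_apply \<beta> x * blinfun_apply \<alpha> y"
proof -
  have "id \<noteq> Transposition.transpose 0 (1::nat)"
  proof
    assume "id = Transposition.transpose 0 (1::nat)"
    from fun_cong[OF this, of 0] show False by simp
  qed
  moreover have "length [x, y] = Suc (Suc 0)" by simp
  ultimately show ?thesis
    unfolding wedge_def by (simp only: permutations_2) (simp add: sign_id sign_swap_id)
qed

lemma onb_blinfun_expand:
  fixes bs :: "'e::real_inner set" and \<beta> :: "'e \<Rightarrow>\<^sub>L real"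
  assumes "onb bs"
  shows "\<beta> = (\<Sum>b\<in>bs. blinfun_apply \<beta> b *\<^sub>R blinfun_inner_left b)"
proof (rule blinfun_eqI)
  fix v
  show "blinfun_apply \<beta> v = blinfun_apply (\<Sum>b\<in>bs. blinfun_apply \<beta> b *\<^sub>R blinfun_inner_left b) v"
    using onb_linear_expand[OF assms bounded_linear.linear[OF blinfun.bounded_linear_right[of \<beta>]], of v]
    by (simp add: blinfun.sum_left blinfun.scaleR_left mult.commute)
qed

section \<open>Bivectors\<close>

lemma bivector_linear:
  fixes P :: "'v::real_vector list \<Rightarrow> real"
  assumes "alternating 2 P"
  shows "linear (\<lambda>\<alpha>. P [\<alpha>, \<beta>])" "linear (\<lambda>\<beta>. P [\<alpha>, \<beta>])" "P [\<alpha>, \<beta>] = - P [\<beta>, \<alpha>]"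
  using alternating_linear[OF assms, of "[\<alpha>, \<beta>]" 0] alternating_linear[OF assms, of "[\<alpha>, \<beta>]" 1]
    alternating_swap[OF assms, of "[\<alpha>, \<beta>]" 0 1 \<alpha> \<beta>] by auto

text \<open>Discharges the definite description: the values of P on the functionals dual to the
  basis are the components of a suitable vector, and these functionals separate vectors.\<close>

lemma sharp_apply:
  fixes P :: "('e::real_inner \<Rightarrow>\<^sub>L real) list \<Rightarrow> real" and bs :: "'e set"
  assumes onb: "onb bs" and P: "alternating 2 P"
  shows "blinfun_apply \<beta> (sharp P \<alpha>) = P [\<alpha>, \<beta>]"
proof -
  let ?v = "\<Sum>b\<in>bs. P [\<alpha>, blinfun_inner_left b] *\<^sub>R b"
  have v: "blinfun_apply \<beta> ?v = P [\<alpha>, \<beta>]" for \<beta>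
  proof -
    have "P [\<alpha>, \<beta>] = P [\<alpha>, \<Sum>b\<in>bs. blinfun_apply \<beta> b *\<^sub>R blinfun_inner_left b]"
      using onb_blinfun_expand[OF onb] by metis
    also have "\<dots> = (\<Sum>b\<in>bs. blinfun_apply \<beta> b * P [\<alpha>, blinfun_inner_left b])"
      by (simp add: linear_sum[OF bivector_linear(2)[OF P]] linear_scale[OF bivector_linear(2)[OF P]])
    finally show ?thesis by (simp add: blinfun.sum_right blinfun.scaleR_right mult.commute)
  qed
  have "sharp P \<alpha> = ?v" unfolding sharp_def
  proof (rule the_equality)
    show "\<forall>\<beta>. blinfun_apply \<beta> ?v = P [\<alpha>, \<beta>]" using v by blast
    fix w assume "\<forall>\<beta>. blinfun_apply \<beta> w = P [\<alpha>, \<beta>]"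
    then have "blinfun_apply (blinfun_inner_left b) w = blinfun_apply (blinfun_inner_left b) ?v" for b
      using v by metis
    then show "w = ?v" by (intro onb_eqI[OF onb]) simp
  qed
  then show ?thesis using v by simp
qed

text \<open>An explicit decomposition over pairs of basis vectors shows that the choice in
  \<open>wedge_sum\<close> succeeds.\<close>

lemma is_wedge_sum_wedge_sum:
  fixes P :: "('e::real_inner \<Rightarrow>\<^sub>L real) list \<Rightarrow> real" and bs :: "'e set"
  assumes onb: "onb bs" and P: "alternating 2 P"
  shows "is_wedge_sum P (wedge_sum P)"
proof -
  obtain bl where bl: "set bl = bs" "distinct bl" using finite_distinct_list[OF onb_finite[OF onb]] by blast
  \<comment> \<open>Ordered pairs count every decomposable twice, hence the factor 1/2.\<close>
  define c where "c a b = P [blinfun_inner_left a, blinfun_inner_left b] / 2" for a b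
  have c: "c a b = - c b a" for a b unfolding c_def using bivector_linear(3)[OF P] by (metis minus_divide_left)
  define xys where "xys = map (\<lambda>(a, b). (c a b *\<^sub>R a, b)) (List.product bl bl)"
  have "P [\<alpha>, \<beta>] = (\<Sum>(x, y)\<leftarrow>xys. wedge [x, y] [\<alpha>, \<beta>])" for \<alpha> \<beta>
  proof -
    define S where "S \<alpha> \<beta> = (\<Sum>a\<in>bs. \<Sum>b\<in>bs. c a b * blinfun_apply \<alpha> a * blinfun_apply \<beta> b)" for \<alpha> \<beta>
    have "P [\<alpha>, \<beta>] = P [\<Sum>a\<in>bs. blinfun_apply \<alpha> a *\<^sub>R blinfun_inner_left a, \<beta>]"
      using onb_blinfun_expand[OF onb] by metis
    also have "\<dots> = (\<Sum>a\<in>bs. blinfun_apply \<alpha> a * P [blinfun_inner_left a, \<beta>])"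
      by (simp add: linear_sum[OF bivector_linear(1)[OF P]] linear_scale[OF bivector_linear(1)[OF P]])
    also have "\<dots> = (\<Sum>a\<in>bs. blinfun_apply \<alpha> a * P [blinfun_inner_left a, \<Sum>b\<in>bs. blinfun_apply \<beta> b *\<^sub>R blinfun_inner_left b])"
      using onb_blinfun_expand[OF onb, of \<beta>] by metis
    also have "\<dots> = 2 * S \<alpha> \<beta>"
      by (simp add: linear_sum[OF bivector_linear(2)[OF P]] linear_scale[OF bivector_linear(2)[OF P]]
        c_def S_def sum_distrib_left algebra_simps)
    \<comment> \<open>Skewness of the coefficients c gives S(\<beta>, \<alpha>) = -S(\<alpha>,
      \<beta>), so the double of S becomes the antisymmetrised sum.\<close>
    also have "\<dots> = S \<alpha> \<beta> - S \<beta> \<alpha>"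
    proof -
      have "S \<beta> \<alpha> = (\<Sum>a\<in>bs. \<Sum>b\<in>bs. - (c a b * blinfun_apply \<alpha> a * blinfun_apply \<beta> b))"
        unfolding S_def by (subst sum.swap) (intro sum.cong refl, subst c, simp)
      then show ?thesis by (simp add: S_def sum_negf)
    qed
    also have "\<dots> = (\<Sum>a\<in>bs. \<Sum>b\<in>bs. wedge [c a b *\<^sub>R a, b] [\<alpha>, \<beta>])"
      by (simp add: S_def sum_subtractf[symmetric] wedge_pair blinfun.scaleR_right algebra_simps)
    also have "\<dots> = (\<Sum>(a, b)\<in>set (List.product bl bl). wedge [c a b *\<^sub>R a, b] [\<alpha>, \<beta>])"
      by (simp add: bl sum.cartesian_product)
    also have "\<dots> = (\<Sum>(x, y)\<leftarrow>xys. wedge [x, y] [\<alpha>, \<beta>])"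
      using bl by (simp add: xys_def sum_list_distinct_conv_sum_set distinct_product o_def case_prod_unfold)
    finally show ?thesis .
  qed
  then have "is_wedge_sum P xys" unfolding is_wedge_sum_def by blast
  then show ?thesis unfolding wedge_sum_def by (rule someI)
qed

section \<open>Differential forms in charts\<close>

lemma sum_list_sum_swap: "(\<Sum>z\<leftarrow>zs. \<Sum>a\<in>S. f z a) = (\<Sum>a\<in>S. \<Sum>z\<leftarrow>zs. f z a)"
  by (induction zs) (simp_all add: sum.distrib)

context manifold
begin

section \<open>The flat connection of a chart\<close>

text \<open>The covariant derivative of X at p for the flat connection of the chart chosen at p.
  Components in this chart and stored coordinates agree at p, so the result is again a tangent
  vector at p.\<close>

definition chart_deriv :: "('g \<Rightarrow> 'e) \<Rightarrow> 'g \<Rightarrow> 'e \<Rightarrow> 'e" where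
  "chart_deriv X p = frechet_derivative (components (chart_at A p) X) (at (snd (chart_at A p) p))"

lemma components_differentiable:
  assumes "vfield A V X" "open V" "p \<in> V"
  shows "components (chart_at A p) X differentiable (at (snd (chart_at A p) p))"
  using Cinf_differentiable[OF vfield_components[OF assms(1,2) chart_at(1)]] assms(3) by auto

lemma linear_chart_deriv: "vfield A V X \<Longrightarrow> open V \<Longrightarrow> p \<in> V \<Longrightarrow> linear (chart_deriv X p)"
  unfolding chart_deriv_def by (intro linear_frechet_derivative components_differentiable)

text \<open>The flat connection of a chart is torsion-free.\<close>

lemma lie_bracket_chart_deriv:
  "vfield A V X \<Longrightarrow> vfield A V Y \<Longrightarrow> open V \<Longrightarrow> p \<in> V \<Longrightarrow>
    lie_bracket A X Y p = chart_deriv Y p (X p) - chart_deriv X p (Y p)"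
  unfolding chart_deriv_def by (rule lie_bracket_components)

lemma coord_ext_at [simp]: "coord_ext A p v p = v"
  by (simp add: coord_ext_eq)

lemma linear_coord_ext: "q \<in> fst (chart_at A p) \<Longrightarrow> linear (\<lambda>v. coord_ext A p v q)"
  using linear_from_chart[OF chart_at(1)] by (simp add: coord_ext_eq)

lemma chart_deriv_coord_ext: "chart_deriv (coord_ext A p v) p u = 0"
proof -
  have "frechet_derivative (\<lambda>x. v) (at (snd (chart_at A p) p)) =
      frechet_derivative (components (chart_at A p) (coord_ext A p v)) (at (snd (chart_at A p) p))"
    by (rule frechet_derivative_transform_within_open[OF _ open_chart_image[OF chart_at(1)[of p]]])
      (auto simp: components_def coord_ext_eq)
  from fun_cong[OF this, of u] show ?thesis by (simp add: chart_deriv_def)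
qed

lemma lie_bracket_coord_ext:
  assumes "vfield A V X" "open V" "p \<in> V"
  shows "lie_bracket A X (coord_ext A p v) p = - chart_deriv X p v"
  using lie_bracket_chart_deriv[of "V \<inter> fst (chart_at A p)" X "coord_ext A p v" p] assms
  by (simp add: vfield_subset[OF assms(1)] vfield_subset[OF vfield_coord_ext] open_Int open_chart chart_deriv_coord_ext)

lemma smooth_fun_components:
  assumes "vfield A V X" "open V" "c \<in> A"
  shows "smooth_fun A (V \<inter> fst c) (\<lambda>q. to_chart c q (X q) \<bullet> b)"
proof -
  have "smooth_fun A (V \<inter> fst c) (\<lambda>p. dirder A p (X p) (\<lambda>q. snd c q \<bullet> b))"
    using assms(1) unfolding vfield_def
    by (auto intro!: open_Int assms open_chart smooth_fun_subset[OF smooth_fun_coord])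
  then show ?thesis
    by (rule smooth_fun_cong) (use assms in \<open>auto intro!: dirder_coord open_Int open_chart\<close>)
qed

lemma dirder_to_chart:
  assumes "vfield A V X" "open V" "p \<in> V"
  shows "dirder A p u (\<lambda>q. to_chart (chart_at A p) q (X q) \<bullet> b) = chart_deriv X p u \<bullet> b"
  using frechet_derivative_linear_comp[OF bounded_linear_inner_left[of b] components_differentiable[OF assms], of u]
  by (simp add: dirder_def chart_deriv_def o_def components_def)

section \<open>1-forms and their exterior derivative\<close>

lemma oneform_smooth: "oneform A V \<alpha> \<Longrightarrow> open W \<Longrightarrow> W \<subseteq> V \<Longrightarrow> vfield A W X \<Longrightarrow> smooth_fun A W (\<lambda>p. blinfun_apply (\<alpha> p) (X p))"
  unfolding oneform_def by blast

lemma oneform_subset: "oneform A V \<alpha> \<Longrightarrow> W \<subseteq> V \<Longrightarrow> oneform A W \<alpha>"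
  unfolding oneform_def by blast

lemma oneform_expand:
  assumes "c \<in> A" "q \<in> fst c" "linear f"
  shows "f v = (\<Sum>b\<in>bs. (to_chart c q v \<bullet> b) *\<^sub>R f (from_chart c q b))"
  using onb_linear_expand[OF onb linear_compose[OF linear_from_chart[OF assms(1,2)] assms(3)], of "to_chart c q v"]
    assms by (simp add: o_def)

lemma smooth_fun_oneform_coord:
  assumes "oneform A V \<alpha>" "open V"
  shows "smooth_fun A (V \<inter> fst (chart_at A p)) (\<lambda>q. blinfun_apply (\<alpha> q) (coord_ext A p v q))"
  by (rule oneform_smooth[OF assms(1)]) (auto intro!: vfield_subset[OF vfield_coord_ext] open_Int assms open_chart)

text \<open>Leibniz rule that compares Y with the extension of its value at p by constant
  components; the correction is the flat derivative of Y. It relates \<open>ext_deriv\<close>,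
  defined through such extensions, to arbitrary fields.\<close>

lemma dirder_oneform:
  assumes \<alpha>: "oneform A V \<alpha>" and Y: "vfield A V Y" and V: "open V" "p \<in> V"
  shows "dirder A p u (\<lambda>q. blinfun_apply (\<alpha> q) (Y q)) =
    dirder A p u (\<lambda>q. blinfun_apply (\<alpha> q) (coord_ext A p (Y p) q)) + blinfun_apply (\<alpha> p) (chart_deriv Y p u)"
proof -
  let ?c = "chart_at A p"
  let ?V = "V \<inter> fst ?c"
  let ?a = "\<lambda>b q. blinfun_apply (\<alpha> q) (coord_ext A p b q)"
  have V': "open ?V" "p \<in> ?V" using V by (auto intro!: open_Int open_chart)
  have exp: "blinfun_apply (\<alpha> q) v = (\<Sum>b\<in>bs. (to_chart ?c q v \<bullet> b) * ?a b q)" if "q \<in> ?V" for q v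
    using oneform_expand[of ?c q "blinfun_apply (\<alpha> q)" v] that
    by (simp add: coord_ext_eq bounded_linear.linear[OF blinfun.bounded_linear_right])
  have sa: "smooth_fun A ?V (?a b)" for b by (rule smooth_fun_oneform_coord[OF \<alpha> V(1)])
  have sy: "smooth_fun A ?V (\<lambda>q. to_chart ?c q (Y q) \<bullet> b)" for b
    by (rule smooth_fun_components[OF Y V(1) chart_at(1)])
  have "dirder A p u (\<lambda>q. blinfun_apply (\<alpha> q) (Y q)) = dirder A p u (\<lambda>q. \<Sum>b\<in>bs. (to_chart ?c q (Y q) \<bullet> b) * ?a b q)"
    by (rule dirder_cong[OF smooth_fun_subset[OF oneform_smooth[OF \<alpha> V(1) order_refl Y]] V']) (auto intro!: exp)
  also have "\<dots> = (\<Sum>b\<in>bs. (Y p \<bullet> b) * dirder A p u (?a b) + (chart_deriv Y p u \<bullet> b) * blinfun_apply (\<alpha> p) b)"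
    using dirder_sum[OF onb_finite[OF onb] smooth_fun_mult[OF V'(1) sy sa] V'(2)]
    by (simp add: dirder_mult[OF sy sa V'(2)] dirder_to_chart[OF Y V])
  also have "\<dots> = (\<Sum>b\<in>bs. (Y p \<bullet> b) * dirder A p u (?a b)) + blinfun_apply (\<alpha> p) (chart_deriv Y p u)"
    using exp[OF V'(2), of "chart_deriv Y p u"] by (simp add: sum.distrib)
  also have "(\<Sum>b\<in>bs. (Y p \<bullet> b) * dirder A p u (?a b)) = dirder A p u (\<lambda>q. \<Sum>b\<in>bs. (Y p \<bullet> b) * ?a b q)"
    using dirder_sum[OF onb_finite[OF onb] smooth_fun_mult[OF V'(1) smooth_fun_const sa] V'(2), of u "\<lambda>b. Y p \<bullet> b" "\<lambda>b. b"]
    by (simp add: dirder_mult[OF smooth_fun_const sa V'(2)] dirder_const)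
  also have "\<dots> = dirder A p u (?a (Y p))"
  proof (rule dirder_cong[OF sa V', symmetric])
    fix q assume "q \<in> ?V"
    then have "linear (\<lambda>v. blinfun_apply (\<alpha> q) (coord_ext A p v q))"
      using linear_compose[OF linear_coord_ext, of q p "blinfun_apply (\<alpha> q)"]
      by (simp add: o_def bounded_linear.linear[OF blinfun.bounded_linear_right])
    from onb_linear_expand[OF onb this, of "Y p"]
    show "?a (Y p) q = (\<Sum>b\<in>bs. (Y p \<bullet> b) * ?a b q)" by simp
  qed
  finally show ?thesis .
qed

lemma ext_deriv_oneform_pair:
  "ext_deriv A (form_of \<alpha>) p [x, y] =
    dirder A p x (\<lambda>q. blinfun_apply (\<alpha> q) (coord_ext A p y q)) - dirder A p y (\<lambda>q. blinfun_apply (\<alpha> q) (coord_ext A p x q))"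
  by (simp add: ext_deriv_def form_of_def)

text \<open>The extensions by constant components have vanishing bracket. For other fields the two
  Leibniz corrections combine into the bracket term.\<close>

lemma ext_deriv_oneform:
  assumes \<alpha>: "oneform A V \<alpha>" and X: "vfield A V X" and Y: "vfield A V Y" and V: "open V" "p \<in> V"
  shows "ext_deriv A (form_of \<alpha>) p [X p, Y p] =
    dirder A p (X p) (\<lambda>q. blinfun_apply (\<alpha> q) (Y q)) - dirder A p (Y p) (\<lambda>q. blinfun_apply (\<alpha> q) (X q))
      - blinfun_apply (\<alpha> p) (lie_bracket A X Y p)"
  unfolding ext_deriv_oneform_pair dirder_oneform[OF \<alpha> X V] dirder_oneform[OF \<alpha> Y V] lie_bracket_chart_deriv[OF X Y V]
  by (simp add: blinfun.diff_right)

text \<open>The coordinate differential of c in the basis direction b. These are the 1-forms on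
  which smoothness of \<pi> is tested to obtain smooth components.\<close>

definition dcoord :: "('g, 'e) chart \<Rightarrow> 'e \<Rightarrow> 'g \<Rightarrow> 'e \<Rightarrow>\<^sub>L real" where
  "dcoord c b q = Blinfun (\<lambda>v. to_chart c q v \<bullet> b)"

lemma dcoord_apply:
  assumes "c \<in> A" "q \<in> fst c"
  shows "blinfun_apply (dcoord c b q) v = to_chart c q v \<bullet> b"
proof -
  have "bounded_linear (\<lambda>v. to_chart c q v \<bullet> b)"
    by (intro onb_bounded_linear[OF onb] linear_compose[OF linear_to_chart[OF assms], of "\<lambda>v. v \<bullet> b", unfolded o_def]
        bounded_linear.linear[OF bounded_linear_inner_left])
  then show ?thesis by (simp add: dcoord_def bounded_linear_Blinfun_apply)
qed

lemma dcoord_at: "dcoord (chart_at A p) b p = blinfun_inner_left b"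
  by (rule blinfun_eqI) (simp add: dcoord_apply)

lemma oneform_dcoord:
  assumes c: "c \<in> A"
  shows "oneform A (fst c) (dcoord c b)"
  unfolding oneform_def
proof (intro allI impI, elim conjE)
  fix V X assume V: "open V" "V \<subseteq> fst c" and X: "vfield A V X"
  have "smooth_fun A V (\<lambda>q. to_chart c q (X q) \<bullet> b)"
    using smooth_fun_components[OF X V(1) c] V(2) by (simp add: inf_absorb1)
  then show "smooth_fun A V (\<lambda>p. blinfun_apply (dcoord c b p) (X p))"
    by (rule smooth_fun_cong[OF _ V(1)]) (use V c in \<open>auto simp: dcoord_apply\<close>)
qed

section \<open>Bivector fields, coboundaries and contraction\<close>

lemma mvfield_smooth2:
  assumes "mvfield A U 2 \<pi>" "open V" "V \<subseteq> U" "oneform A V \<alpha>" "oneform A V \<beta>"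
  shows "smooth_fun A V (\<lambda>p. \<pi> p [\<alpha> p, \<beta> p])"
proof -
  have "\<forall>V \<alpha>s. open V \<and> V \<subseteq> U \<and> length \<alpha>s = 2 \<and> (\<forall>\<alpha>\<in>set \<alpha>s. oneform A V \<alpha>) \<longrightarrow> smooth_fun A V (\<lambda>p. \<pi> p (map (\<lambda>\<alpha>. \<alpha> p) \<alpha>s))"
    using assms(1) by (simp add: mvfield_def)
  from this[rule_format, of V "[\<alpha>, \<beta>]"] assms show ?thesis by simp
qed

lemma mvfield_alternating: "mvfield A U k \<pi> \<Longrightarrow> p \<in> U \<Longrightarrow> alternating k (\<pi> p)"
  by (simp add: mvfield_def)

lemma to_chart_sharp:
  assumes "mvfield A U 2 \<pi>" "q \<in> U" "c \<in> A" "q \<in> fst c"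
  shows "to_chart c q (sharp (\<pi> q) \<alpha>) \<bullet> b = \<pi> q [\<alpha>, dcoord c b q]"
  using sharp_apply[OF onb mvfield_alternating[OF assms(1,2)], of "dcoord c b q" \<alpha>]
  by (simp add: dcoord_apply[OF assms(3,4)])

text \<open>The components of the field in a chart are the values of \<pi> on \<alpha> and the
  coordinate differentials, which are smooth by the definition of a bivector field.\<close>

lemma vfield_sharp:
  assumes \<pi>: "mvfield A U 2 \<pi>" and U: "open U" and \<alpha>: "oneform A U \<alpha>"
  shows "vfield A U (\<lambda>q. sharp (\<pi> q) (\<alpha> q))"
proof (rule vfieldI)
  fix p assume p: "p \<in> U"
  let ?c = "chart_at A p"
  let ?W = "U \<inter> fst ?c"
  have W: "open ?W" using U by (auto intro!: open_Int open_chart)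
  have "Cinf_on (snd ?c ` ?W) (components ?c (\<lambda>q. sharp (\<pi> q) (\<alpha> q)))"
  proof (rule Cinf_componentwise[OF onb open_image[OF chart_at(1) U]])
    fix b
    have "smooth_fun A ?W (\<lambda>q. \<pi> q [\<alpha> q, dcoord ?c b q])"
      by (rule mvfield_smooth2[OF \<pi> W]) (auto intro: oneform_subset[OF \<alpha>] oneform_subset[OF oneform_dcoord])
    from smooth_fun_Cinf[OF this chart_at(1), of p]
    have "Cinf_on (snd ?c ` ?W) ((\<lambda>q. \<pi> q [\<alpha> q, dcoord ?c b q]) \<circ> chart_inv ?c)" by simp
    then show "Cinf_on (snd ?c ` ?W) (\<lambda>x. components ?c (\<lambda>q. sharp (\<pi> q) (\<alpha> q)) x \<bullet> b)"
      by (rule Cinf_cong[OF _ open_image[OF chart_at(1) U]])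
        (auto simp: components_def to_chart_sharp[OF \<pi>])
  qed
  then show "\<exists>c\<in>A. \<exists>W. open W \<and> p \<in> W \<and> W \<subseteq> fst c \<and> Cinf_on (snd c ` W) (components c (\<lambda>q. sharp (\<pi> q) (\<alpha> q)))"
    using p W by (intro bexI[of _ ?c] exI[of _ ?W]) auto
qed

text \<open>Paired with \<beta>, each summand (y f) x - (x f) y is the value of the decomposable
  bivector on (\<beta>, df). The sum is \<pi>(\<beta>, df), whatever decomposition was
  chosen.\<close>

lemma bracket_fun_apply:
  assumes P: "alternating 2 (\<pi> p)" and f: "smooth_fun A V f" "p \<in> V"
  shows "blinfun_apply \<beta> (bracket_fun A \<pi> f p) = dirder A p (sharp (\<pi> p) \<beta>) f"
proof -
  define df where "df = Blinfun (\<lambda>v. dirder A p v f)"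
  have df: "blinfun_apply df v = dirder A p v f" for v
    using onb_bounded_linear[OF onb dirder_linear[OF f]] by (simp add: df_def bounded_linear_Blinfun_apply)
  have "blinfun_apply \<beta> (bracket_fun A \<pi> f p) = (\<Sum>(x, y)\<leftarrow>wedge_sum (\<pi> p). wedge [x, y] [\<beta>, df])"
  proof -
    have "blinfun_apply \<beta> (\<Sum>(x, y)\<leftarrow>xys. dirder A p y f *\<^sub>R x - dirder A p x f *\<^sub>R y) = (\<Sum>(x, y)\<leftarrow>xys. wedge [x, y] [\<beta>, df])" for xys
      by (induction xys) (auto simp: wedge_pair df blinfun.add_right blinfun.diff_right blinfun.scaleR_right blinfun.zero_right)
    then show ?thesis by (simp add: bracket_fun_def)
  qed
  also have "\<dots> = \<pi> p [\<beta>, df]"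
    using is_wedge_sum_wedge_sum[OF onb P] by (simp add: is_wedge_sum_def)
  also have "\<dots> = dirder A p (sharp (\<pi> p) \<beta>) f"
    using sharp_apply[OF onb P, of df \<beta>] by (simp add: df)
  finally show ?thesis .
qed

lemma blinfun_separates:
  assumes "\<And>\<beta> :: 'e \<Rightarrow>\<^sub>L real. blinfun_apply \<beta> v = blinfun_apply \<beta> w"
  shows "v = w"
proof (rule onb_eqI[OF onb])
  fix b
  from assms[of "blinfun_inner_left b"] show "v \<bullet> b = w \<bullet> b" by simp
qed

text \<open>Classes are sets of fields, so equality means that subtracting the exact field preserves
  the set of coboundaries in both directions; potentials are changed by adding -f or f.\<close>

lemma cohomology_class_coboundary:
  assumes U: "open U" and \<pi>: "mvfield A U 2 \<pi>" and f: "smooth_fun A U f"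
    and Z: "\<And>p. p \<in> U \<Longrightarrow> Z p = bracket_fun A \<pi> f p"
  shows "cohomology_class A U \<pi> Z = cohomology_class A U \<pi> (\<lambda>p. 0)"
proof -
  have add: "bracket_fun A \<pi> (\<lambda>q. g q + k * f q) p = bracket_fun A \<pi> g p + k *\<^sub>R bracket_fun A \<pi> f p"
    if g: "smooth_fun A U g" and p: "p \<in> U" for g k p
  proof -
    have kf: "smooth_fun A U (\<lambda>q. k * f q)" by (intro smooth_fun_mult U smooth_fun_const f)
    then have s: "smooth_fun A U (\<lambda>q. g q + k * f q)" by (intro smooth_fun_add U g)
    have B: "blinfun_apply \<beta> (bracket_fun A \<pi> h p) = dirder A p (sharp (\<pi> p) \<beta>) h" if "smooth_fun A U h" for h \<beta>
      by (rule bracket_fun_apply[of \<pi> p U h \<beta>, OF mvfield_alternating[OF \<pi> p] that p])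
    show "bracket_fun A \<pi> (\<lambda>q. g q + k * f q) p = bracket_fun A \<pi> g p + k *\<^sub>R bracket_fun A \<pi> f p"
      by (rule blinfun_separates)
        (simp add: blinfun.add_right blinfun.scaleR_right B[OF s] B[OF g] B[OF f]
          dirder_add[OF g kf p] dirder_mult[OF smooth_fun_const f p] dirder_const)
  qed
  have sm: "smooth_fun A U (\<lambda>q. g q + k * f q)" if g: "smooth_fun A U g" for g k
    by (intro smooth_fun_mult smooth_fun_add U smooth_fun_const f g)
  have "(\<lambda>p. W p - Z p) \<in> coboundaries A U \<pi> \<longleftrightarrow> W \<in> coboundaries A U \<pi>" for W
  proof
    assume "(\<lambda>p. W p - Z p) \<in> coboundaries A U \<pi>"
    then obtain g where g: "smooth_fun A U g" "\<And>p. p \<in> U \<Longrightarrow> W p - Z p = bracket_fun A \<pi> g p"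
      unfolding coboundaries_def by auto
    have "W p = bracket_fun A \<pi> (\<lambda>q. g q + 1 * f q) p" if "p \<in> U" for p
      using g(2)[OF that] Z[OF that] add[OF g(1) that, of 1] by (simp add: algebra_simps)
    then show "W \<in> coboundaries A U \<pi>" unfolding coboundaries_def using sm[OF g(1), of 1] by blast
  next
    assume "W \<in> coboundaries A U \<pi>"
    then obtain g where g: "smooth_fun A U g" "\<And>p. p \<in> U \<Longrightarrow> W p = bracket_fun A \<pi> g p"
      unfolding coboundaries_def by auto
    have "W p - Z p = bracket_fun A \<pi> (\<lambda>q. g q + (-1) * f q) p" if "p \<in> U" for p
      using g(2)[OF that] Z[OF that] add[OF g(1) that, of "-1"] by simp
    then show "(\<lambda>p. W p - Z p) \<in> coboundaries A U \<pi>" unfolding coboundaries_def using sm[OF g(1), of "-1"] by blast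
  qed
  then show ?thesis unfolding cohomology_class_def by simp
qed

text \<open>The coordinate expression: the components of the bivector contracted with the first
  derivatives of the components of \<alpha>. It depends on P only, so the chosen decomposition drops
  out, and skewness of P accounts for both terms of d\<alpha>.\<close>

lemma contract_ext_deriv:
  assumes P: "alternating 2 P" and \<alpha>: "oneform A U \<alpha>" and U: "open U" "p \<in> U"
  shows "contract P (ext_deriv A (form_of \<alpha>) p) [] =
    (\<Sum>a\<in>bs. \<Sum>b\<in>bs. P [blinfun_inner_left a, blinfun_inner_left b] *
      dirder A p b (\<lambda>q. blinfun_apply (\<alpha> q) (coord_ext A p a q)))"
proof -
  let ?c = "chart_at A p"
  let ?V = "U \<inter> fst ?c"
  let ?a = "\<lambda>b q. blinfun_apply (\<alpha> q) (coord_ext A p b q)"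
  have V': "open ?V" "p \<in> ?V" using U by (auto intro!: open_Int open_chart)
  have sa: "smooth_fun A ?V (?a b)" for b by (rule smooth_fun_oneform_coord[OF \<alpha> U(1)])
  have D: "dirder A p y (?a x) = (\<Sum>a\<in>bs. \<Sum>b\<in>bs. (x \<bullet> a) * (y \<bullet> b) * dirder A p b (?a a))" for x y
  proof -
    have "dirder A p y (?a x) = dirder A p y (\<lambda>q. \<Sum>a\<in>bs. (x \<bullet> a) * ?a a q)"
    proof (rule dirder_cong[OF sa V'])
      fix q assume "q \<in> ?V"
      then have "linear (\<lambda>v. blinfun_apply (\<alpha> q) (coord_ext A p v q))"
        using linear_compose[OF linear_coord_ext, of q p "blinfun_apply (\<alpha> q)"]
        by (simp add: o_def bounded_linear.linear[OF blinfun.bounded_linear_right])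
      from onb_linear_expand[OF onb this, of x]
      show "?a x q = (\<Sum>b\<in>bs. (x \<bullet> b) * ?a b q)" by simp
    qed
    also have "\<dots> = (\<Sum>a\<in>bs. (x \<bullet> a) * dirder A p y (?a a))"
      using dirder_sum[OF onb_finite[OF onb] smooth_fun_mult[OF V'(1) smooth_fun_const sa] V'(2), of y "\<lambda>b. x \<bullet> b" "\<lambda>b. b"]
      by (simp add: dirder_mult[OF smooth_fun_const sa V'(2)] dirder_const)
    also have "\<dots> = (\<Sum>a\<in>bs. \<Sum>b\<in>bs. (x \<bullet> a) * (y \<bullet> b) * dirder A p b (?a a))"
      by (intro sum.cong refl) (subst onb_linear_expand[OF onb dirder_linear[OF sa V'(2)], of y], simp add: sum_distrib_left mult.assoc)
    finally show ?thesis .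
  qed
  have "ext_deriv A (form_of \<alpha>) p [y, x] =
    (\<Sum>a\<in>bs. \<Sum>b\<in>bs. wedge [x, y] [blinfun_inner_left a, blinfun_inner_left b] * dirder A p b (?a a))" for x y
  proof -
    have "ext_deriv A (form_of \<alpha>) p [y, x] = dirder A p y (?a x) - dirder A p x (?a y)"
      by (rule ext_deriv_oneform_pair)
    also have "\<dots> = (\<Sum>a\<in>bs. \<Sum>b\<in>bs. (x \<bullet> a) * (y \<bullet> b) * dirder A p b (?a a)) -
        (\<Sum>a\<in>bs. \<Sum>b\<in>bs. (y \<bullet> a) * (x \<bullet> b) * dirder A p b (?a a))"
      by (rule arg_cong2[where f = "(-)", OF D D])
    also have "\<dots> = (\<Sum>a\<in>bs. \<Sum>b\<in>bs. wedge [x, y] [blinfun_inner_left a, blinfun_inner_left b] * dirder A p b (?a a))"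
      unfolding sum_subtractf[symmetric] by (intro sum.cong refl) (simp add: wedge_pair algebra_simps)
    finally show ?thesis .
  qed
  then have "contract P (ext_deriv A (form_of \<alpha>) p) [] =
    (\<Sum>(x, y)\<leftarrow>wedge_sum P. \<Sum>a\<in>bs. \<Sum>b\<in>bs. wedge [x, y] [blinfun_inner_left a, blinfun_inner_left b] * dirder A p b (?a a))"
    by (simp add: contract_def)
  also have "\<dots> = (\<Sum>a\<in>bs. \<Sum>b\<in>bs. (\<Sum>(x, y)\<leftarrow>wedge_sum P. wedge [x, y] [blinfun_inner_left a, blinfun_inner_left b]) * dirder A p b (?a a))"
    by (simp add: case_prod_unfold sum_list_sum_swap sum_list_mult_const)
  also have "\<dots> = (\<Sum>a\<in>bs. \<Sum>b\<in>bs. P [blinfun_inner_left a, blinfun_inner_left b] * dirder A p b (?a a))"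
    using is_wedge_sum_wedge_sum[OF onb P] by (simp add: is_wedge_sum_def)
  finally show ?thesis .
qed

end

section \<open>Divergence with respect to a volume form\<close>

locale volume = manifold A bs for A :: "('g::topological_space, 'e::real_inner) chart set" and bs :: "'e set" +
  fixes U :: "'g set" and \<mu> :: "'g \<Rightarrow> 'e list \<Rightarrow> real" and bl :: "'e list"
  assumes open_U: "open U" and \<mu>: "volume_form A U \<mu>" and bl: "distinct bl" "set bl = bs"
begin

lemma length_bl: "length bl = dim (UNIV :: 'e set)"
  using distinct_card[OF bl(1)] bl(2) onb_card[OF onb] by simp

lemma onb': "onb (set bl)"
  using onb bl by simp

lemma \<mu>_alternating: "q \<in> U \<Longrightarrow> alternating (length bl) (\<mu> q)"
  using \<mu> unfolding volume_form_def dform_def length_bl by blast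

lemma \<mu>_smooth:
  "open V \<Longrightarrow> V \<subseteq> U \<Longrightarrow> length Xs = length bl \<Longrightarrow> (\<And>X. X \<in> set Xs \<Longrightarrow> vfield A V X) \<Longrightarrow> smooth_fun A V (\<lambda>p. \<mu> p (map (\<lambda>X. X p) Xs))"
  using \<mu> unfolding volume_form_def dform_def length_bl by blast

lemma \<mu>_basis_nonzero:
  assumes "p \<in> U"
  shows "\<mu> p bl \<noteq> 0"
proof
  assume "\<mu> p bl = 0"
  then have "\<mu> p vs = 0" if "length vs = length bl" for vs
    using alternating_top_eq_0[OF onb' bl(1) \<mu>_alternating[OF assms] _ that] by blast
  then show False using \<mu> assms unfolding volume_form_def length_bl by blast
qed

text \<open>The coefficient of \<open>\<mu>\<close> in the coordinates of the chart chosen at p, as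
  a function of q.\<close>

definition density :: "'g \<Rightarrow> 'g \<Rightarrow> real" where
  "density p q = \<mu> q (map (\<lambda>b. coord_ext A p b q) bl)"

lemma density_at: "density p p = \<mu> p bl"
  by (simp add: density_def)

lemma density_smooth: "smooth_fun A (U \<inter> fst (chart_at A p)) (density p)"
proof -
  have "smooth_fun A (U \<inter> fst (chart_at A p)) (\<lambda>q. \<mu> q (map (\<lambda>X. X q) (map (coord_ext A p) bl)))"
    by (rule \<mu>_smooth) (auto intro!: open_Int open_U open_chart vfield_subset[OF vfield_coord_ext])
  then show ?thesis by (simp add: density_def[abs_def] o_def)
qed

lemma \<mu>_coord_ext:
  assumes q: "q \<in> U" "q \<in> fst (chart_at A p)" and p: "p \<in> U" and vs: "length vs = length bl"
  shows "\<mu> q (map (\<lambda>v. coord_ext A p v q) vs) = density p q / \<mu> p bl * \<mu> p vs"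
proof -
  have "alternating (length bl) (\<lambda>vs. \<mu> q (map (\<lambda>v. coord_ext A p v q) vs))"
    by (rule alternating_map[OF \<mu>_alternating[OF q(1)] linear_coord_ext[OF q(2)]])
  from alternating_top_proportional[OF onb' bl(1) this \<mu>_alternating[OF p] vs] \<mu>_basis_nonzero[OF p]
  show ?thesis by (simp add: density_def field_simps)
qed

text \<open>The coordinate formula for the divergence: the logarithmic derivative of the density
  plus the trace of the derivative of the components. Brackets with constant fields produce this
  derivative, and \<open>alternating_trace\<close> sums them.\<close>

lemma lie_deriv_volume:
  assumes W: "vfield A U W" and p: "p \<in> U" and vs: "length vs = length bl"
  shows "lie_deriv A W \<mu> p vs = (dirder A p (W p) (density p) / \<mu> p bl + (\<Sum>b\<in>bs. chart_deriv W p b \<bullet> b)) * \<mu> p vs"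
proof -
  let ?V = "U \<inter> fst (chart_at A p)"
  have V: "open ?V" "p \<in> ?V" using p by (auto intro!: open_U open_chart)
  have "dirder A p (W p) (\<lambda>q. \<mu> q (map (\<lambda>v. coord_ext A p v q) vs)) = dirder A p (W p) (\<lambda>q. density p q * (\<mu> p vs / \<mu> p bl))"
    by (rule dirder_cong[OF smooth_fun_mult[OF V(1) density_smooth smooth_fun_const] V, symmetric])
      (use p vs in \<open>auto simp: \<mu>_coord_ext\<close>)
  also have "\<dots> = dirder A p (W p) (density p) / \<mu> p bl * \<mu> p vs"
    by (subst dirder_mult[OF density_smooth smooth_fun_const V(2)]) (simp add: dirder_const)
  finally have 1: "dirder A p (W p) (\<lambda>q. \<mu> q (map (\<lambda>v. coord_ext A p v q) vs)) = dirder A p (W p) (density p) / \<mu> p bl * \<mu> p vs" .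
  have "\<mu> p (vs[i := lie_bracket A W (coord_ext A p (vs ! i)) p]) = - \<mu> p (vs[i := chart_deriv W p (vs ! i)])" if "i < length bl" for i
    unfolding lie_bracket_coord_ext[OF W open_U p]
    by (rule linear_neg[OF alternating_linear[OF \<mu>_alternating[OF p] vs that]])
  then have "(\<Sum>i<length vs. \<mu> p (vs[i := lie_bracket A W (coord_ext A p (vs ! i)) p])) = - (\<Sum>i<length bl. \<mu> p (vs[i := chart_deriv W p (vs ! i)]))"
    using vs by (simp add: sum_negf)
  also have "\<dots> = - (\<Sum>b\<in>bs. chart_deriv W p b \<bullet> b) * \<mu> p vs"
    using alternating_trace[OF onb' bl(1) \<mu>_alternating[OF p] linear_chart_deriv[OF W open_U p] vs] bl(2) by simp
  finally show ?thesis unfolding lie_deriv_def 1 by (simp add: algebra_simps)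
qed

text \<open>Replaces the coordinate extensions in \<open>lie_deriv\<close> by arbitrary fields, so
  that brackets can later be computed in an invariant frame. Both sides carry a factor from the
  other list of vectors, so no division is involved and the fields may be dependent at p.\<close>

lemma lie_deriv_frame:
  assumes W: "vfield A U W" and p: "p \<in> U" and vs: "length vs = length bl"
    and Es: "length Es = length bl" "\<And>E. E \<in> set Es \<Longrightarrow> vfield A U E"
  shows "lie_deriv A W \<mu> p vs * \<mu> p (map (\<lambda>E. E p) Es) =
    (dirder A p (W p) (\<lambda>q. \<mu> q (map (\<lambda>E. E q) Es)) - (\<Sum>i<length bl. \<mu> p ((map (\<lambda>E. E p) Es)[i := lie_bracket A W (Es ! i) p]))) * \<mu> p vs"
proof -
  let ?n = "length bl"
  let ?c = "chart_at A p"
  let ?V = "U \<inter> fst ?c"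
  have V: "open ?V" "p \<in> ?V" using p by (auto intro!: open_U open_chart)
  let ?E = "map (\<lambda>E. E p) Es"
  define tr where "tr = (\<Sum>b\<in>bs. chart_deriv W p b \<bullet> b)"
  \<comment> \<open>The components of the fields at q, inserted into the fixed form at p. The value
    of \<open>\<mu>\<close> on the fields is this determinant times the relative density.\<close>
  define g where "g q = \<mu> p (map (\<lambda>E. to_chart ?c q (E q)) Es)" for q
  have sE: "smooth_fun A U (\<lambda>q. \<mu> q (map (\<lambda>E. E q) Es))"
    by (rule \<mu>_smooth[OF open_U order_refl Es])
  have frame: "\<mu> q (map (\<lambda>E. E q) Es) = density p q / \<mu> p bl * g q" if "q \<in> ?V" for q
    using \<mu>_coord_ext[of q p "map (\<lambda>E. to_chart ?c q (E q)) Es"] that p Es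
    by (simp add: coord_ext_eq o_def g_def)
  have gp: "g p = \<mu> p ?E" by (simp add: g_def)
  let ?D = "\<lambda>u. \<Sum>i<?n. \<mu> p (?E[i := chart_deriv (Es ! i) p u])"
  have dg: "((g \<circ> chart_inv ?c) has_derivative ?D) (at (snd ?c p))"
  proof -
    have "((\<lambda>x. \<mu> p (map (\<lambda>Y. Y x) (map (components ?c) Es))) has_derivative
       (\<lambda>u. \<Sum>i<?n. \<mu> p ((map (\<lambda>Y. Y (snd ?c p)) (map (components ?c) Es))[i := chart_deriv (Es ! i) p u]))) (at (snd ?c p))"
    proof (rule alternating_has_derivative[OF onb \<mu>_alternating[OF p]])
      fix i assume i: "i < ?n"
      then have "vfield A U (Es ! i)" using Es by auto
      from components_differentiable[OF this open_U p] i Es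
      show "(map (components ?c) Es ! i has_derivative chart_deriv (Es ! i) p) (at (snd ?c p))"
        by (simp add: chart_deriv_def frechet_derivative_works)
    qed (use Es in simp)
    then show ?thesis by (simp add: g_def o_def components_def[abs_def])
  qed
  have dirg: "dirder A p u (\<lambda>q. density p q * (g q / \<mu> p bl)) = ?D u + dirder A p u (density p) / \<mu> p bl * \<mu> p ?E" for u
  proof -
    have dg': "((\<lambda>x. g (chart_inv ?c x) / \<mu> p bl) has_derivative (\<lambda>u. ?D u / \<mu> p bl)) (at (snd ?c p))"
      using bounded_linear.has_derivative[OF bounded_linear_divide[of "\<mu> p bl"] dg] by (simp add: o_def)
    have "dirder A p u (\<lambda>q. density p q * (g q / \<mu> p bl)) = density p p * (?D u / \<mu> p bl) + dirder A p u (density p) * (g p / \<mu> p bl)"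
      using frechet_derivative_scaleR[OF smooth_fun_differentiable[OF density_smooth V(2) chart_at] differentiableI[OF dg'], of u]
        fun_cong[OF frechet_derivative_at[OF dg'], of u]
      by (simp add: dirder_def o_def)
    then show ?thesis using \<mu>_basis_nonzero[OF p] by (simp add: density_at gp)
  qed
  have "dirder A p (W p) (\<lambda>q. \<mu> q (map (\<lambda>E. E q) Es)) = dirder A p (W p) (\<lambda>q. density p q / \<mu> p bl * g q)"
    by (rule dirder_cong[OF smooth_fun_subset[OF sE] V frame]) auto
  also have "\<dots> = ?D (W p) + dirder A p (W p) (density p) / \<mu> p bl * \<mu> p ?E"
    using dirg by simp
  finally have 1: "dirder A p (W p) (\<lambda>q. \<mu> q (map (\<lambda>E. E q) Es)) = ?D (W p) + dirder A p (W p) (density p) / \<mu> p bl * \<mu> p ?E" .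
  \<comment> \<open>By the torsion-free formula. The derivatives of the fields along W cancel those
    coming from g, and the derivatives of W add up to its trace.\<close>
  have "\<mu> p (?E[i := lie_bracket A W (Es ! i) p]) = \<mu> p (?E[i := chart_deriv (Es ! i) p (W p)]) - \<mu> p (?E[i := chart_deriv W p (?E ! i)])"
    if i: "i < ?n" for i
  proof -
    have "vfield A U (Es ! i)" using i Es by auto
    from lie_bracket_chart_deriv[OF W this open_U p] linear_diff[OF alternating_linear[OF \<mu>_alternating[OF p], of ?E i]] i Es
    show ?thesis by simp
  qed
  then have "(\<Sum>i<?n. \<mu> p (?E[i := lie_bracket A W (Es ! i) p])) = ?D (W p) - (\<Sum>i<?n. \<mu> p (?E[i := chart_deriv W p (?E ! i)]))"
    by (simp add: sum_subtractf)
  also have "(\<Sum>i<?n. \<mu> p (?E[i := chart_deriv W p (?E ! i)])) = tr * \<mu> p ?E"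
    using alternating_trace[OF onb' bl(1) \<mu>_alternating[OF p] linear_chart_deriv[OF W open_U p], of ?E] Es bl(2) by (simp add: tr_def)
  finally have 2: "(\<Sum>i<?n. \<mu> p (?E[i := lie_bracket A W (Es ! i) p])) = ?D (W p) - tr * \<mu> p ?E" .
  show ?thesis unfolding 1 2 lie_deriv_volume[OF W p vs] tr_def[symmetric] by (simp add: algebra_simps)
qed

text \<open>In coordinates, the trace in the divergence of \<pi>^# \<alpha> splits into derivatives
  of \<pi> and derivatives of \<alpha>. The latter are exactly the contraction subtracted in the
  formula, so the right side is linear in the value of \<alpha> at p and is represented by a
  vector.\<close>

lemma X_field_exists:
  assumes \<pi>: "mvfield A U 2 \<pi>" and p: "p \<in> U"
  shows "\<exists>v. \<forall>\<alpha> vs. oneform A U \<alpha> \<and> length vs = dim (UNIV :: 'e set) \<longrightarrow>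
     blinfun_apply (\<alpha> p) v * \<mu> p vs =
       lie_deriv A (\<lambda>q. sharp (\<pi> q) (\<alpha> q)) \<mu> p vs
       - contract (\<pi> p) (ext_deriv A (form_of \<alpha>) p) [] * \<mu> p vs"
proof -
  let ?c = "chart_at A p"
  let ?V = "U \<inter> fst ?c"
  have V: "open ?V" "p \<in> ?V" using p by (auto intro!: open_U open_chart)
  define \<Theta> where "\<Theta> a b q = \<pi> q [dcoord ?c a q, dcoord ?c b q]" for a b q
  have s\<Theta>: "smooth_fun A ?V (\<Theta> a b)" for a b
    unfolding \<Theta>_def by (rule mvfield_smooth2[OF \<pi> V(1)]) (auto intro: oneform_subset[OF oneform_dcoord])
  note P = mvfield_alternating[OF \<pi>]
  \<comment> \<open>The logarithmic derivative of the density at p.\<close>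
  define m where "m u = dirder A p u (density p) / \<mu> p bl" for u
  have m: "linear m"
    using linear_compose_scale_right[OF dirder_linear[OF density_smooth V(2)], of "inverse (\<mu> p bl)"]
    by (simp add: m_def[abs_def] divide_inverse mult.commute)
  \<comment> \<open>Component a is the coordinate divergence of row a of \<pi> plus the logarithmic
    derivative of the density along the image of the covector dual to a.\<close>
  define v where "v = (\<Sum>a\<in>bs. ((\<Sum>b\<in>bs. dirder A p b (\<Theta> a b)) + m (sharp (\<pi> p) (blinfun_inner_left a))) *\<^sub>R a)"
  have "blinfun_apply (\<alpha> p) v * \<mu> p vs =
       lie_deriv A (\<lambda>q. sharp (\<pi> q) (\<alpha> q)) \<mu> p vs
       - contract (\<pi> p) (ext_deriv A (form_of \<alpha>) p) [] * \<mu> p vs"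
    if \<alpha>: "oneform A U \<alpha>" and vs: "length vs = dim (UNIV :: 'e set)" for \<alpha> vs
  proof -
    let ?W = "\<lambda>q. sharp (\<pi> q) (\<alpha> q)"
    let ?a = "\<lambda>b q. blinfun_apply (\<alpha> q) (coord_ext A p b q)"
    have W: "vfield A U ?W" by (rule vfield_sharp[OF \<pi> open_U \<alpha>])
    have sa: "smooth_fun A ?V (?a b)" for b by (rule smooth_fun_oneform_coord[OF \<alpha> open_U])
    have exp: "to_chart ?c q (?W q) \<bullet> b = (\<Sum>a\<in>bs. ?a a q * \<Theta> a b q)" if q: "q \<in> ?V" for q b
    proof -
      have eq: "\<alpha> q = (\<Sum>a\<in>bs. ?a a q *\<^sub>R dcoord ?c a q)"
      proof (rule blinfun_eqI)
        fix w
        show "blinfun_apply (\<alpha> q) w = blinfun_apply (\<Sum>a\<in>bs. ?a a q *\<^sub>R dcoord ?c a q) w"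
          using oneform_expand[of ?c q "blinfun_apply (\<alpha> q)" w] q
          by (simp add: coord_ext_eq bounded_linear.linear[OF blinfun.bounded_linear_right] blinfun.sum_left blinfun.scaleR_left dcoord_apply mult.commute)
      qed
      have Pq: "alternating 2 (\<pi> q)" using P q by simp
      have "\<pi> q [\<alpha> q, dcoord ?c b q] = \<pi> q [\<Sum>a\<in>bs. ?a a q *\<^sub>R dcoord ?c a q, dcoord ?c b q]"
        by (rule arg_cong[OF eq])
      also have "\<dots> = (\<Sum>a\<in>bs. ?a a q * \<Theta> a b q)"
        by (simp add: \<Theta>_def linear_sum[OF bivector_linear(1)[OF Pq]] linear_scale[OF bivector_linear(1)[OF Pq]])
      finally have "\<pi> q [\<alpha> q, dcoord ?c b q] = (\<Sum>a\<in>bs. ?a a q * \<Theta> a b q)" .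
      then show ?thesis using to_chart_sharp[OF \<pi>, of q ?c "\<alpha> q" b] q by simp
    qed
    have "chart_deriv ?W p b \<bullet> b = (\<Sum>a\<in>bs. blinfun_apply (\<alpha> p) a * dirder A p b (\<Theta> a b) + dirder A p b (?a a) * \<Theta> a b p)" for b
    proof -
      have "chart_deriv ?W p b \<bullet> b = dirder A p b (\<lambda>q. to_chart ?c q (?W q) \<bullet> b)"
        by (rule dirder_to_chart[OF W open_U p, symmetric])
      also have "\<dots> = dirder A p b (\<lambda>q. \<Sum>a\<in>bs. ?a a q * \<Theta> a b q)"
        by (rule dirder_cong[OF smooth_fun_components[OF W open_U chart_at(1)] V exp])
      also have "\<dots> = (\<Sum>a\<in>bs. blinfun_apply (\<alpha> p) a * dirder A p b (\<Theta> a b) + dirder A p b (?a a) * \<Theta> a b p)"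
        using dirder_sum[OF onb_finite[OF onb] smooth_fun_mult[OF V(1) sa s\<Theta>] V(2), of b "\<lambda>a. a" "\<lambda>a. a" "\<lambda>a. b"]
        by (simp add: dirder_mult[OF sa s\<Theta> V(2)])
      finally show ?thesis .
    qed
    then have "(\<Sum>b\<in>bs. chart_deriv ?W p b \<bullet> b) =
        (\<Sum>b\<in>bs. \<Sum>a\<in>bs. blinfun_apply (\<alpha> p) a * dirder A p b (\<Theta> a b) + dirder A p b (?a a) * \<Theta> a b p)"
      by simp
    also have "\<dots> = (\<Sum>a\<in>bs. \<Sum>b\<in>bs. blinfun_apply (\<alpha> p) a * dirder A p b (\<Theta> a b) + dirder A p b (?a a) * \<Theta> a b p)"
      by (rule sum.swap)
    finally have tr: "(\<Sum>b\<in>bs. chart_deriv ?W p b \<bullet> b) =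
        (\<Sum>a\<in>bs. blinfun_apply (\<alpha> p) a * (\<Sum>b\<in>bs. dirder A p b (\<Theta> a b))) + (\<Sum>a\<in>bs. \<Sum>b\<in>bs. \<Theta> a b p * dirder A p b (?a a))"
      by (simp add: sum.distrib sum_distrib_left mult.commute)
    have "?W p = (\<Sum>a\<in>bs. blinfun_apply (\<alpha> p) a *\<^sub>R sharp (\<pi> p) (blinfun_inner_left a))"
    proof (rule blinfun_separates)
      fix \<beta>
      have "\<pi> p [\<alpha> p, \<beta>] = \<pi> p [\<Sum>a\<in>bs. blinfun_apply (\<alpha> p) a *\<^sub>R blinfun_inner_left a, \<beta>]"
        using onb_blinfun_expand[OF onb] by metis
      then show "blinfun_apply \<beta> (?W p) = blinfun_apply \<beta> (\<Sum>a\<in>bs. blinfun_apply (\<alpha> p) a *\<^sub>R sharp (\<pi> p) (blinfun_inner_left a))"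
        by (simp add: sharp_apply[OF onb P[OF p]] blinfun.sum_right blinfun.scaleR_right
            linear_sum[OF bivector_linear(1)[OF P[OF p]]] linear_scale[OF bivector_linear(1)[OF P[OF p]]])
    qed
    then have mW: "m (?W p) = (\<Sum>a\<in>bs. blinfun_apply (\<alpha> p) a * m (sharp (\<pi> p) (blinfun_inner_left a)))"
      by (simp add: linear_sum[OF m] linear_scale[OF m])
    \<comment> \<open>This is the second sum in \<open>tr\<close>, the one with derivatives of
      \<alpha>.\<close>
    have con: "contract (\<pi> p) (ext_deriv A (form_of \<alpha>) p) [] = (\<Sum>a\<in>bs. \<Sum>b\<in>bs. \<Theta> a b p * dirder A p b (?a a))"
      using contract_ext_deriv[OF P[OF p] \<alpha> open_U p] by (simp add: \<Theta>_def dcoord_at)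
    have "blinfun_apply (\<alpha> p) v = (\<Sum>a\<in>bs. blinfun_apply (\<alpha> p) a * (\<Sum>b\<in>bs. dirder A p b (\<Theta> a b))) + m (?W p)"
      unfolding mW by (simp add: v_def blinfun.sum_right blinfun.scaleR_right blinfun.add_right sum.distrib distrib_left mult.commute)
    moreover have "lie_deriv A ?W \<mu> p vs = (m (?W p) + (\<Sum>b\<in>bs. chart_deriv ?W p b \<bullet> b)) * \<mu> p vs"
      unfolding m_def by (rule lie_deriv_volume[OF W p]) (simp only: vs length_bl)
    ultimately show ?thesis unfolding con tr by (simp only: distrib_right)
  qed
  then show ?thesis by blast
qed

end

section \<open>Smooth group operations\<close>

lemma frechet_derivative_partial:
  fixes H :: "'a::real_normed_vector \<times> 'b::real_normed_vector \<Rightarrow> 'c::real_normed_vector"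
  assumes "H differentiable (at (a, b))"
  shows "frechet_derivative (\<lambda>x. H (x, b)) (at a) u = frechet_derivative H (at (a, b)) (u, 0)"
    and "frechet_derivative (\<lambda>y. H (a, y)) (at b) v = frechet_derivative H (at (a, b)) (0, v)"
    and "(\<lambda>x. H (x, b)) differentiable (at a)" and "(\<lambda>y. H (a, y)) differentiable (at b)"
proof -
  have H: "(H has_derivative frechet_derivative H (at (a, b))) (at (a, b))"
    using assms by (simp add: frechet_derivative_works)
  have "((\<lambda>x. (x, b)) has_derivative (\<lambda>u. (u, 0))) (at a)" "((\<lambda>y. (a, y)) has_derivative (\<lambda>v. (0, v))) (at b)"
    by (auto intro!: derivative_eq_intros)
  from has_derivative_compose[OF this(1) H] has_derivative_compose[OF this(2) H]
  have D: "((\<lambda>x. H (x, b)) has_derivative (\<lambda>u. frechet_derivative H (at (a, b)) (u, 0))) (at a)"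
    "((\<lambda>y. H (a, y)) has_derivative (\<lambda>v. frechet_derivative H (at (a, b)) (0, v))) (at b)" .
  show "frechet_derivative (\<lambda>x. H (x, b)) (at a) u = frechet_derivative H (at (a, b)) (u, 0)"
    using fun_cong[OF frechet_derivative_at[OF D(1)], of u] by simp
  show "frechet_derivative (\<lambda>y. H (a, y)) (at b) v = frechet_derivative H (at (a, b)) (0, v)"
    using fun_cong[OF frechet_derivative_at[OF D(2)], of v] by simp
  show "(\<lambda>x. H (x, b)) differentiable (at a)" "(\<lambda>y. H (a, y)) differentiable (at b)"
    using D by (blast intro: differentiableI)+
qed

text \<open>Symmetry of the second derivative on the product, in the directions (u, 0) and (0,
  v).\<close>

lemma partial_derivatives_commute:
  fixes H :: "'a::real_normed_vector \<times> 'b::real_normed_vector \<Rightarrow> real"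
  assumes S: "open S" "(a, b) \<in> S" and H: "Cinf_on S H"
  shows "frechet_derivative (\<lambda>y. frechet_derivative (\<lambda>x. H (x, y)) (at a) u) (at b) v =
    frechet_derivative (\<lambda>x. frechet_derivative (\<lambda>y. H (x, y)) (at b) v) (at a) u"
proof -
  note d = frechet_derivative_partial[OF Cinf_differentiable[OF Cinf_derivative[OF H] S(2)]]
  have "open ((\<lambda>y. (a, y)) -` S)" "open ((\<lambda>x. (x, b)) -` S)"
    using S(1) by (auto intro!: open_vimage continuous_intros)
  then have "frechet_derivative (\<lambda>y. frechet_derivative H (at (a, y)) (u, 0)) (at b) v =
      frechet_derivative (\<lambda>y. frechet_derivative (\<lambda>x. H (x, y)) (at a) u) (at b) v"
    "frechet_derivative (\<lambda>x. frechet_derivative H (at (x, b)) (0, v)) (at a) u =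
      frechet_derivative (\<lambda>x. frechet_derivative (\<lambda>y. H (x, y)) (at b) v) (at a) u"
    by (intro fun_cong[OF frechet_derivative_transform_within_open[OF d(4)]]
        fun_cong[OF frechet_derivative_transform_within_open[OF d(3)]],
        auto simp: S frechet_derivative_partial[OF Cinf_differentiable[OF H]])+
  then show ?thesis
    using d(2)[of "(u, 0)" v] d(1)[of "(0, v)" u] second_derivative_symmetric[OF S H, of "(u, 0)" "(0, v)"] by simp
qed

context manifold
begin

section \<open>Smooth binary operations\<close>

definition op_dom :: "('g \<Rightarrow> 'g \<Rightarrow> 'g) \<Rightarrow> 'g set \<Rightarrow> ('g, 'e) chart \<Rightarrow> ('g, 'e) chart \<Rightarrow> ('e \<times> 'e) set" where
  "op_dom m V c c' = {z \<in> snd c ` fst c \<times> snd c' ` fst c'. m (chart_inv c (fst z)) (chart_inv c' (snd z)) \<in> V}"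

definition op_rep :: "('g \<Rightarrow> 'g \<Rightarrow> 'g) \<Rightarrow> ('g \<Rightarrow> real) \<Rightarrow> ('g, 'e) chart \<Rightarrow> ('g, 'e) chart \<Rightarrow> 'e \<times> 'e \<Rightarrow> real" where
  "op_rep m f c c' z = f (m (chart_inv c (fst z)) (chart_inv c' (snd z)))"

text \<open>A smooth binary operation, tested on smooth functions. The condition is symmetric in the two
arguments, so everything below applies to the opposite multiplication, which exchanges left and
right translations.\<close>

definition smooth_op :: "('g \<Rightarrow> 'g \<Rightarrow> 'g) \<Rightarrow> bool" where
  "smooth_op m \<longleftrightarrow> continuous_on UNIV (\<lambda>z. m (fst z) (snd z)) \<and>
     (\<forall>V f. \<forall>c\<in>A. \<forall>c'\<in>A. open V \<and> smooth_fun A V f \<longrightarrow> Cinf_on (op_dom m V c c') (op_rep m f c c'))"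

lemma chart_inv_continuous: "c \<in> A \<Longrightarrow> continuous_on (snd c ` fst c) (chart_inv c)"
  using chart_homeomorphism by (simp add: homeomorphism_def)

lemma open_op_dom:
  assumes m: "continuous_on UNIV (\<lambda>z. m (fst z) (snd z))" and c: "c \<in> A" "c' \<in> A" and V: "open V"
  shows "open (op_dom m V c c')"
proof -
  let ?D = "snd c ` fst c \<times> snd c' ` fst c'"
  have "continuous_on ?D (\<lambda>z. (chart_inv c (fst z), chart_inv c' (snd z)))"
    by (intro continuous_on_Pair continuous_on_compose2[OF chart_inv_continuous[OF c(1)]]
        continuous_on_compose2[OF chart_inv_continuous[OF c(2)]] continuous_on_fst continuous_on_snd continuous_on_id) auto
  then have "continuous_on ?D (\<lambda>z. m (chart_inv c (fst z)) (chart_inv c' (snd z)))"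
    using continuous_on_compose2[OF m, of ?D "\<lambda>z. (chart_inv c (fst z), chart_inv c' (snd z))"] by simp
  then have "open (?D \<inter> (\<lambda>z. m (chart_inv c (fst z)) (chart_inv c' (snd z))) -` V)"
    by (rule continuous_open_preimage) (auto intro!: open_Times open_chart_image c V)
  moreover have "op_dom m V c c' = ?D \<inter> (\<lambda>z. m (chart_inv c (fst z)) (chart_inv c' (snd z))) -` V"
    by (auto simp: op_dom_def)
  ultimately show ?thesis by simp
qed

lemma smooth_op_swap:
  assumes "smooth_op m"
  shows "smooth_op (\<lambda>x y. m y x)"
proof -
  have m: "continuous_on UNIV (\<lambda>z. m (fst z) (snd z))" using assms by (simp add: smooth_op_def)
  have m': "continuous_on UNIV (\<lambda>z. m (snd z) (fst z))"
    using continuous_on_compose2[OF m continuous_on_swap[of UNIV]] by (simp add: prod.swap_def)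
  have "Cinf_on (op_dom (\<lambda>x y. m y x) V c c') (op_rep (\<lambda>x y. m y x) f c c')"
    if "c \<in> A" "c' \<in> A" "open V" "smooth_fun A V f" for V f c c'
  proof -
    have "bounded_linear (\<lambda>z :: 'e \<times> 'e. (snd z, fst z))"
      by (intro bounded_linear_Pair bounded_linear_fst bounded_linear_snd)
    then have "Cinf_on (op_dom (\<lambda>x y. m y x) V c c') (\<lambda>z. op_rep m f c' c (snd z, fst z))"
    proof (intro Cinf_compose[OF onb_prod[OF onb onb] open_op_dom[OF _ that(1-3)] open_op_dom[OF m that(2,1,3)] Cinf_bounded_linear])
      show "continuous_on UNIV (\<lambda>z. m (snd z) (fst z))" by (rule m')
      show "Cinf_on (op_dom m V c' c) (op_rep m f c' c)"
        using assms that unfolding smooth_op_def by blast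
      show "(\<lambda>z. (snd z, fst z)) ` op_dom (\<lambda>x y. m y x) V c c' \<subseteq> op_dom m V c' c"
        by (auto simp: op_dom_def)
    qed
    then show ?thesis by (simp add: op_rep_def[abs_def])
  qed
  then show ?thesis using m' by (simp add: smooth_op_def)
qed

context
  fixes m :: "'g \<Rightarrow> 'g \<Rightarrow> 'g"
  assumes m: "smooth_op m"
begin

lemma op_continuous: "continuous_on UNIV (\<lambda>z. m (fst z) (snd z))"
  using m by (simp add: smooth_op_def)

lemma op_rep_Cinf:
  "c \<in> A \<Longrightarrow> c' \<in> A \<Longrightarrow> open V \<Longrightarrow> smooth_fun A V f \<Longrightarrow> Cinf_on (op_dom m V c c') (op_rep m f c c')"
  using m by (simp add: smooth_op_def)

lemma translation_continuous: "continuous_on UNIV (m p)"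
  using continuous_on_compose2[OF op_continuous, of UNIV "\<lambda>x. (p, x)"]
  by (simp add: continuous_on_Pair)

lemma open_translation: "open V \<Longrightarrow> open {z. m p z \<in> V}"
  using open_vimage[OF _ translation_continuous] by (simp add: vimage_def)

lemma op_dom_chart: "p \<in> fst c \<Longrightarrow> q \<in> fst c' \<Longrightarrow> c \<in> A \<Longrightarrow> c' \<in> A \<Longrightarrow> m p q \<in> V \<Longrightarrow> (snd c p, snd c' q) \<in> op_dom m V c c'"
  by (auto simp: op_dom_def)

lemma smooth_fun_through_op:
  assumes V: "open V" and f: "smooth_fun A V f"
    and W: "open W" and W': "W \<subseteq> fst c'" and c: "c \<in> A" "c' \<in> A" and F: "Cinf_on (op_dom m V c c') F"
    and g: "Cinf_on (snd c' ` W) g" and gV: "\<And>q. q \<in> W \<Longrightarrow> (g (snd c' q), snd c' q) \<in> op_dom m V c c'"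
  shows "Cinf_on (snd c' ` W) (\<lambda>x. F (g x, x))"
proof (rule Cinf_compose[OF onb_prod[OF onb onb] _ open_op_dom[OF op_continuous c V] _ F])
  show op: "open (snd c' ` W)" using open_image[OF c(2) W] W' by (simp add: inf_absorb1)
  show "Cinf_on (snd c' ` W) (\<lambda>x. (g x, x))"
    by (intro Cinf_Pair op g Cinf_bounded_linear bounded_linear_ident)
  show "(\<lambda>x. (g x, x)) ` (snd c' ` W) \<subseteq> op_dom m V c c'" using gV by auto
qed

lemma smooth_fun_translation:
  assumes V: "open V" and f: "smooth_fun A V f"
  shows "smooth_fun A {z. m p z \<in> V} (\<lambda>z. f (m p z))"
proof (rule smooth_fun_localI)
  fix q assume q: "q \<in> {z. m p z \<in> V}"
  let ?c = "chart_at A p" and ?c' = "chart_at A q"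
  let ?W = "{z. m p z \<in> V} \<inter> fst ?c'"
  have W: "open ?W" by (intro open_Int open_translation V open_chart chart_at)
  have "Cinf_on (snd ?c' ` ?W) (\<lambda>x. op_rep m f ?c ?c' (snd ?c p, x))"
    by (rule smooth_fun_through_op[OF V f W _ _ _ op_rep_Cinf[OF _ _ V f] Cinf_const])
      (auto intro: op_dom_chart)
  then have "Cinf_on (snd ?c' ` ?W) ((\<lambda>z. f (m p z)) \<circ> chart_inv ?c')"
    by (simp add: op_rep_def o_def)
  then show "\<exists>c\<in>A. \<exists>W. open W \<and> q \<in> W \<and> W \<subseteq> fst c \<and> Cinf_on (snd c ` W) ((\<lambda>z. f (m p z)) \<circ> chart_inv c)"
    using W q by (intro bexI[of _ ?c'] exI[of _ ?W]) auto
qed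

lemma smooth_map_translation: "smooth_map A A (m p)"
  by (rule smooth_mapI[OF translation_continuous])
    (use smooth_fun_translation in \<open>auto simp: vimage_def o_def\<close>)

lemma dirder_op_fst:
  assumes V: "open V" and f: "smooth_fun A V f" and c': "c' \<in> A" "q \<in> fst c'" and pq: "m p q \<in> V"
  shows "dirder A p u (\<lambda>y. f (m y q)) = frechet_derivative (op_rep m f (chart_at A p) c') (at (snd (chart_at A p) p, snd c' q)) (u, 0)"
  using frechet_derivative_partial(1)[OF Cinf_differentiable[OF op_rep_Cinf[OF chart_at(1) c'(1) V f] op_dom_chart[OF chart_at(2) c'(2) chart_at(1) c'(1) pq]], of u] c'
  by (simp add: dirder_def op_rep_def o_def)

text \<open>For the opposite operation and p the unit, this is smoothness of the action of a
  left-invariant vector field on f.\<close>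

lemma smooth_fun_dirder_fst:
  assumes V: "open V" and f: "smooth_fun A V f"
  shows "smooth_fun A {z. m p z \<in> V} (\<lambda>z. dirder A p u (\<lambda>y. f (m y z)))"
proof (rule smooth_fun_localI)
  fix q assume q: "q \<in> {z. m p z \<in> V}"
  let ?c = "chart_at A p" and ?c' = "chart_at A q"
  let ?W = "{z. m p z \<in> V} \<inter> fst ?c'"
  have W: "open ?W" by (intro open_Int open_translation V open_chart chart_at)
  have op: "open (snd ?c' ` ?W)" using open_image[OF chart_at(1)[of q] W] by (simp add: Int_assoc)
  have "Cinf_on (snd ?c' ` ?W) (\<lambda>x. frechet_derivative (op_rep m f ?c ?c') (at (snd ?c p, x)) (u, 0))"
    by (rule smooth_fun_through_op[OF V f W _ _ _ Cinf_derivative[OF op_rep_Cinf[OF _ _ V f]] Cinf_const])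
      (auto intro: op_dom_chart)
  then have "Cinf_on (snd ?c' ` ?W) ((\<lambda>z. dirder A p u (\<lambda>y. f (m y z))) \<circ> chart_inv ?c')"
    by (rule Cinf_cong[OF _ op]) (auto simp: dirder_op_fst[OF V f chart_at(1)])
  then show "\<exists>c\<in>A. \<exists>W. open W \<and> q \<in> W \<and> W \<subseteq> fst c \<and> Cinf_on (snd c ` W) ((\<lambda>z. dirder A p u (\<lambda>y. f (m y z))) \<circ> chart_inv c)"
    using W q by (intro bexI[of _ ?c'] exI[of _ ?W]) auto
qed

text \<open>The source of the commutation of left- and right-invariant fields: derivatives in the
  two arguments of the operation commute.\<close>

lemma dirder_op_commute:
  assumes V: "open V" and f: "smooth_fun A V f" and pq: "m p q \<in> V"
  shows "dirder A q v (\<lambda>z. dirder A p u (\<lambda>y. f (m y z))) = dirder A p u (\<lambda>y. dirder A q v (\<lambda>z. f (m y z)))"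
  using partial_derivatives_commute[OF open_op_dom[OF op_continuous chart_at(1) chart_at(1) V]
      op_dom_chart[OF chart_at(2) chart_at(2) chart_at(1) chart_at(1) pq] op_rep_Cinf[OF chart_at(1) chart_at(1) V f], of u v]
  by (simp add: dirder_def op_rep_def o_def)

text \<open>With i the group inverse, the translation by i q brings q to the unit; this gives
  smoothness of invariant 1-forms. The translation depends on q but is not differentiated.\<close>

lemma smooth_fun_dirder_vfield:
  assumes V: "open V" and f: "smooth_fun A V f" and Y: "vfield A W Y" and W: "open W"
    and i: "smooth_map A A i" and iV: "\<And>q. q \<in> W \<Longrightarrow> m (i q) q \<in> V"
  shows "smooth_fun A W (\<lambda>q. dirder A q (Y q) (\<lambda>x. f (m (i q) x)))"
proof (rule smooth_fun_localI)
  fix q assume q: "q \<in> W"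
  let ?c = "chart_at A (i q)" and ?c' = "chart_at A q"
  let ?W = "W \<inter> (i -` fst ?c \<inter> fst ?c')"
  have ic: "continuous_on UNIV i" using i by (simp add: smooth_map_def)
  have W': "open ?W" by (intro open_Int open_vimage ic W open_chart chart_at)
  have op: "open (snd ?c' ` ?W)" using open_image[OF chart_at(1)[of q] W'] by (simp add: Int_assoc)
  have gi: "Cinf_on (snd ?c' ` ?W) (snd ?c \<circ> i \<circ> chart_inv ?c')"
    by (rule Cinf_subset[OF i[unfolded smooth_map_def, THEN conjunct2, rule_format, OF chart_at(1) chart_at(1)]]) auto
  \<comment> \<open>Only the second argument is differentiated, so the direction is (0, Y), while
    the base point moves along (i q, q).\<close>
  have "Cinf_on (snd ?c' ` ?W) (\<lambda>x. frechet_derivative (op_rep m f ?c ?c') (at ((snd ?c \<circ> i \<circ> chart_inv ?c') x, x)) (0, components ?c' Y x))"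
  proof (rule Cinf_derivative_along[OF onb_prod[OF onb onb] open_op_dom[OF op_continuous _ _ V] op op_rep_Cinf[OF _ _ V f]])
    show "Cinf_on (snd ?c' ` ?W) (\<lambda>x. (0, components ?c' Y x))"
      by (intro Cinf_Pair op Cinf_const Cinf_subset[OF vfield_components[OF Y W chart_at(1)]]) auto
    show "Cinf_on (snd ?c' ` ?W) (\<lambda>x. ((snd ?c \<circ> i \<circ> chart_inv ?c') x, x))"
      by (intro Cinf_Pair op gi Cinf_bounded_linear bounded_linear_ident)
    show "(\<lambda>x. ((snd ?c \<circ> i \<circ> chart_inv ?c') x, x)) ` snd ?c' ` ?W \<subseteq> op_dom m V ?c ?c'"
      using iV by (auto intro!: op_dom_chart)
  qed auto
  then have "Cinf_on (snd ?c' ` ?W) ((\<lambda>q. dirder A q (Y q) (\<lambda>x. f (m (i q) x))) \<circ> chart_inv ?c')"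
  proof (rule Cinf_cong[OF _ op])
    fix x assume "x \<in> snd ?c' ` ?W"
    then obtain r where r: "r \<in> W" "i r \<in> fst ?c" "r \<in> fst ?c'" "x = snd ?c' r" by auto
    have "dirder A r (Y r) (\<lambda>x. f (m (i r) x)) = frechet_derivative ((\<lambda>x. f (m (i r) x)) \<circ> chart_inv ?c') (at x) (components ?c' Y x)"
      using dirder_components[OF smooth_fun_translation[OF V f, of "i r"] _ open_translation[OF V] chart_at(1) r(3), of Y] iV r by simp
    also have "\<dots> = frechet_derivative (op_rep m f ?c ?c') (at (snd ?c (i r), x)) (0, components ?c' Y x)"
      using frechet_derivative_partial(2)[OF Cinf_differentiable[OF op_rep_Cinf[OF chart_at(1) chart_at(1) V f] op_dom_chart[OF r(2,3) chart_at(1) chart_at(1) iV[OF r(1)]]], of "components ?c' Y x"] r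
      by (simp add: op_rep_def o_def)
    finally show "frechet_derivative (op_rep m f ?c ?c') (at ((snd ?c \<circ> i \<circ> chart_inv ?c') x, x)) (0, components ?c' Y x) =
        ((\<lambda>q. dirder A q (Y q) (\<lambda>x. f (m (i q) x))) \<circ> chart_inv ?c') x"
      using r by simp
  qed
  then show "\<exists>c\<in>A. \<exists>W. open W \<and> q \<in> W \<and> W \<subseteq> fst c \<and> Cinf_on (snd c ` W) ((\<lambda>q. dirder A q (Y q) (\<lambda>x. f (m (i q) x))) \<circ> chart_inv c)"
    using W' q by (intro bexI[of _ ?c'] exI[of _ ?W]) auto
qed

end

end

section \<open>Invariant vector fields and forms\<close>

text \<open>The group is given by bare functions so that the locale can be interpreted twice, for
  the multiplication and for its opposite. In the second case all left-invariant objects below are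
  the right-invariant ones of the original group.\<close>

locale smooth_group = manifold A bs for A :: "('g::topological_space, 'e::real_inner) chart set" and bs :: "'e set" +
  fixes m :: "'g \<Rightarrow> 'g \<Rightarrow> 'g" and e :: 'g and i :: "'g \<Rightarrow> 'g"
  assumes op: "smooth_op m" and inv_smooth: "smooth_map A A i"
    and assoc: "m (m x y) z = m x (m y z)" and unit [simp]: "m e x = x" "m x e = x"
    and inverse [simp]: "m (i x) x = e" "m x (i x) = e"
begin

definition field :: "'e \<Rightarrow> 'g \<Rightarrow> 'e" where
  "field X g = tangent_map A (m g) e X"

text \<open>The left Maurer-Cartan form, which identifies the tangent space at g with the Lie
  algebra.\<close>

definition pull :: "'g \<Rightarrow> 'e \<Rightarrow> 'e" where
  "pull g = tangent_map A (m (i g)) g"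

definition form :: "('e \<Rightarrow>\<^sub>L real) \<Rightarrow> 'g \<Rightarrow> 'e \<Rightarrow>\<^sub>L real" where
  "form \<alpha> g = Blinfun (\<lambda>v. blinfun_apply \<alpha> (pull g v))"

definition br :: "'e \<Rightarrow> 'e \<Rightarrow> 'e" where
  "br X Y = lie_bracket A (field X) (field Y) e"

lemma linear_field: "linear (\<lambda>X. field X g)"
  unfolding field_def by (rule linear_tangent_map[OF smooth_map_translation[OF op]])

lemma linear_pull: "linear (pull g)"
  unfolding pull_def by (rule linear_tangent_map[OF smooth_map_translation[OF op]])

lemma translation_compose [simp]: "m (i g) \<circ> m g = (\<lambda>x. x)" "m g \<circ> m (i g) = (\<lambda>x. x)"
  by (auto simp: fun_eq_iff assoc[symmetric])

lemma pull_field [simp]: "pull g (field X g) = X"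
proof -
  from tangent_map_compose[OF smooth_map_translation[OF op, of "i g"] smooth_map_translation[OF op, of g], where p = e and v = X]
  show ?thesis by (simp add: pull_def field_def tangent_map_id)
qed

lemma field_pull [simp]: "field (pull g v) g = v"
proof -
  from tangent_map_compose[OF smooth_map_translation[OF op, of g] smooth_map_translation[OF op, of "i g"], where p = g and v = v]
  show ?thesis by (simp add: pull_def field_def tangent_map_id)
qed

lemma field_unit [simp]: "field X e = X"
proof -
  have "m e = (\<lambda>x. x)" by auto
  then show ?thesis by (simp add: field_def tangent_map_id)
qed

lemma dirder_field:
  assumes "smooth_fun A V f" "open V" "g \<in> V"
  shows "dirder A g (field X g) f = dirder A e X (\<lambda>x. f (m g x))"
  using dirder_tangent_map[OF smooth_map_translation[OF op, of g] assms(1,2), of e X] assms(3)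
  by (simp add: field_def o_def)

lemma vfield_field: "vfield A V (field X)"
  unfolding vfield_def
proof (intro allI impI, elim conjE)
  fix W f assume W: "open W" "W \<subseteq> V" and f: "smooth_fun A W f"
  \<comment> \<open>The derivative is in the second argument, so the opposite operation is used; the
    set is W itself because e is the unit.\<close>
  have "smooth_fun A {z. m z e \<in> W} (\<lambda>z. dirder A e X (\<lambda>y. f (m z y)))"
    by (rule smooth_fun_dirder_fst[OF smooth_op_swap[OF op] W(1) f])
  then have "smooth_fun A W (\<lambda>z. dirder A e X (\<lambda>y. f (m z y)))" by simp
  then show "smooth_fun A W (\<lambda>p. dirder A p (field X p) f)"
    by (rule smooth_fun_cong[OF _ W(1)]) (simp add: dirder_field[OF f W(1)])
qed

lemma form_apply: "blinfun_apply (form \<alpha> g) v = blinfun_apply \<alpha> (pull g v)"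
proof -
  have "bounded_linear (\<lambda>v. blinfun_apply \<alpha> (pull g v))"
    using onb_bounded_linear[OF onb linear_compose[OF linear_pull bounded_linear.linear[OF blinfun.bounded_linear_right]]]
    by (simp add: o_def)
  then show ?thesis by (simp add: form_def bounded_linear_Blinfun_apply)
qed

lemma form_field [simp]: "blinfun_apply (form \<alpha> g) (field X g) = blinfun_apply \<alpha> X"
  by (simp add: form_apply)

lemma oneform_form: "oneform A V (form \<alpha>)"
  unfolding oneform_def
proof (intro allI impI, elim conjE)
  fix W Y assume W: "open W" "W \<subseteq> V" and Y: "vfield A W Y"
  let ?c = "chart_at A e"
  \<comment> \<open>The components of the translated vector are derivatives of the coordinate
    functions at the unit, composed with the translation by i q.\<close>
  have pb: "pull q (Y q) \<bullet> b = dirder A q (Y q) (\<lambda>x. snd ?c (m (i q) x) \<bullet> b)" for q b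
    using dirder_tangent_map[OF smooth_map_translation[OF op, of "i q"] smooth_fun_coord[OF chart_at(1)[of e]] open_chart[OF chart_at(1)[of e]], of q "Y q" b]
      dirder_coord[OF chart_at(1)[of e] chart_at(2)[of e], of "pull q (Y q)" b]
    by (simp add: pull_def o_def)
  have "smooth_fun A W (\<lambda>q. \<Sum>b\<in>bs. dirder A q (Y q) (\<lambda>x. snd ?c (m (i q) x) \<bullet> b) * blinfun_apply \<alpha> b)"
    by (intro smooth_fun_sum smooth_fun_mult smooth_fun_const W(1)
      smooth_fun_dirder_vfield[OF op open_chart[OF chart_at(1)[of e]] smooth_fun_coord[OF chart_at(1)[of e]] Y W(1) inv_smooth])
      simp
  then show "smooth_fun A W (\<lambda>p. blinfun_apply (form \<alpha> p) (Y p))"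
  proof (rule smooth_fun_cong[OF _ W(1)])
    fix p
    show "(\<Sum>b\<in>bs. dirder A p (Y p) (\<lambda>x. snd ?c (m (i p) x) \<bullet> b) * blinfun_apply \<alpha> b) = blinfun_apply (form \<alpha> p) (Y p)"
      using onb_linear_expand[OF onb bounded_linear.linear[OF blinfun.bounded_linear_right[of \<alpha>]], of "pull p (Y p)"]
      by (simp add: form_apply pb)
  qed
qed

text \<open>Derivatives of f at g along left-invariant fields are those at the unit of f composed
  with the translation by g. Applying this twice moves the commutator to the unit.\<close>

lemma lie_bracket_field: "lie_bracket A (field X) (field Y) g = field (br X Y) g"
proof (rule tangent_eqI[of UNIV])
  fix f W assume W: "open W" "g \<in> W" and f: "smooth_fun A W f"
  let ?W = "{z. m g z \<in> W}" and ?h = "\<lambda>x. f (m g x)"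
  have W': "open ?W" "e \<in> ?W" using W open_translation[OF op] by auto
  have h: "smooth_fun A ?W ?h" by (rule smooth_fun_translation[OF op W(1) f])
  have 2: "dirder A g (field X g) (\<lambda>q. dirder A q (field Y q) f) = dirder A e (field X e) (\<lambda>q. dirder A q (field Y q) ?h)" for X Y
  proof -
    have Yf: "smooth_fun A W (\<lambda>q. dirder A q (field Y q) f)" by (rule vfield_smooth[OF vfield_field W(1) f])
    have "dirder A g (field X g) (\<lambda>q. dirder A q (field Y q) f) = dirder A e X (\<lambda>x. dirder A (m g x) (field Y (m g x)) f)"
      by (rule dirder_field[OF Yf W])
    also have "\<dots> = dirder A e X (\<lambda>x. dirder A x (field Y x) ?h)"
      by (rule dirder_cong[OF smooth_fun_translation[OF op W(1) Yf] W'])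
        (simp add: dirder_field[OF f W(1)] dirder_field[OF h W'(1)] assoc)
    finally show ?thesis by simp
  qed
  have "dirder A g (lie_bracket A (field X) (field Y) g) f = dirder A e (lie_bracket A (field X) (field Y) e) ?h"
    using dirder_lie_bracket[OF vfield_field[of UNIV] vfield_field[of UNIV] _ _ f W(1,2), of X Y]
      dirder_lie_bracket[OF vfield_field[of UNIV] vfield_field[of UNIV] _ _ h W'(1,2), of X Y] 2 by simp
  also have "\<dots> = dirder A g (field (br X Y) g) f"
    unfolding dirder_field[OF f W] br_def ..
  finally show "dirder A g (lie_bracket A (field X) (field Y) g) f = dirder A g (field (br X Y) g) f" .
qed auto

text \<open>A left-invariant form is constant on left-invariant fields, so only the bracket term of
  the invariant formula remains.\<close>

lemma ext_deriv_form: "ext_deriv A (form_of (form \<alpha>)) g [field X g, field Y g] = - blinfun_apply \<alpha> (br X Y)"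
  using ext_deriv_oneform[OF oneform_form[of UNIV \<alpha>] vfield_field[of UNIV X] vfield_field[of UNIV Y], of g]
  by (simp add: lie_bracket_field dirder_const)

end

text \<open>A right-invariant field is the derivative along left translations, which preserve
  left-invariant fields. Either order of differentiation is thus a mixed derivative of f(y z) in y
  at the unit and in z at g.\<close>

lemma (in manifold) dirder_lie_bracket_field:
  assumes L: "smooth_group A bs m e i" and R: "smooth_group A bs (\<lambda>x y. m y x) e i"
    and f: "smooth_fun A V f" and V: "open V" "g \<in> V"
  shows "dirder A g (smooth_group.field A m e X g) (\<lambda>q. dirder A q (smooth_group.field A (\<lambda>x y. m y x) e Y q) f) =
    dirder A g (smooth_group.field A (\<lambda>x y. m y x) e Y g) (\<lambda>q. dirder A q (smooth_group.field A m e X q) f)"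
proof -
  interpret L: smooth_group A bs m e i by fact
  interpret R: smooth_group A bs "\<lambda>x y. m y x" e i by fact
  have Vm: "open {y. m y g \<in> V}" "e \<in> {y. m y g \<in> V}" using open_translation[OF R.op V(1)] V(2) by auto
  have Xf: "smooth_fun A V (\<lambda>q. dirder A q (L.field X q) f)" by (rule vfield_smooth[OF L.vfield_field V(1) f])
  have Yf: "smooth_fun A V (\<lambda>q. dirder A q (R.field Y q) f)" by (rule vfield_smooth[OF R.vfield_field V(1) f])
  have "dirder A g (L.field X g) (\<lambda>q. dirder A q (R.field Y q) f) = dirder A g (L.field X g) (\<lambda>z. dirder A e Y (\<lambda>y. f (m y z)))"
    by (rule dirder_cong[OF Yf V]) (rule R.dirder_field[OF f V(1)])
  also have "\<dots> = dirder A e Y (\<lambda>y. dirder A g (L.field X g) (\<lambda>z. f (m y z)))"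
    by (rule dirder_op_commute[OF L.op V(1) f]) (simp add: V)
  also have "\<dots> = dirder A e Y (\<lambda>y. dirder A (m y g) (L.field X (m y g)) f)"
  proof (rule dirder_cong[OF smooth_fun_translation[OF R.op V(1) Xf, of g] Vm, symmetric])
    fix y assume "y \<in> {y. m y g \<in> V}"
    then show "dirder A (m y g) (L.field X (m y g)) f = dirder A g (L.field X g) (\<lambda>z. f (m y z))"
      using L.dirder_field[OF f V(1), of "m y g" X] L.dirder_field[OF smooth_fun_translation[OF L.op V(1) f] open_translation[OF L.op V(1)], of g y X]
      by (simp add: L.assoc)
  qed
  also have "\<dots> = dirder A g (R.field Y g) (\<lambda>q. dirder A q (L.field X q) f)"
    by (rule R.dirder_field[OF Xf V, symmetric])
  finally show ?thesis .
qed

text \<open>Passes from smoothness in product charts to the test on functions, which treats both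
  arguments alike.\<close>

lemma (in manifold) smooth_op_prod:
  assumes "smooth_map (prod_atlas A A) A (\<lambda>(x, y). m x y)"
  shows "smooth_op m"
proof -
  have cont: "continuous_on UNIV (\<lambda>z. m (fst z) (snd z))"
    using assms by (simp add: smooth_map_def case_prod_unfold)
  have "Cinf_on (op_dom m V c c') (op_rep m f c c')"
    if c: "c \<in> A" "c' \<in> A" and V: "open V" and f: "smooth_fun A V f" for V f c c'
  proof (rule Cinf_local)
    fix z assume z: "z \<in> op_dom m V c c'"
    define d where "d = chart_at A (m (chart_inv c (fst z)) (chart_inv c' (snd z)))"
    \<comment> \<open>Near z the products stay in the single chart d, in which f has a smooth
      expression.\<close>
    define T where "T = op_dom m (V \<inter> fst d) c c'"
    define pc where "pc = (fst c \<times> fst c', map_prod (snd c) (snd c'))"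
    have d: "d \<in> A" by (simp add: d_def)
    have T: "open T" unfolding T_def by (intro open_op_dom cont c open_Int V open_chart d)
    have zT: "z \<in> T" using z by (auto simp: T_def op_dom_def d_def)
    have pc: "pc \<in> prod_atlas A A" using c unfolding prod_atlas_def pc_def by (cases c; cases c') auto
    have "inj_on (snd c) (fst c)" if "c \<in> A" for c
      by (rule inj_on_inverseI[of _ "chart_inv c"]) (use that in simp)
    then have inj: "inj_on (snd pc) (fst pc)"
      unfolding pc_def using c by (simp add: map_prod_inj_on)
    have inv: "chart_inv pc y = (chart_inv c (fst y), chart_inv c' (snd y))" if y: "y \<in> snd c ` fst c \<times> snd c' ` fst c'" for y
    proof -
      obtain a b where ab: "a \<in> fst c" "b \<in> fst c'" "y = (snd c a, snd c' b)" using y by auto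
      then have "y = snd pc (a, b)" "(a, b) \<in> fst pc" by (auto simp: pc_def)
      then have "chart_inv pc y = (a, b)" using inj by (simp add: chart_inv_def)
      then show ?thesis using ab c by simp
    qed
    have sub: "T \<subseteq> snd pc ` (fst pc \<inter> (\<lambda>(x, y). m x y) -` fst d)"
    proof
      fix y assume "y \<in> T"
      then obtain a b where "a \<in> fst c" "b \<in> fst c'" "y = (snd c a, snd c' b)" "m a b \<in> fst d"
        using c by (auto simp: T_def op_dom_def)
      then show "y \<in> snd pc ` (fst pc \<inter> (\<lambda>(x, y). m x y) -` fst d)"
        by (intro image_eqI[of _ _ "(a, b)"]) (auto simp: pc_def)
    qed
    have "Cinf_on (snd pc ` (fst pc \<inter> (\<lambda>(x, y). m x y) -` fst d)) (snd d \<circ> (\<lambda>(x, y). m x y) \<circ> chart_inv pc)"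
      using assms pc d unfolding smooth_map_def by blast
    then have G: "Cinf_on T (snd d \<circ> (\<lambda>(x, y). m x y) \<circ> chart_inv pc)" using sub by (rule Cinf_subset)
    have Tm: "y \<in> snd c ` fst c \<times> snd c' ` fst c'" "m (chart_inv c (fst y)) (chart_inv c' (snd y)) \<in> V"
      "m (chart_inv c (fst y)) (chart_inv c' (snd y)) \<in> fst d" if "y \<in> T" for y
      using that by (auto simp: T_def op_dom_def)
    have "Cinf_on T (\<lambda>y. (f \<circ> chart_inv d) ((snd d \<circ> (\<lambda>(x, y). m x y) \<circ> chart_inv pc) y))"
      by (rule Cinf_compose[OF onb T open_image[OF d V] G smooth_fun_Cinf[OF f d]])
        (use Tm in \<open>auto simp: inv\<close>)
    then have "Cinf_on T (op_rep m f c c')"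
      by (rule Cinf_cong[OF _ T]) (use Tm d in \<open>auto simp: inv op_rep_def\<close>)
    then show "\<exists>T. open T \<and> z \<in> T \<and> Cinf_on T (op_rep m f c c')" using T zT by blast
  qed
  then show ?thesis using cont by (simp add: smooth_op_def)
qed

section \<open>Invariant bilinear forms\<close>

locale metric =
  fixes bs :: "'e::real_inner set" and B :: "'e \<Rightarrow> 'e \<Rightarrow> real"
  assumes onb: "onb bs" and bilinear: "bilinear B" and sym: "B x y = B y x"
    and nondegenerate: "(\<And>y. B x y = 0) \<Longrightarrow> x = 0"
begin

lemma linear_left: "linear (\<lambda>x. B x y)" and linear_right: "linear (B x)"
  using bilinear by (auto simp: bilinear_def)

lemma eqI: "(\<And>y. B x y = B z y) \<Longrightarrow> x = z"
  using nondegenerate[of "x - z"] linear_diff[OF linear_left] by simp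

text \<open>The metric may be indefinite, so it is compared with the inner product of the model
  space through its Gram map S. Nondegeneracy says that S is injective, and finite dimension makes
  it surjective.\<close>

lemma represent:
  assumes f: "linear (f :: 'e \<Rightarrow> real)"
  shows "\<exists>x. \<forall>y. B x y = f y"
proof -
  interpret finite_dimensional_vector_space scaleR bs
  proof unfold_locales
    show "finite bs" by (rule onb_finite[OF onb])
    have "pairwise orthogonal bs" "0 \<notin> bs"
      using onb_inner[OF onb] unfolding pairwise_def orthogonal_def by (auto, fastforce)
    then show "\<not> module.dependent scaleR bs"
      using pairwise_orthogonal_independent by (simp add: dependent_raw_def)
    have "x \<in> span bs" for x
      using onb_expand[OF onb, of x] by (metis (no_types, lifting) span_base span_scale span_sum)
    then show "module.span scaleR bs = UNIV" by (auto simp: span_raw_def)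
  qed
  define S where "S x = (\<Sum>b\<in>bs. B x b *\<^sub>R b)" for x
  have S_inner: "S x \<bullet> y = B x y" for x y
    using onb_linear_expand[OF onb linear_right, of x y]
    by (simp add: S_def inner_sum_left mult.commute inner_commute[of y])
  have "linear S"
    by (rule linearI)
      (auto simp: S_def linear_add[OF linear_left] linear_scale[OF linear_left] algebra_simps sum.distrib scaleR_sum_right)
  moreover have "inj S"
    by (rule injI) (metis S_inner eqI)
  ultimately have "surj S"
    by (intro linear_inj_imp_surj) (simp_all add: linear_def)
  then obtain x where x: "S x = (\<Sum>b\<in>bs. f b *\<^sub>R b)" by (metis surjD)
  have "B x y = f y" for y
    using S_inner[of x y] onb_linear_expand[OF onb f, of y]
    by (simp add: x inner_sum_left mult.commute inner_commute[of y])
  then show ?thesis by blast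
qed

lemma metric_dual_apply: "B (metric_dual B \<alpha>) y = blinfun_apply \<alpha> y"
proof -
  obtain x where x: "\<forall>y. B x y = blinfun_apply \<alpha> y"
    using represent[OF bounded_linear.linear[OF blinfun.bounded_linear_right]] by blast
  have "metric_dual B \<alpha> = x"
    unfolding metric_dual_def by (rule the_equality[of _ x]) (use x in \<open>auto intro: eqI\<close>)
  then show ?thesis using x by simp
qed

context
  fixes L :: "'e \<Rightarrow> 'e"
  assumes skew: "\<And>x y. B (L x) y + B x (L y) = 0"
begin

text \<open>L moves to the other argument of B, in which x enters linearly, and B separates vectors.
  Linearity of the adjoint maps thus follows from invariance of the metric.\<close>

lemma skew_linear: "linear L"
proof (rule linearI)
  have L: "B (L x) y = - B x (L y)" for x y using skew[of x y] by simp
  show "L (x + y) = L x + L y" for x y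
    by (rule eqI) (simp add: L linear_add[OF linear_left])
  show "L (r *\<^sub>R x) = r *\<^sub>R L x" for r x
    by (rule eqI) (simp add: L linear_scale[OF linear_left])
qed

text \<open>In a basis, the trace pairs a symmetric matrix with a skew one.\<close>

lemma skew_trace: "(\<Sum>b\<in>bs. L b \<bullet> b) = 0"
proof -
  have "\<forall>b. \<exists>x. \<forall>y. B x y = b \<bullet> y"
    using represent[OF bounded_linear.linear[OF bounded_linear_inner_right]] by blast
  \<comment> \<open>The basis dual to \<open>bs\<close> under B: pairing with \<open>d b\<close>
    gives the coordinate along b.\<close>
  then obtain d where d: "B (d b) y = b \<bullet> y" for b y by metis
  have exp: "z = (\<Sum>c\<in>bs. B z c *\<^sub>R d c)" for z
  proof (rule eqI)
    fix y
    show "B z y = B (\<Sum>c\<in>bs. B z c *\<^sub>R d c) y"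
      using onb_linear_expand[OF onb linear_right, of z y]
      by (simp add: linear_sum[OF linear_left] linear_scale[OF linear_left] d mult.commute inner_commute[of y])
  qed
  define q where "q b c = B b c * B (d b) (L (d c))" for b c
  have q: "q c b = - q b c" for b c
  proof -
    have "B (d c) (L (d b)) = - B (d b) (L (d c))"
      using skew[of "d b" "d c"] sym[of "d c" "L (d b)"] by simp
    then show ?thesis by (simp add: q_def sym[of c b])
  qed
  have "(\<Sum>b\<in>bs. L b \<bullet> b) = (\<Sum>b\<in>bs. \<Sum>c\<in>bs. q b c)"
  proof (rule sum.cong[OF refl])
    fix b
    have "L b \<bullet> b = B (d b) (L (\<Sum>c\<in>bs. B b c *\<^sub>R d c))"
      using exp[of b] by (metis d inner_commute)
    then show "L b \<bullet> b = (\<Sum>c\<in>bs. q b c)"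
      by (simp add: q_def linear_sum[OF skew_linear] linear_scale[OF skew_linear] linear_sum[OF linear_right] linear_scale[OF linear_right])
  qed
  moreover have "(\<Sum>b\<in>bs. \<Sum>c\<in>bs. q b c) = - (\<Sum>b\<in>bs. \<Sum>c\<in>bs. q b c)"
    by (subst sum.swap) (simp add: sum_negf[symmetric] q[symmetric])
  ultimately show ?thesis by linarith
qed

end

end

section \<open>The modular class\<close>

context smooth_group
begin

section \<open>Left- and right-invariant fields together\<close>

lemma opposite: "smooth_group A bs (\<lambda>x y. m y x) e i"
  by unfold_locales (simp_all add: smooth_op_swap[OF op] inv_smooth assoc)

interpretation R: smooth_group A bs "\<lambda>x y. m y x" e i
  by (rule opposite)

lemma lie_bracket_field_opposite: "lie_bracket A (R.field X) (field Y) g = 0"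
proof (rule tangent_eqI[of UNIV])
  fix f W assume W: "open W" "g \<in> W" and f: "smooth_fun A W f"
  have "dirder A g (lie_bracket A (R.field X) (field Y) g) f = 0"
    using dirder_lie_bracket[OF R.vfield_field[of UNIV] vfield_field[of UNIV] _ _ f W, of X Y]
      dirder_lie_bracket_field[OF smooth_group_axioms opposite f W, of Y X] by simp
  then show "dirder A g (lie_bracket A (R.field X) (field Y) g) f = dirder A g 0 f"
    using linear_0[OF dirder_linear[OF f W(2)]] by simp
qed auto

text \<open>At the unit X^L and X^R have the same value. With commutation of left and right fields
  this gives X^R Y^R f = X^L Y^R f = Y^R X^L f = Y^L X^L f there, so the order is reversed.\<close>

lemma br_opposite: "R.br X Y = - br X Y"
proof (rule tangent_eqI[of UNIV])
  fix f W assume W: "open W" "e \<in> W" and f: "smooth_fun A W f"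
  have "dirder A e (R.br X Y) f = - dirder A e (br X Y) f"
    unfolding br_def R.br_def
    using dirder_lie_bracket[OF R.vfield_field[of UNIV] R.vfield_field[of UNIV] _ _ f W, of X Y]
      dirder_lie_bracket[OF vfield_field[of UNIV] vfield_field[of UNIV] _ _ f W, of X Y]
      dirder_lie_bracket_field[OF smooth_group_axioms opposite f W, of Y X]
      dirder_lie_bracket_field[OF smooth_group_axioms opposite f W, of X Y] by simp
  then show "dirder A e (R.br X Y) f = dirder A e (- br X Y) f"
    using linear_neg[OF dirder_linear[OF f W(2)]] by simp
qed auto

section \<open>Volume forms on open subsets of the group\<close>

text \<open>The wedge product of a left-invariant coframe takes the value 1 on the dual
  frame.\<close>

lemma volume_form_exists:
  assumes U: "open U" and bl: "distinct bl" "set bl = bs"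
  shows "\<exists>\<mu>. volume_form A U \<mu>"
proof -
  have len: "length bl = dim (UNIV :: 'e set)"
    using distinct_card[OF bl(1)] bl(2) onb_card[OF onb] by simp
  define \<alpha>s where "\<alpha>s = map (\<lambda>b. form (blinfun_inner_left b)) bl"
  define \<mu> where "\<mu> g vs = wedge vs (map (\<lambda>\<alpha>. \<alpha> g) \<alpha>s)" for g vs
  have "dform A U (length bl) \<mu>"
    unfolding dform_def
  proof (intro conjI ballI allI impI, goal_cases)
    case (1 p)
    then show ?case using wedge_alternating[of "map (\<lambda>\<alpha>. \<alpha> p) \<alpha>s"] by (simp add: \<mu>_def[abs_def] \<alpha>s_def)
  next
    case (2 V Xs)
    have "smooth_fun A V (\<lambda>p. blinfun_apply ((map (\<lambda>\<alpha>. \<alpha> p) \<alpha>s) ! \<sigma> i) (map (\<lambda>X. X p) Xs ! i))"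
      if "\<sigma> permutes {..<length bl}" "i < length bl" for \<sigma> i
    proof -
      have "\<sigma> i < length bl" using that permutes_in_image[OF that(1)] by auto
      moreover have "smooth_fun A V (\<lambda>p. blinfun_apply (form (blinfun_inner_left (bl ! \<sigma> i)) p) ((Xs ! i) p))"
        by (rule oneform_smooth[OF oneform_form]) (use 2 that in auto)
      ultimately show ?thesis using that 2 by (simp add: \<alpha>s_def)
    qed
    moreover have "length Xs = length bl" "open V" using 2 by auto
    ultimately show ?case unfolding \<mu>_def wedge_def length_map
      by (intro smooth_fun_sum smooth_fun_mult smooth_fun_const smooth_fun_prod) auto
  qed
  moreover have "\<mu> p (map (\<lambda>b. field b p) bl) = 1" for p
    unfolding \<mu>_def by (rule wedge_dual)
      (use bl onb_inner[OF onb] in \<open>auto simp: \<alpha>s_def nth_eq_iff_index_eq\<close>)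
  ultimately have "volume_form A U \<mu>"
    unfolding volume_form_def len by (metis len length_map zero_neq_one)
  then show ?thesis by blast
qed

text \<open>Translation from the unit to p is onto, so vanishing on the invariant frame would force
  the volume form to vanish on all lists at p.\<close>

lemma frame_nonzero:
  assumes "volume A bs U \<mu> bl" "p \<in> U"
  shows "\<mu> p (map (\<lambda>E. E p) (map field bl)) \<noteq> 0"
proof
  interpret volume A bs U \<mu> bl by fact
  assume "\<mu> p (map (\<lambda>E. E p) (map field bl)) = 0"
  then have 0: "\<mu> p (map (\<lambda>X. field X p) vs) = 0" if "length vs = length bl" for vs
    using alternating_top_eq_0[OF onb' bl(1) alternating_map[OF \<mu>_alternating[OF assms(2)] linear_field[of p]] _ that]
    by (simp add: o_def)
  have "\<mu> p bl = 0" using 0[of "map (pull p) bl"] by (simp add: o_def)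
  then show False using \<mu>_basis_nonzero[OF assms(2)] by simp
qed

lemma lie_deriv_symmetric_field:
  assumes "volume A bs U \<mu> bl" and p: "p \<in> U" and W: "vfield A U W"
    and W_eq: "\<And>q. q \<in> U \<Longrightarrow> W q = 2 *\<^sub>R (field a q - R.field a q)"
    and lin: "linear (br a)" and tr: "(\<Sum>b\<in>bs. br a b \<bullet> b) = 0" and vs: "length vs = dim (UNIV :: 'e set)"
  shows "lie_deriv A W \<mu> p vs = dirder A p (W p) (\<lambda>q. ln \<bar>\<mu> q (map (\<lambda>E. E q) (map field bl))\<bar>) * \<mu> p vs"
proof -
  interpret volume A bs U \<mu> bl by fact
  let ?E = "map field bl"
  \<comment> \<open>The right-invariant part of W commutes with left-invariant fields, so only its
    left part contributes.\<close>
  have br: "lie_bracket A W (field X) p = field (2 *\<^sub>R br a X) p" for X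
  proof (rule tangent_eqI[OF open_U p])
    fix f V assume V: "open V" "p \<in> V" "V \<subseteq> U" and f: "smooth_fun A V f"
    note lf = dirder_linear[OF f]
    note s = vfield_smooth[OF vfield_field V(1) f] vfield_smooth[OF R.vfield_field V(1) f]
    have Xf: "smooth_fun A V (\<lambda>q. dirder A q (field X q) f)" by (rule s)
    have Wf: "dirder A p v (\<lambda>q. dirder A q (W q) f) =
      2 * (dirder A p v (\<lambda>q. dirder A q (field a q) f) - dirder A p v (\<lambda>q. dirder A q (R.field a q) f))" for v
    proof -
      have "dirder A p v (\<lambda>q. dirder A q (W q) f) = dirder A p v (\<lambda>q. 2 * (dirder A q (field a q) f - dirder A q (R.field a q) f))"
        by (rule dirder_cong[OF vfield_smooth[OF vfield_subset[OF W V(3)] V(1) f] V(1,2)])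
          (use V(3) in \<open>auto simp: W_eq subset_iff linear_scale[OF lf] linear_diff[OF lf]\<close>)
      also have "\<dots> = 2 * (dirder A p v (\<lambda>q. dirder A q (field a q) f) - dirder A p v (\<lambda>q. dirder A q (R.field a q) f))"
        by (rule dirder_scaled_diff[OF V(1,2) s])
      finally show ?thesis .
    qed
    have "dirder A p (lie_bracket A W (field X) p) f =
      2 * (dirder A p (lie_bracket A (field a) (field X) p) f - dirder A p (lie_bracket A (R.field a) (field X) p) f)"
      using dirder_lie_bracket[OF W vfield_field open_U p f V(1,2), of X]
        dirder_lie_bracket[OF vfield_field vfield_field open_U p f V(1,2), of a X]
        dirder_lie_bracket[OF R.vfield_field vfield_field open_U p f V(1,2), of a X]
      by (simp add: Wf W_eq[OF p] linear_scale[OF dirder_linear[OF Xf V(2)]] linear_diff[OF dirder_linear[OF Xf V(2)]])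
    then show "dirder A p (lie_bracket A W (field X) p) f = dirder A p (field (2 *\<^sub>R br a X) p) f"
      by (simp add: lie_bracket_field lie_bracket_field_opposite linear_scale[OF linear_field] linear_scale[OF lf[OF V(2)]] linear_0[OF lf[OF V(2)]])
  qed
  have "(\<Sum>i<length bl. \<mu> p ((map (\<lambda>E. E p) ?E)[i := lie_bracket A W (?E ! i) p])) =
    (\<Sum>i<length bl. \<mu> p (map (\<lambda>X. field X p) (bl[i := 2 *\<^sub>R br a (bl ! i)])))"
    by (intro sum.cong refl) (simp add: br map_update o_def)
  \<comment> \<open>Translated to the unit, the volume form at p is a form of top degree on the Lie
    algebra, and twice the adjoint map acts on it as a derivation.\<close>
  also have "\<dots> = (\<Sum>b\<in>set bl. (2 *\<^sub>R br a b) \<bullet> b) * \<mu> p (map (\<lambda>X. field X p) bl)"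
    by (rule alternating_trace[OF onb' bl(1) alternating_map[OF \<mu>_alternating[OF p] linear_field[of p]] linear_compose_scale_right[OF lin] refl])
  also have "\<dots> = 0"
    using tr bl(2) by (simp add: sum_distrib_left[symmetric])
  finally have 0: "(\<Sum>i<length bl. \<mu> p ((map (\<lambda>E. E p) ?E)[i := lie_bracket A W (?E ! i) p])) = 0" .
  have sE: "smooth_fun A U (\<lambda>q. \<mu> q (map (\<lambda>E. E q) ?E))"
    by (rule \<mu>_smooth[OF open_U order_refl]) (auto intro: vfield_field)
  have vE: "\<And>E. E \<in> set ?E \<Longrightarrow> vfield A U E" by (auto intro: vfield_field)
  have "lie_deriv A W \<mu> p vs * \<mu> p (map (\<lambda>E. E p) ?E) = dirder A p (W p) (\<lambda>q. \<mu> q (map (\<lambda>E. E q) ?E)) * \<mu> p vs"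
    using lie_deriv_frame[of W p vs ?E, OF W p _ _ vE] vs unfolding 0 by (simp add: length_bl)
  then show ?thesis
    using frame_nonzero[OF assms(1) p] unfolding dirder_ln_abs[OF sE p frame_nonzero[OF assms(1) p]]
    by (simp add: nonzero_eq_divide_eq)
qed

section \<open>Vanishing of the modular class\<close>

text \<open>The hypothesis \<open>sep\<close> says that the covectors \<alpha>^L + \<alpha>^R span
  the cotangent space. The same bracket occurs in both conditions on \<open>\<psi>\<close>, since
  either translation reduces to the value at the unit.\<close>

lemma unimodular_symmetric_bivector:
  fixes B :: "'e \<Rightarrow> 'e \<Rightarrow> real"
  assumes B: "metric bs B" and inv: "\<And>x y z. B (br z x) y + B x (br z y) = 0"
    and U: "open U" and \<pi>: "mvfield A U 2 \<pi>"
    and sharp: "\<And>q \<alpha>. q \<in> U \<Longrightarrow> sharp (\<pi> q) (form \<alpha> q + R.form \<alpha> q) =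
      2 *\<^sub>R (field (metric_dual B \<alpha>) q - R.field (metric_dual B \<alpha>) q)"
    and sep: "\<And>q v. q \<in> U \<Longrightarrow> (\<And>\<alpha>. blinfun_apply (form \<alpha> q + R.form \<alpha> q) v = 0) \<Longrightarrow> v = 0"
    and \<psi>: "\<And>q. alternating 3 (\<psi> q)"
    and \<psi>L: "\<And>q X Y Z. \<psi> q [field X q, field Y q, field Z q] = 1/2 * B X (br Y Z)"
    and \<psi>R: "\<And>q X Y Z. \<psi> q [R.field X q, R.field Y q, R.field Z q] = 1/2 * B X (br Y Z)"
  shows "unimodular A U \<pi> \<psi>"
  unfolding unimodular_def
proof (intro conjI allI impI)
  interpret B: metric bs B by fact
  obtain bl where bl: "set bl = bs" "distinct bl"
    using finite_distinct_list[OF onb_finite[OF onb]] by blast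
  show "\<exists>\<mu>. volume_form A U \<mu>" by (rule volume_form_exists[OF U bl(2,1)])
  fix \<mu> assume \<mu>: "volume_form A U \<mu>"
  interpret V: volume A bs U \<mu> bl by unfold_locales (use U \<mu> bl in auto)
  define n where "n q = \<mu> q (map (\<lambda>E. E q) (map field bl))" for q
  define f where "f q = ln \<bar>n q\<bar>" for q
  have n: "smooth_fun A U n"
    unfolding n_def by (rule V.\<mu>_smooth[OF U order_refl]) (auto intro: vfield_field)
  have f: "smooth_fun A U f"
    unfolding f_def by (rule smooth_fun_ln_abs[OF U n]) (use frame_nonzero[OF V.volume_axioms] in \<open>simp add: n_def\<close>)
  show "cohomology_class A U \<pi> (Z_field A U \<pi> \<psi> \<mu>) = cohomology_class A U \<pi> (\<lambda>p. 0)"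
  proof (rule cohomology_class_coboundary[OF U \<pi> f])
    fix p assume p: "p \<in> U"
    note P = mvfield_alternating[OF \<pi> p]
    obtain vs where vs: "length vs = dim (UNIV :: 'e set)" "\<mu> p vs \<noteq> 0"
      using \<mu> p unfolding volume_form_def by blast
    define X where "X = X_field A U \<pi> \<mu> p"
    have X: "\<forall>\<alpha> vs. oneform A U \<alpha> \<and> length vs = dim (UNIV :: 'e set) \<longrightarrow>
      blinfun_apply (\<alpha> p) X * \<mu> p vs = lie_deriv A (\<lambda>q. sharp (\<pi> q) (\<alpha> q)) \<mu> p vs
       - contract (\<pi> p) (ext_deriv A (form_of \<alpha>) p) [] * \<mu> p vs"
      unfolding X_def X_field_def
    proof (rule theI', rule ex_ex1I[OF V.X_field_exists[OF \<pi> p]], goal_cases)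
      case (1 v w)
      \<comment> \<open>Uniqueness is tested on left-invariant forms, whose values fill the
        cotangent space at p, and on one list where the volume form is nonzero.\<close>
      have "blinfun_apply \<alpha> (pull p v) = blinfun_apply \<alpha> (pull p w)" for \<alpha> :: "'e \<Rightarrow>\<^sub>L real"
      proof -
        have "blinfun_apply (form \<alpha> p) v * \<mu> p vs = blinfun_apply (form \<alpha> p) w * \<mu> p vs"
          using 1[rule_format, of "form \<alpha>" vs] oneform_form vs(1) by simp
        then show ?thesis using vs(2) by (simp add: form_apply)
      qed
      then have "pull p v = pull p w" by (rule blinfun_separates)
      then show ?case by (metis field_pull)
    qed
    have "blinfun_apply (form \<alpha> p + R.form \<alpha> p) (X + Y_field \<pi> \<psi> p - bracket_fun A \<pi> f p) = 0" for \<alpha>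
    proof -
      define a where "a = metric_dual B \<alpha>"
      define \<theta> where "\<theta> q = form \<alpha> q + R.form \<alpha> q" for q
      define W where "W q = sharp (\<pi> q) (\<theta> q)" for q
      have W_eq: "W q = 2 *\<^sub>R (field a q - R.field a q)" if "q \<in> U" for q
        unfolding W_def \<theta>_def a_def by (rule sharp[OF that])
      have \<theta>: "oneform A U \<theta>"
        unfolding oneform_def \<theta>_def blinfun.add_left
        by (intro allI impI smooth_fun_add oneform_smooth[OF oneform_form] oneform_smooth[OF R.oneform_form]) auto
      have W: "vfield A U W" unfolding W_def by (rule vfield_sharp[OF \<pi> U \<theta>])
      have \<alpha>: "blinfun_apply \<alpha> y = B a y" for y unfolding a_def B.metric_dual_apply ..
      \<comment> \<open>The number (i_\<pi> \<psi>)(W), evaluated at p.\<close>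
      define C where "C = (\<Sum>(x, y)\<leftarrow>wedge_sum (\<pi> p). \<psi> p [y, x, W p])"
      \<comment> \<open>A cyclic shift is two transpositions; it moves the invariant field from the
        first slot to the last.\<close>
      have cyc: "\<psi> p [x, y, z] = \<psi> p [z, x, y]" for x y z
        using alternating_swap[OF \<psi>[of p], of "[x, y, z]" 0 2 x z] alternating_swap[OF \<psi>[of p], of "[z, y, x]" 1 2 y x] by simp
      have lin: "linear (\<lambda>z. \<psi> p [x, y, z])" for x y
        using alternating_linear[OF \<psi>[of p], of "[x, y, 0]" 2] by simp
      have "ext_deriv A (form_of \<theta>) p [y, x] = - \<psi> p [y, x, W p]" for x y
      proof -
        have s: "smooth_fun A (U \<inter> fst (chart_at A p)) (\<lambda>q. blinfun_apply (form \<alpha> q) (coord_ext A p v q))"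
          "smooth_fun A (U \<inter> fst (chart_at A p)) (\<lambda>q. blinfun_apply (R.form \<alpha> q) (coord_ext A p v q))" for v
          by (intro smooth_fun_oneform_coord[OF oneform_form U] smooth_fun_oneform_coord[OF R.oneform_form U])+
        have "ext_deriv A (form_of \<theta>) p [y, x] = ext_deriv A (form_of (form \<alpha>)) p [y, x] + ext_deriv A (form_of (R.form \<alpha>)) p [y, x]"
          unfolding ext_deriv_oneform_pair \<theta>_def blinfun.add_left
          using dirder_add[OF s, of p] p by simp
        \<comment> \<open>The factor 2 undoes the 1/2 in the Cartan form.\<close>
        moreover have "ext_deriv A (form_of (form \<alpha>)) p [y, x] = - 2 * \<psi> p [y, x, field a p]"
          using ext_deriv_form[of \<alpha> p "pull p y" "pull p x"] \<psi>L[of p a "pull p y" "pull p x"] cyc[of y x "field a p"]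
          by (simp add: \<alpha>)
        \<comment> \<open>The sign of the opposite bracket cancels the minus sign in
          \<open>R.ext_deriv_form\<close>. The sum of both contributions therefore contains the
          difference of the two fields, which is half of W.\<close>
        moreover have "ext_deriv A (form_of (R.form \<alpha>)) p [y, x] = 2 * \<psi> p [y, x, R.field a p]"
          using R.ext_deriv_form[of \<alpha> p "R.pull p y" "R.pull p x"] \<psi>R[of p a "R.pull p y" "R.pull p x"] cyc[of y x "R.field a p"]
          by (simp add: \<alpha> br_opposite linear_neg[OF B.linear_right])
        ultimately show ?thesis
          by (simp add: W_eq[OF p] linear_scale[OF lin] linear_diff[OF lin])
      qed
      then have con: "contract (\<pi> p) (ext_deriv A (form_of \<theta>) p) [] = - C"
        unfolding contract_def C_def by (simp add: case_prod_unfold uminus_sum_list_map o_def)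
      have "lie_deriv A W \<mu> p vs = dirder A p (W p) f * \<mu> p vs"
        unfolding f_def n_def
        by (rule lie_deriv_symmetric_field[OF V.volume_axioms p W W_eq B.skew_linear[OF inv] B.skew_trace[OF inv] vs(1)])
      then have "blinfun_apply (\<theta> p) X * \<mu> p vs = (dirder A p (W p) f + C) * \<mu> p vs"
        using X[rule_format, of \<theta> vs] \<theta> vs(1) con by (simp add: W_def[abs_def] algebra_simps)
      then have \<theta>X: "blinfun_apply (\<theta> p) X = dirder A p (W p) f + C" using vs(2) by simp
      have linc: "linear (\<lambda>v. contract (\<pi> p) (\<psi> p) [v])"
      proof -
        have "linear (\<lambda>v. \<Sum>(x, y)\<leftarrow>xys. \<psi> p [y, x, v])" for xys
          by (induction xys) (auto intro!: linear_compose_add lin linear_zero)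
        then show ?thesis by (simp add: contract_def)
      qed
      have \<beta>: "blinfun_apply (Blinfun (\<lambda>v. contract (\<pi> p) (\<psi> p) [v])) v = contract (\<pi> p) (\<psi> p) [v]" for v
        using onb_bounded_linear[OF onb linc] by (simp add: bounded_linear_Blinfun_apply)
      \<comment> \<open>\<pi>^# is skew: pairing \<theta> with the image of i_\<pi> \<psi> is minus
        the value of i_\<pi> \<psi> on W. This is the sign opposite to that of C in
        \<open>\<theta>X\<close>.\<close>
      have "blinfun_apply (\<theta> p) (Y_field \<pi> \<psi> p) = - contract (\<pi> p) (\<psi> p) [W p]"
        unfolding Y_field_def sharp_apply[OF onb P] bivector_linear(3)[OF P, of _ "\<theta> p"]
        using sharp_apply[OF onb P, of "Blinfun (\<lambda>v. contract (\<pi> p) (\<psi> p) [v])" "\<theta> p"] by (simp add: \<beta> W_def)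
      then have "blinfun_apply (\<theta> p) (Y_field \<pi> \<psi> p) = - C" by (simp add: contract_def C_def)
      with \<theta>X bracket_fun_apply[of \<pi> p U f "\<theta> p", OF P f p]
      have "blinfun_apply (\<theta> p) (X + Y_field \<pi> \<psi> p - bracket_fun A \<pi> f p) = 0"
        by (simp add: blinfun.add_right blinfun.diff_right W_def)
      then show ?thesis by (simp add: \<theta>_def)
    qed
    from sep[OF p this] show "Z_field A U \<pi> \<psi> \<mu> p = bracket_fun A \<pi> f p"
      by (simp add: Z_field_def X_def)
  qed
qed

end

theorem proposition8p1:
  fixes G :: "('g::t2_space, 'm) monoid_scheme"
    and A :: "('g, 'e::real_inner) chart set"
    and B :: "'e \<Rightarrow> 'e \<Rightarrow> real"
    and \<pi> :: "'g \<Rightarrow> ('e \<Rightarrow>\<^sub>L real) list \<Rightarrow> real"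
    and \<psi> :: "'g \<Rightarrow> 'e list \<Rightarrow> real"
  assumes "lie_group G A"
    and "invariant_metric G A B"
    and "mvfield A (G_zero G A) 2 \<pi>"
    and "\<And>g \<alpha>. g \<in> G_zero G A \<Longrightarrow>
           sharp (\<pi> g) (left_form G A \<alpha> g + right_form G A \<alpha> g) =
             2 *\<^sub>R (left_field G A (metric_dual B \<alpha>) g - right_field G A (metric_dual B \<alpha>) g)"
    and "dform A UNIV 3 \<psi>"
    and "bi_invariant G A 3 \<psi>"
    and "\<And>X Y Z. \<psi> \<one>\<^bsub>G\<^esub> [X, Y, Z] = 1/2 * B X (Lie_br G A Y Z)"
    and "twisted_poisson A (G_zero G A) \<pi> \<psi>"
  shows "unimodular A (G_zero G A) \<pi> \<psi>"
proof -
  interpret lie_group G A by fact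
  obtain bs :: "'e set" where bs: "onb bs" using finite_dim onb_exists by blast
  interpret manifold A bs by unfold_locales (use atlas bs in auto)
  have [simp]: "x \<in> carrier G" for x by (simp add: carrier)
  interpret L: smooth_group A bs "mult G" "\<one>\<^bsub>G\<^esub>" "m_inv G"
    by unfold_locales (simp_all add: smooth_op_prod[OF smooth_mult] smooth_inv m_assoc)
  interpret R: smooth_group A bs "\<lambda>x y. y \<otimes>\<^bsub>G\<^esub> x" "\<one>\<^bsub>G\<^esub>" "m_inv G"
    by (rule L.opposite)
  have L_field: "left_field G A = L.field" "left_form G A = L.form"
    by (simp_all add: fun_eq_iff left_field_def L.field_def left_form_def L.form_def L.pull_def)
  have L: "left_field G A = L.field" "left_form G A = L.form" "Lie_br G A = L.br"
    by (simp_all add: L_field fun_eq_iff Lie_br_def L.br_def)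
  have R: "right_field G A = R.field" "right_form G A = R.form"
    by (simp_all add: fun_eq_iff right_field_def R.field_def right_form_def R.form_def R.pull_def)
  show ?thesis
  proof (rule L.unimodular_symmetric_bivector)
    show "metric bs B"
      using assms(2) bs by unfold_locales (auto simp: invariant_metric_def)
    show "B (L.br z x) y + B x (L.br z y) = 0" for x y z
      using assms(2) unfolding invariant_metric_def L by blast
    show "open (G_zero G A)" using assms(8) by (simp add: twisted_poisson_def)
    show "mvfield A (G_zero G A) 2 \<pi>" by fact
    show "sharp (\<pi> q) (L.form \<alpha> q + R.form \<alpha> q) = 2 *\<^sub>R (L.field (metric_dual B \<alpha>) q - R.field (metric_dual B \<alpha>) q)"
      if "q \<in> G_zero G A" for q \<alpha>
      using assms(4)[OF that] by (simp add: L R)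
    show "alternating 3 (\<psi> q)" for q using assms(5) by (simp add: dform_def)
    \<comment> \<open>Bi-invariance with base point the unit: translation by q carries the Lie
      algebra elements to the invariant fields at q.\<close>
    show "\<psi> q [L.field X q, L.field Y q, L.field Z q] = 1/2 * B X (L.br Y Z)" for q X Y Z
      using assms(6)[unfolded bi_invariant_def, rule_format, of "[X, Y, Z]" q "\<one>\<^bsub>G\<^esub>"] assms(7)[of X Y Z]
      by (simp add: L.field_def L)
    show "\<psi> q [R.field X q, R.field Y q, R.field Z q] = 1/2 * B X (L.br Y Z)" for q X Y Z
      using assms(6)[unfolded bi_invariant_def, rule_format, of "[X, Y, Z]" q "\<one>\<^bsub>G\<^esub>"] assms(7)[of X Y Z]
      by (simp add: R.field_def L)
    fix q v assume q: "q \<in> G_zero G A" and 0: "\<And>\<alpha>. blinfun_apply (L.form \<alpha> q + R.form \<alpha> q) v = 0"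
    define u where "u = L.pull q v"
    \<comment> \<open>All covectors vanish on the sum, so the left and right translates of v to the
      unit are opposite.\<close>
    have "L.pull q v + R.pull q v = 0"
      by (rule blinfun_separates) (use 0 in \<open>simp add: blinfun.add_left blinfun.add_right L.form_apply R.form_apply blinfun.zero_right\<close>)
    then have "R.pull q (L.field u q) = - u" by (simp add: u_def add_eq_0_iff)
    moreover have "R.pull q (L.field u q) = Ad G A q u"
    proof -
      \<comment> \<open>Left translation by q followed by right translation back to the unit is
        conjugation by q. So u satisfies Ad_q u = -u, which is excluded on G_0 unless u = 0.\<close>
      have eq: "(\<lambda>x. x \<otimes>\<^bsub>G\<^esub> inv\<^bsub>G\<^esub> q) \<circ> mult G q = (\<lambda>x. q \<otimes>\<^bsub>G\<^esub> x \<otimes>\<^bsub>G\<^esub> inv\<^bsub>G\<^esub> q)"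
        by auto
      from tangent_map_compose[OF smooth_map_translation[OF R.op, of "inv\<^bsub>G\<^esub> q"] smooth_map_translation[OF L.op, of q], where p = "\<one>\<^bsub>G\<^esub>" and v = u]
      show ?thesis by (simp add: eq Ad_def R.pull_def L.field_def)
    qed
    ultimately have "u = 0" using q by (auto simp: G_zero_def)
    then show "v = 0" using L.field_pull[of q v] linear_0[OF L.linear_field] by (simp add: u_def)
  qed
qed

end
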